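(* The algebra of coinvariants for the coaction $\delta_L$, $$\{a\in \mathcal B(\mathrm{SL}_\theta(2,\mathbb H))\rtimes H_F \mid \delta_L(a)=1\otimes a\},$$ is isomorphic to the subalgebra $\mathcal B(\mathsf M_\theta)\rtimes H_F$ of $\mathcal B(\mathrm{SL}_\theta(2,\mathbb H))\rtimes H_F$, where $\mathcal B(\mathsf M_\theta)$ is the subalgebra of $\mathcal B(\mathrm{SL}_\theta(2,\mathbb H))$ generated by the elements $$\mathsf m_{ij}:=\sum_\alpha(\widehat A_{\alpha i})^*\,\underline\cdot\,\widehat A_{\alpha j},\qquad i,j=1,\dots,4.$$
   Context: **Torus and twist.** Fix $\theta\in\mathbb R$. $H=\mathcal A(\mathbb T^2)$ is the Hopf $*$-algebra of Laurent polynomials in commuting $t_1,t_2$, $t_j^*=t_j^{-1}$, with all monomials $t^a=t_1^{a_1}t_2^{a_2}$ group-like. $(\tau_1,\tau_2,\tau_3,\tau_4):=(t_1,t_1^*,t_2,t_2^* )$. $F(t^a,t^b)=\exp(\tfrac{i\pi\theta}{2}(a_1b_2-a_2b_1))$; $F^{-2}(g,h):=F(g,h)^{-2}$ on group-likes. $H_F$ equals $H$ as a Hopf $*$-algebra, with coquasitriangular structure $F^{-2}$. For a left comodule, $v$ is homogeneous of degree $|v|$ if its coaction is $v\mapsto|v|\otimes v$. The cotwist of a commutative $H$-comodule $*$-algebra is the same vector space (and $*$) with product $a\cdot_F b=F(|a|,|b|)ab$. The braided tensor product $B\underline\otimes C$ of comodule algebras is $B\otimes C$ with $(a\otimes b)(c\otimes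 d)=F^{-2}(|c|,|b|)\,ac\otimes bd$. **Braided groups.** $\mathcal A(\mathrm M(2,\mathbb H))$ is the commutative $*$-algebra generated by the entries of the $4\times4$ matrix $A=(A_{ij})$ with rows $(a_1,-a_2^*,b_1,-b_2^* )$, $(a_2,a_1^*,b_2,b_1^* )$, $(c_1,-c_2^*,d_1,-d_2^* )$, $(c_2,c_1^*,d_2,d_1^* )$, with matrix coproduct and $H$-coaction $A_{ij}\mapsto\tau_i\tau_j^*\otimes A_{ij}$. $\mathcal A(\mathrm{SL}(2,\mathbb H))$ is its quotient by $\det A=1$, and $\mathcal A(\mathrm{Sp}(2))$ the further quotient by the relations $\sum_\alpha(A^* )_{i\alpha}A_{\alpha j}=\delta_{ij}$. $\mathcal B(\mathrm{SL}_\theta(2,\mathbb H))$ and $\mathcal B(\mathrm{Sp}_\theta(2))$ are their cotwists, with product $\underline\cdot$; $\Pi_\theta:\mathcal B(\mathrm{SL}_\theta(2,\mathbb H))\to\mathcal B(\mathrm{Sp}_\theta(2))$ is the canonical projection. With $\widehat A_{ij}=F^{-1}(\tau_i,\tau_j)A_{ij}$ the braided coproduct is the algebra map $\Delta_F$ into the braided tensor product with $\Delta_F(\widehat A_{ij})=\sum_\alpha\widehat A_{i\alpha}\otimes\widehat A_{\alpha j}$, written $\Delta_F(a)=a_{(\underline1)}\otimes a_{(\underline2)}$. **Cobosonisation.** For a comodule subalgebra $K$ of $\mathcal B(\mathrm{SL}_\theta(2,\mathbb H))$, $K\rtimes H_F$ is the vector space $K\otimes H_F$ with product $(a\otimes g)(b\otimes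 h)=F^{-2}(|b|,g)\,a\,\underline\cdot\,b\otimes gh$ for homogeneous $a,b$ and group-like $g,h$. It is a left $H_F$-comodule by the tensor product coaction ($|a\otimes h|=|a|h$). **Coaction.** $\delta_L:\mathcal B(\mathrm{SL}_\theta(2,\mathbb H))\rtimes H_F\to \mathcal B(\mathrm{Sp}_\theta(2))\,\underline\otimes\,(\mathcal B(\mathrm{SL}_\theta(2,\mathbb H))\rtimes H_F)$ is the braided left coaction $\delta_L(a\otimes h)=\Pi_\theta(a_{(\underline1)})\otimes a_{(\underline2)}\otimes h$. *)

theory Defs
  imports
    "HOL-Analysis.Determinants"
    "HOL-Library.Poly_Mapping"
    "HOL-Library.Product_Plus"
    "HOL-Algebra.Module"
    "HOL-Algebra.QuotRing"
begin

class complex_module = ab_group_add +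
  fixes cscale :: "complex \<Rightarrow> 'a \<Rightarrow> 'a"  (infixr \<open>*\<^sub>C\<close> 75)
  assumes cscale_add_right: "c *\<^sub>C (x + y) = c *\<^sub>C x + c *\<^sub>C y"
    and cscale_add_left: "(c + d) *\<^sub>C x = c *\<^sub>C x + d *\<^sub>C x"
    and cscale_cscale: "c *\<^sub>C d *\<^sub>C x = (c * d) *\<^sub>C x"
    and cscale_one: "1 *\<^sub>C x = x"

interpretation cvs: vector_space "cscale :: complex \<Rightarrow> 'a \<Rightarrow> 'a::complex_module"
  by standard (simp_all add: cscale_add_right cscale_add_left cscale_cscale cscale_one)

abbreviation cspan :: "'a::complex_module set \<Rightarrow> 'a set"
  where "cspan \<equiv> module.span cscale"

abbreviation clinear :: "('a::complex_module \<Rightarrow> 'b::complex_module) \<Rightarrow> bool"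
  where "clinear \<equiv> module_hom cscale cscale"

class complex_algebra = complex_module + comm_ring_1 +
  assumes cscale_mult_left: "(c *\<^sub>C x) * y = c *\<^sub>C (x * y)"

instantiation complex :: complex_algebra
begin
definition cscale_complex :: "complex \<Rightarrow> complex \<Rightarrow> complex"
  where "cscale_complex = (*)"
instance by standard (simp_all add: cscale_complex_def algebra_simps)
end

instantiation poly_mapping :: (type, complex_module) complex_module
begin
lift_definition cscale_poly_mapping :: "complex \<Rightarrow> ('a \<Rightarrow>\<^sub>0 'b) \<Rightarrow> ('a \<Rightarrow>\<^sub>0 'b)"
  is "\<lambda>c f k. c *\<^sub>C f k"
  by (rule finite_subset[rotated]) auto
instance
  by standard (transfer; simp add: fun_eq_iff cscale_add_right cscale_add_left cscale_cscale cscale_one)+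
end

lemma lookup_cscale [simp]: "Poly_Mapping.lookup (c *\<^sub>C p) k = c *\<^sub>C Poly_Mapping.lookup p k"
  by transfer simp

lemma cscale_single: "c *\<^sub>C Poly_Mapping.single k x = Poly_Mapping.single k (c *\<^sub>C x)"
  by (rule poly_mapping_eqI) (simp add: lookup_single when_def)

lemma poly_mapping_single_induct [case_names zero single_plus]:
  assumes "P 0" and "\<And>k c p. P p \<Longrightarrow> P (Poly_Mapping.single k c + p)"
  shows "P (p :: 'a \<Rightarrow>\<^sub>0 'b::comm_monoid_add)"
proof (induction p rule: update_induct)
  case const
  show ?case by (rule assms(1))
next
  case (update f a b)
  have "Poly_Mapping.update a b f = Poly_Mapping.single a b + f"
    using update(1)
    by (intro poly_mapping_eqI)
      (auto simp: lookup_update lookup_add lookup_single when_def in_keys_iff)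
  then show ?case using assms(2)[OF update(3)] by simp
qed

instance poly_mapping :: (comm_monoid_add, complex_algebra) complex_algebra
proof
  fix c and x y :: "'a \<Rightarrow>\<^sub>0 'b"
  have 1: "c *\<^sub>C Poly_Mapping.single k u * q = c *\<^sub>C (Poly_Mapping.single k u * q)"
    for k u and q :: "'a \<Rightarrow>\<^sub>0 'b"
    by (induction q rule: poly_mapping_single_induct)
      (simp_all add: distrib_left mult_single cscale_single cscale_mult_left cscale_add_right)
  show "c *\<^sub>C x * y = c *\<^sub>C (x * y)"
    by (induction x rule: poly_mapping_single_induct)
      (simp_all add: cscale_add_right distrib_right 1)
qed

lemma cscale_mult_right: "x * (c *\<^sub>C y) = c *\<^sub>C (x * (y::'a::complex_algebra))"
  by (metis cscale_mult_left mult.commute)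

lemma lookup_map_zero:
  "f 0 = 0 \<Longrightarrow> Poly_Mapping.lookup (Poly_Mapping.map f p) k = f (Poly_Mapping.lookup p k)"
  by (simp add: Poly_Mapping.map.rep_eq when_def)

lemma map_additive:
  assumes "\<And>x y. f (x + y) = f x + f y" "f 0 = 0"
  shows "Poly_Mapping.map f (p + q) = Poly_Mapping.map f p + Poly_Mapping.map f q"
  by (rule poly_mapping_eqI) (simp add: lookup_map_zero lookup_add assms)

lemma map_single_zero:
  "f 0 = 0 \<Longrightarrow> Poly_Mapping.map f (Poly_Mapping.single k c) = Poly_Mapping.single k (f c)"
  by (rule poly_mapping_eqI) (simp add: lookup_map_zero lookup_single when_def)

lemma map_multiplicative:
  fixes f :: "'a::comm_ring_1 \<Rightarrow> 'b::comm_ring_1" and p q :: "'k::comm_monoid_add \<Rightarrow>\<^sub>0 'a"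
  assumes add: "\<And>x y. f (x + y) = f x + f y" and zero: "f 0 = 0"
    and mult: "\<And>x y. f (x * y) = f x * f y"
  shows "Poly_Mapping.map f (p * q) = Poly_Mapping.map f p * Poly_Mapping.map f q"
proof -
  have [simp]: "Poly_Mapping.map f 0 = 0" for f :: "'a \<Rightarrow> 'b"
    by (rule poly_mapping_eqI) (simp add: Poly_Mapping.map.rep_eq)
  have 1: "Poly_Mapping.map f (Poly_Mapping.single k u * q)
      = Poly_Mapping.map f (Poly_Mapping.single k u) * Poly_Mapping.map f q" for k u q
    by (induction q rule: poly_mapping_single_induct)
      (simp_all add: distrib_left mult_single map_additive[OF add zero] map_single_zero[of f, OF zero] mult)
  show ?thesis
    by (induction p rule: poly_mapping_single_induct)
      (simp_all add: distrib_right map_additive[OF add zero] 1)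
qed


definition lin_ext :: "('k \<Rightarrow> 'c::complex_module) \<Rightarrow> ('k \<Rightarrow>\<^sub>0 complex) \<Rightarrow> 'c"
  where "lin_ext f p = (\<Sum>k\<in>Poly_Mapping.keys p. Poly_Mapping.lookup p k *\<^sub>C f k)"

lemma lin_ext_superset:
  "finite S \<Longrightarrow> Poly_Mapping.keys p \<subseteq> S \<Longrightarrow>
    lin_ext f p = (\<Sum>k\<in>S. Poly_Mapping.lookup p k *\<^sub>C f k)"
  unfolding lin_ext_def by (rule sum.mono_neutral_left) (auto simp: in_keys_iff)

lemma lin_ext_zero [simp]: "lin_ext f 0 = 0"
  by (simp add: lin_ext_def)

lemma lin_ext_single [simp]: "lin_ext f (Poly_Mapping.single k c) = c *\<^sub>C f k"
  by (simp add: lin_ext_superset[of "{k}"])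

lemma lin_ext_add: "lin_ext f (p + q) = lin_ext f p + lin_ext f q"
  using Poly_Mapping.keys_add[of p q]
  by (simp add: lin_ext_superset[of "Poly_Mapping.keys p \<union> Poly_Mapping.keys q"]
      lookup_add cscale_add_left sum.distrib)

lemma lin_ext_cscale: "lin_ext f (c *\<^sub>C p) = c *\<^sub>C lin_ext f p"
  by (induction p rule: poly_mapping_single_induct)
    (simp_all add: cscale_add_right lin_ext_add cscale_single cscale_cscale cscale_complex_def)

lemma clinear_lin_ext: "clinear (lin_ext f)"
  by unfold_locales (simp_all add: lin_ext_add lin_ext_cscale)

lemma cspan_eqI: "p = q \<Longrightarrow> p - q \<in> cspan S"
  by (simp add: cvs.span_zero)

lemma equivp_cspan: "equivp (\<lambda>p q. p - q \<in> cspan S)"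
proof (rule equivpI)
  show "reflp (\<lambda>p q. p - q \<in> cspan S)"
    by (simp add: reflp_def cvs.span_zero)
  show "symp (\<lambda>p q. p - q \<in> cspan S)"
  proof (rule sympI)
    fix p q assume "p - q \<in> cspan S"
    from cvs.span_neg[OF this] show "q - p \<in> cspan S" by simp
  qed
  show "transp (\<lambda>p q. p - q \<in> cspan S)"
  proof (rule transpI)
    fix p q r assume "p - q \<in> cspan S" "q - r \<in> cspan S"
    from cvs.span_add[OF this] show "p - r \<in> cspan S" by simp
  qed
qed

lemma cspan_cong:
  assumes "p - p' \<in> cspan S"
  shows "q - q' \<in> cspan S \<Longrightarrow> (p + q) - (p' + q') \<in> cspan S"
    and "q - q' \<in> cspan S \<Longrightarrow> (p - q) - (p' - q') \<in> cspan S"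
    and "- p - - p' \<in> cspan S"
    and "c *\<^sub>C p - c *\<^sub>C p' \<in> cspan S"
proof -
  show "(p + q) - (p' + q') \<in> cspan S" if "q - q' \<in> cspan S"
    using cvs.span_add[OF assms that] by (simp only: add_diff_add)
  show "(p - q) - (p' - q') \<in> cspan S" if "q - q' \<in> cspan S"
  proof -
    have eq: "(p - q) - (p' - q') = (p - p') - (q - q')"
      by (simp add: algebra_simps)
    show ?thesis unfolding eq by (rule cvs.span_diff[OF assms that])
  qed
  show "- p - - p' \<in> cspan S"
    using cvs.span_neg[OF assms] by (simp only: minus_diff_minus)
  show "c *\<^sub>C p - c *\<^sub>C p' \<in> cspan S"
    using cvs.span_scale[OF assms] by (simp only: cvs.scale_right_diff_distrib)
qed

definition tensor_relators ::
    "(('a::complex_module \<times> 'b::complex_module) \<Rightarrow>\<^sub>0 complex) set"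
  where "tensor_relators =
    (let s = (\<lambda>a b. Poly_Mapping.single (a, b) (1::complex)) in
      {s (a + a') b - s a b - s a' b | a a' b. True} \<union>
      {s a (b + b') - s a b - s a b' | a b b'. True} \<union>
      {s (c *\<^sub>C a) b - c *\<^sub>C s a b | c a b. True} \<union>
      {s a (c *\<^sub>C b) - c *\<^sub>C s a b | c a b. True})"

quotient_type (overloaded) ('a, 'b) tensor =
    "('a::complex_module \<times> 'b::complex_module) \<Rightarrow>\<^sub>0 complex" /
    "\<lambda>p q. p - q \<in> cspan tensor_relators"
  by (rule equivp_cspan)

instantiation tensor :: (complex_module, complex_module) complex_module
begin

lift_definition zero_tensor :: "('a, 'b) tensor" is 0 .

lift_definition plus_tensor :: "('a, 'b) tensor \<Rightarrow> ('a, 'b) tensor \<Rightarrow> ('a, 'b) tensor" is "(+)"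
  by (rule cspan_cong(1))

lift_definition uminus_tensor :: "('a, 'b) tensor \<Rightarrow> ('a, 'b) tensor" is uminus
  by (rule cspan_cong(3))

lift_definition minus_tensor :: "('a, 'b) tensor \<Rightarrow> ('a, 'b) tensor \<Rightarrow> ('a, 'b) tensor" is "(-)"
  by (rule cspan_cong(2))

lift_definition cscale_tensor :: "complex \<Rightarrow> ('a, 'b) tensor \<Rightarrow> ('a, 'b) tensor" is cscale
  by (rule cspan_cong(4))

instance
proof
  fix x y z :: "('a, 'b) tensor" and c d :: complex
  show "x + y + z = x + (y + z)"
    by transfer (rule cspan_eqI, rule add.assoc)
  show "x + y = y + x"
    by transfer (rule cspan_eqI, rule add.commute)
  show "0 + x = x"
    by transfer (rule cspan_eqI, simp)
  show "- x + x = 0"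
    by transfer (rule cspan_eqI, simp)
  show "x - y = x + - y"
    by transfer (rule cspan_eqI, simp)
  show "c *\<^sub>C (x + y) = c *\<^sub>C x + c *\<^sub>C y"
    by transfer (rule cspan_eqI, rule cscale_add_right)
  show "(c + d) *\<^sub>C x = c *\<^sub>C x + d *\<^sub>C x"
    by transfer (rule cspan_eqI, rule cscale_add_left)
  show "c *\<^sub>C d *\<^sub>C x = (c * d) *\<^sub>C x"
    by transfer (rule cspan_eqI, rule cscale_cscale)
  show "1 *\<^sub>C x = x"
    by transfer (rule cspan_eqI, rule cscale_one)
qed

end

lift_definition pure_tensor ::
    "'a::complex_module \<Rightarrow> 'b::complex_module \<Rightarrow> ('a, 'b) tensor"  (infixr \<open>\<boxtimes>\<close> 72)
  is "\<lambda>a b. Poly_Mapping.single (a, b) 1" .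

definition cbilinear :: "('a::complex_module \<Rightarrow> 'b::complex_module \<Rightarrow> 'c::complex_module) \<Rightarrow> bool"
  where "cbilinear f \<longleftrightarrow> (\<forall>a. clinear (f a)) \<and> (\<forall>b. clinear (\<lambda>a. f a b))"

lemma cbilinear_pure_tensor: "cbilinear ((\<boxtimes>) :: 'a::complex_module \<Rightarrow> 'b::complex_module \<Rightarrow> _)"
proof -
  have rel: "x - y \<in> cspan (tensor_relators :: (('a \<times> 'b) \<Rightarrow>\<^sub>0 complex) set)"
    if "x - y \<in> tensor_relators" for x y
    using that by (rule cvs.span_base)
  have "a \<boxtimes> (b + b') = a \<boxtimes> b + a \<boxtimes> b'" for a :: 'a and b b' :: 'b
    apply transfer
    apply (rule rel)
    unfolding tensor_relators_def Let_def diff_diff_eq[symmetric]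
    by blast
  moreover have "(a + a') \<boxtimes> b = a \<boxtimes> b + a' \<boxtimes> b" for a a' :: 'a and b :: 'b
    apply transfer
    apply (rule rel)
    unfolding tensor_relators_def Let_def diff_diff_eq[symmetric]
    by blast
  moreover have "(c *\<^sub>C a) \<boxtimes> b = c *\<^sub>C (a \<boxtimes> b)" for c and a :: 'a and b :: 'b
    apply transfer
    apply (rule rel)
    unfolding tensor_relators_def Let_def
    by blast
  moreover have "a \<boxtimes> (c *\<^sub>C b) = c *\<^sub>C (a \<boxtimes> b)" for c and a :: 'a and b :: 'b
    apply transfer
    apply (rule rel)
    unfolding tensor_relators_def Let_def
    by blast
  ultimately show ?thesis
    unfolding cbilinear_def
    by (intro conjI allI module_hom.intro module_hom_axioms.intro cvs.module_axioms)
qed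

text \<open>The linear map out of the tensor product induced by a bilinear map (unspecified on other
  maps, since it is evaluated on some representative).\<close>

definition tensor_lift ::
    "('a::complex_module \<Rightarrow> 'b::complex_module \<Rightarrow> 'c::complex_module) \<Rightarrow> ('a, 'b) tensor \<Rightarrow> 'c"
  where "tensor_lift f x = lin_ext (\<lambda>(a, b). f a b) (rep_tensor x)"

lemma lin_ext_tensor_relators:
  assumes "cbilinear f" and "p \<in> cspan tensor_relators"
  shows "lin_ext (\<lambda>(a, b). f a b) p = 0"
proof -
  interpret L: module_hom cscale cscale "lin_ext (\<lambda>(a, b). f a b)"
    by (rule clinear_lin_ext)
  have l: "clinear (f a)" "clinear (\<lambda>a. f a b)" for a b
    using assms(1) by (auto simp: cbilinear_def)
  note l = l[THEN module_hom.add] l[THEN module_hom.scale]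
  have "lin_ext (\<lambda>(a, b). f a b) r = 0" if "r \<in> tensor_relators" for r
    using that unfolding tensor_relators_def Let_def
    by (auto simp: L.diff L.scale l cscale_one)
  with assms(2) show ?thesis
    by (induction rule: cvs.span_induct_alt) (simp_all add: L.add L.scale)
qed

lemma tensor_lift_abs:
  assumes "cbilinear f"
  shows "tensor_lift f (abs_tensor p) = lin_ext (\<lambda>(a, b). f a b) p"
proof -
  interpret L: module_hom cscale cscale "lin_ext (\<lambda>(a, b). f a b)"
    by (rule clinear_lin_ext)
  have "rep_tensor (abs_tensor p) - p \<in> cspan tensor_relators"
    using Quotient3_abs_rep[OF Quotient3_tensor, of "abs_tensor p"] by (simp add: tensor.abs_eq_iff)
  from lin_ext_tensor_relators[OF assms this] show ?thesis
    by (simp add: tensor_lift_def L.diff)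
qed

lemma tensor_lift_pure [simp]: "cbilinear f \<Longrightarrow> tensor_lift f (a \<boxtimes> b) = f a b"
  by (simp add: pure_tensor.abs_eq tensor_lift_abs cscale_one)

lemma clinear_tensor_lift:
  assumes "cbilinear f"
  shows "clinear (tensor_lift f)"
proof unfold_locales
  interpret L: module_hom cscale cscale "lin_ext (\<lambda>(a, b). f a b)"
    by (rule clinear_lin_ext)
  show "tensor_lift f (x + y) = tensor_lift f x + tensor_lift f y" for x y
    by (induction x; induction y)
      (simp add: plus_tensor.abs_eq tensor_lift_abs[OF assms] L.add)
  show "tensor_lift f (c *\<^sub>C x) = c *\<^sub>C tensor_lift f x" for c x
    by (induction x) (simp add: cscale_tensor.abs_eq tensor_lift_abs[OF assms] L.scale)
qed

interpretation rmod: Modules.module "(*) :: 'a \<Rightarrow> 'a \<Rightarrow> 'a::comm_ring_1"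
  by standard (simp_all add: algebra_simps)

abbreviation ideal_of :: "'a::comm_ring_1 set \<Rightarrow> 'a set"
  where "ideal_of \<equiv> Modules.module.span (*)"

lemma equivp_ideal: "equivp (\<lambda>p q. p - q \<in> ideal_of S)"
proof (rule equivpI)
  show "reflp (\<lambda>p q. p - q \<in> ideal_of S)"
    by (simp add: reflp_def rmod.span_zero)
  show "symp (\<lambda>p q. p - q \<in> ideal_of S)"
  proof (rule sympI)
    fix p q assume "p - q \<in> ideal_of S"
    from rmod.span_neg[OF this] show "q - p \<in> ideal_of S" by simp
  qed
  show "transp (\<lambda>p q. p - q \<in> ideal_of S)"
  proof (rule transpI)
    fix p q r assume "p - q \<in> ideal_of S" "q - r \<in> ideal_of S"
    from rmod.span_add[OF this] show "p - r \<in> ideal_of S" by simp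
  qed
qed

lemma ideal_cong:
  fixes p p' q q' :: "'a::comm_ring_1"
  assumes p: "p - p' \<in> ideal_of S"
  shows "q - q' \<in> ideal_of S \<Longrightarrow> (p + q) - (p' + q') \<in> ideal_of S"
    and "q - q' \<in> ideal_of S \<Longrightarrow> (p - q) - (p' - q') \<in> ideal_of S"
    and "- p - - p' \<in> ideal_of S"
    and "q - q' \<in> ideal_of S \<Longrightarrow> p * q - p' * q' \<in> ideal_of S"
proof -
  show "- p - - p' \<in> ideal_of S"
    using rmod.span_neg[OF p] by (simp only: minus_diff_minus)
  assume q: "q - q' \<in> ideal_of S"
  show "(p + q) - (p' + q') \<in> ideal_of S"
    using rmod.span_add[OF p q] by (simp only: add_diff_add)
  have eq: "(p - q) - (p' - q') = (p - p') - (q - q')"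
    by (simp add: algebra_simps)
  show "(p - q) - (p' - q') \<in> ideal_of S"
    unfolding eq by (rule rmod.span_diff[OF p q])
  have eq: "p * q - p' * q' = p * (q - q') + q' * (p - p')"
    by (simp add: algebra_simps)
  show "p * q - p' * q' \<in> ideal_of S"
    unfolding eq by (intro rmod.span_add rmod.span_scale p q)
qed

lemma ideal_cong_cscale:
  fixes p p' :: "'a::complex_algebra"
  assumes "p - p' \<in> ideal_of S"
  shows "c *\<^sub>C p - c *\<^sub>C p' \<in> ideal_of S"
proof -
  have "c *\<^sub>C p - c *\<^sub>C p' = (c *\<^sub>C 1) * (p - p')"
    by (simp add: cscale_mult_left cvs.scale_right_diff_distrib)
  then show ?thesis using rmod.span_scale[OF assms, of "c *\<^sub>C 1"] by simp
qed

lemma ideal_eqI: "p = q \<Longrightarrow> p - q \<in> ideal_of S"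
  by (simp add: rmod.span_zero)

definition crmap :: "('a::comm_ring_1 \<Rightarrow> 'b::comm_ring_1) \<Rightarrow> bool"
  where "crmap f \<longleftrightarrow> f 1 = 1 \<and> (\<forall>x y. f (x + y) = f x + f y) \<and> (\<forall>x y. f (x * y) = f x * f y)"

lemma crmapD:
  assumes "crmap f"
  shows "f 1 = 1" "f (x + y) = f x + f y" "f (x * y) = f x * f y"
    "f 0 = 0" "f (- x) = - f x" "f (x - y) = f x - f y"
proof -
  show 1: "f 1 = 1" "f (x + y) = f x + f y" "f (x * y) = f x * f y" for x y
    using assms by (simp_all add: crmap_def)
  show 0: "f 0 = 0" using 1(2)[of 0 0] by simp
  show m: "f (- x) = - f x" for x
    using 1(2)[of x "- x"] 0 by (simp add: eq_neg_iff_add_eq_0 add.commute)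
  show "f (x - y) = f x - f y" using 1(2)[of x "- y"] m by simp
qed

lemma crmap_sum: "crmap f \<Longrightarrow> f (sum g S) = (\<Sum>i\<in>S. f (g i))"
  by (induction S rule: infinite_finite_induct) (simp_all add: crmapD)

lemma crmap_prod: "crmap f \<Longrightarrow> f (prod g S) = (\<Prod>i\<in>S. f (g i))"
  by (induction S rule: infinite_finite_induct) (simp_all add: crmapD)

lemma crmap_of_int: "crmap f \<Longrightarrow> f (of_int n) = of_int n"
proof -
  assume f: "crmap f"
  have "f (of_nat k) = of_nat k" for k
    by (induction k) (simp_all add: crmapD[OF f])
  then show ?thesis by (cases n) (simp_all add: crmapD[OF f])
qed

lemma crmap_det: "crmap f \<Longrightarrow> f (det A) = det (\<chi> i j. f (A $ i $ j))"
  by (simp add: det_def crmap_sum crmap_prod crmap_of_int crmapD)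

lemma crmap_ideal:
  assumes f: "crmap f" and "\<And>s. s \<in> S \<Longrightarrow> f s \<in> ideal_of T" and "x \<in> ideal_of S"
  shows "f x \<in> ideal_of T"
  using assms(3)
proof (induction rule: rmod.span_induct_alt)
  case base
  then show ?case by (simp add: crmapD[OF f] rmod.span_zero)
next
  case (step c x y)
  then show ?case
    by (simp add: crmapD[OF f] rmod.span_add rmod.span_scale assms(2))
qed

lemma crmap_ideal_zero:
  assumes f: "crmap f" and "\<And>s. s \<in> S \<Longrightarrow> f s = 0" and "x \<in> ideal_of S"
  shows "f x = 0"
  using crmap_ideal[OF f _ assms(3), of "{}"] assms(2) by simp

lemma crmap_map:
  assumes f: "crmap f"
  shows "crmap (Poly_Mapping.map f :: ('k::comm_monoid_add \<Rightarrow>\<^sub>0 _) \<Rightarrow> _)"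
proof -
  have "Poly_Mapping.map f (1 :: 'k \<Rightarrow>\<^sub>0 'a) = 1"
    using map_single_zero[of f "0::'k" 1] by (simp add: crmapD[OF f])
  then show ?thesis
    unfolding crmap_def using crmapD[OF f] by (auto intro!: map_additive map_multiplicative)
qed

lemma crmap_comp: "crmap f \<Longrightarrow> crmap g \<Longrightarrow> crmap (\<lambda>x. f (g x))"
  by (simp add: crmap_def)

lemma crmap_single_zero: "crmap (Poly_Mapping.single (0::'k::comm_monoid_add))"
  by (simp add: crmap_def single_add mult_single)

lemma det_conjugate:
  fixes A P Q :: "'a::comm_ring_1^'n^'n"
  assumes "P ** Q = mat 1"
  shows "det (P ** A ** Q) = det A"
proof -
  have "det P * det Q = 1"
    by (metis assms det_I det_mul)
  then show ?thesis by (simp add: det_mul) (metis mult.commute mult.left_commute mult_1)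
qed

lemma vector_4 [simp]:
  "(vector [w, x, y, z] :: ('a::zero)^4) $ 1 = w"
  "(vector [w, x, y, z] :: ('a::zero)^4) $ 2 = x"
  "(vector [w, x, y, z] :: ('a::zero)^4) $ 3 = y"
  "(vector [w, x, y, z] :: ('a::zero)^4) $ 4 = z"
  unfolding vector_def by simp_all


text \<open>The group-like monomial \<open>t^a\<close> is represented by its exponent vector in the additive group of
  pairs of integers. The algebra of Laurent polynomials is the group algebra of that group, and
  for a complex vector space V the tensor product of H with V is identified with the finitely
  supported families of elements of V indexed by exponent vectors. A coaction thus maps v to its
  family of homogeneous components.\<close>

type_synonym torus = "int \<times> int"
type_synonym hopf = "torus \<Rightarrow>\<^sub>0 complex"

definition tau :: "4 \<Rightarrow> torus"
  where "tau i = (vector [(1, 0), (-1, 0), (0, 1), (0, -1)] :: torus^4) $ i"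

definition twist :: "real \<Rightarrow> torus \<Rightarrow> torus \<Rightarrow> complex"
  where "twist \<theta> a b =
    exp (\<i> * of_real pi * of_real \<theta> / 2 * of_int (fst a * snd b - snd a * fst b))"


text \<open>A free commutative star-algebra is the polynomial algebra on the generators
  and their formal adjoints; the pair (x, True) is the adjoint of the generator x.\<close>

datatype qentry = a\<^sub>1 | a\<^sub>2 | b\<^sub>1 | b\<^sub>2 | c\<^sub>1 | c\<^sub>2 | d\<^sub>1 | d\<^sub>2

type_synonym gen = "qentry \<times> bool"
type_synonym m2h = "(gen \<Rightarrow>\<^sub>0 nat) \<Rightarrow>\<^sub>0 complex"

definition var :: "gen \<Rightarrow> m2h"
  where "var v = Poly_Mapping.single (Poly_Mapping.single v 1) 1"

definition monom_eval :: "(gen \<Rightarrow> 'a::comm_ring_1) \<Rightarrow> (gen \<Rightarrow>\<^sub>0 nat) \<Rightarrow> 'a"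
  where "monom_eval x m = (\<Prod>v\<in>Poly_Mapping.keys m. x v ^ Poly_Mapping.lookup m v)"

definition poly_eval :: "(gen \<Rightarrow> 'a::complex_algebra) \<Rightarrow> m2h \<Rightarrow> 'a"
  where "poly_eval x = lin_ext (monom_eval x)"

lemma monom_eval_superset:
  "finite S \<Longrightarrow> Poly_Mapping.keys m \<subseteq> S \<Longrightarrow>
    monom_eval x m = (\<Prod>v\<in>S. x v ^ Poly_Mapping.lookup m v)"
  unfolding monom_eval_def by (rule prod.mono_neutral_left) (auto simp: in_keys_iff)

lemma monom_eval_zero [simp]: "monom_eval x 0 = 1"
  by (simp add: monom_eval_def)

lemma monom_eval_add: "monom_eval x (m + n) = monom_eval x m * monom_eval x n"
  using Poly_Mapping.keys_add[of m n]
  by (simp add: monom_eval_superset[of "Poly_Mapping.keys m \<union> Poly_Mapping.keys n"]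
      lookup_add power_add prod.distrib)

lemma lin_ext_multiplicative:
  fixes f :: "'k::comm_monoid_add \<Rightarrow> 'a::complex_algebra"
  assumes "\<And>m n. f (m + n) = f m * f n"
  shows "lin_ext f (p * q) = lin_ext f p * lin_ext f q"
proof -
  have 1: "lin_ext f (Poly_Mapping.single k c * q) = (c *\<^sub>C f k) * lin_ext f q" for k c q
    by (induction q rule: poly_mapping_single_induct)
      (simp_all add: distrib_left lin_ext_add mult_single assms cscale_mult_left
        cscale_mult_right cscale_cscale)
  show ?thesis
    by (induction p rule: poly_mapping_single_induct)
      (simp_all add: distrib_right lin_ext_add 1)
qed

lemma crmap_poly_eval: "crmap (poly_eval x)"
  unfolding crmap_def poly_eval_def
  using lin_ext_single[of "monom_eval x" 0 1]
  by (auto simp: lin_ext_add lin_ext_multiplicative monom_eval_add cscale_one)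

lemma poly_eval_var [simp]: "poly_eval x (var v) = x v"
  by (simp add: poly_eval_def var_def cscale_one monom_eval_superset[of "{v}"])

lemma poly_eval_cscale: "poly_eval x (c *\<^sub>C p) = c *\<^sub>C poly_eval x p"
  by (simp add: poly_eval_def lin_ext_cscale)

text \<open>The coefficients are conjugated first, so that this is the antilinear algebra map
  exchanging the generators and their adjoints.\<close>

definition star_m :: "m2h \<Rightarrow> m2h"
  where "star_m p = poly_eval (\<lambda>(x, s). var (x, \<not> s)) (Poly_Mapping.map cnj p)"

definition A_m :: "m2h^4^4"
  where "A_m = (let g = (\<lambda>x. var (x, False)); h = (\<lambda>x. star_m (var (x, False))) in
    vector [vector [g a\<^sub>1, - h a\<^sub>2, g b\<^sub>1, - h b\<^sub>2],
            vector [g a\<^sub>2,   h a\<^sub>1, g b\<^sub>2,   h b\<^sub>1],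
            vector [g c\<^sub>1, - h c\<^sub>2, g d\<^sub>1, - h d\<^sub>2],
            vector [g c\<^sub>2,   h c\<^sub>1, g d\<^sub>2,   h d\<^sub>1]])"

lemma crmap_star_m: "crmap star_m"
  unfolding star_m_def
  by (intro crmap_comp[OF crmap_poly_eval] crmap_map) (simp add: crmap_def)

lemma star_m_cscale: "star_m (c *\<^sub>C p) = cnj c *\<^sub>C star_m p"
proof -
  have "Poly_Mapping.map cnj (c *\<^sub>C p) = cnj c *\<^sub>C Poly_Mapping.map cnj p"
    by (rule poly_mapping_eqI) (simp add: lookup_map_zero cscale_complex_def)
  then show ?thesis by (simp add: star_m_def poly_eval_cscale)
qed

lemma star_m_var [simp]: "star_m (var (x, s)) = var (x, \<not> s)"
proof -
  have "Poly_Mapping.map cnj (var (x, s)) = var (x, s)"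
    by (simp add: var_def map_single_zero)
  then show ?thesis by (simp add: star_m_def)
qed

text \<open>The degree of a generator is read off from the unique place of the matrix at which it
  occurs; lemma \<open>coact_m_A\<close> below shows that this is the coaction prescribed on all entries.\<close>

fun place :: "qentry \<Rightarrow> 4 \<times> 4"
  where "place a\<^sub>1 = (1, 1)" | "place a\<^sub>2 = (2, 1)" | "place b\<^sub>1 = (1, 3)" | "place b\<^sub>2 = (2, 3)"
  | "place c\<^sub>1 = (3, 1)" | "place c\<^sub>2 = (4, 1)" | "place d\<^sub>1 = (3, 3)" | "place d\<^sub>2 = (4, 3)"

fun gen_deg :: "gen \<Rightarrow> torus"
  where "gen_deg (x, s) = (let (i, j) = place x; d = tau i - tau j in if s then - d else d)"

definition coact_m :: "m2h \<Rightarrow> torus \<Rightarrow>\<^sub>0 m2h"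
  where "coact_m = poly_eval (\<lambda>v. Poly_Mapping.single (gen_deg v) (var v))"

lemma crmap_coact_m: "crmap coact_m"
  by (simp add: coact_m_def crmap_poly_eval)

lemma tau_simps [simp]: "tau 1 = (1, 0)" "tau 2 = (-1, 0)" "tau 3 = (0, 1)" "tau 4 = (0, -1)"
  by (simp_all add: tau_def)

lemma coact_m_A: "coact_m (A_m $ i $ j) = Poly_Mapping.single (tau i - tau j) (A_m $ i $ j)"
proof -
  have "\<forall>i j. coact_m (A_m $ i $ j) = Poly_Mapping.single (tau i - tau j) (A_m $ i $ j)"
    unfolding forall_4 
    by (simp add: A_m_def Let_def crmapD[OF crmap_coact_m] single_uminus) (simp add: coact_m_def)
  then show ?thesis by blast
qed

lemma det_coact_m: "coact_m (det A_m) = Poly_Mapping.single 0 (det A_m)"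
proof -
  define P :: "(torus \<Rightarrow>\<^sub>0 m2h)^4^4"
    where "P = (\<chi> i j. if i = j then Poly_Mapping.single (tau i) 1 else 0)"
  define Q :: "(torus \<Rightarrow>\<^sub>0 m2h)^4^4"
    where "Q = (\<chi> i j. if i = j then Poly_Mapping.single (- tau i) 1 else 0)"
  define B :: "(torus \<Rightarrow>\<^sub>0 m2h)^4^4"
    where "B = (\<chi> i j. Poly_Mapping.single 0 (A_m $ i $ j))"
  have "P ** Q = mat 1"
    by (simp add: P_def Q_def matrix_matrix_mult_def mat_def vec_eq_iff if_distrib[of "\<lambda>x. x * _"]
        if_distrib[of "\<lambda>x. _ * x"] mult_single cong: if_cong)
  moreover have "(\<chi> i j. coact_m (A_m $ i $ j)) = P ** B ** Q"
    by (simp add: P_def Q_def B_def matrix_matrix_mult_def vec_eq_iff coact_m_A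
        if_distrib[of "\<lambda>x. x * _"] if_distrib[of "\<lambda>x. _ * x"] mult_single cong: if_cong)
  ultimately have "coact_m (det A_m) = det B"
    by (simp add: crmap_det[OF crmap_coact_m] det_conjugate)
  also have "\<dots> = Poly_Mapping.single 0 (det A_m)"
    by (simp add: B_def crmap_det[OF crmap_single_zero])
  finally show ?thesis .
qed

lemma det_star_m: "star_m (det A_m) = det A_m"
proof -
  define P :: "m2h^4^4" where "P = vector [vector [0, 1, 0, 0], vector [- 1, 0, 0, 0],
    vector [0, 0, 0, 1], vector [0, 0, - 1, 0]]"
  define Q :: "m2h^4^4" where "Q = vector [vector [0, - 1, 0, 0], vector [1, 0, 0, 0],
    vector [0, 0, 0, - 1], vector [0, 0, 1, 0]]"
  have "P ** Q = mat 1"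
    unfolding vec_eq_iff forall_4 matrix_matrix_mult_def sum_4 mat_def
    by (simp add: P_def Q_def)
  moreover have "(\<chi> i j. star_m (A_m $ i $ j)) = P ** A_m ** Q"
    unfolding vec_eq_iff forall_4 matrix_matrix_mult_def sum_4
    by (simp add: P_def Q_def A_m_def Let_def crmapD[OF crmap_star_m])
  ultimately show ?thesis
    by (simp add: crmap_det[OF crmap_star_m] det_conjugate)
qed

definition sl_ideal :: "m2h set"
  where "sl_ideal = ideal_of {det A_m - 1}"

quotient_type sl2h = m2h / "\<lambda>p q. p - q \<in> sl_ideal"
  unfolding sl_ideal_def by (rule equivp_ideal)

text \<open>Evaluation at the identity matrix shows that the quotients are nonzero.\<close>

definition eval_one :: "m2h \<Rightarrow> complex"
  where "eval_one = poly_eval (\<lambda>(x, _). if fst (place x) = snd (place x) then 1 else 0)"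

lemma crmap_eval_one: "crmap eval_one"
  by (simp add: eval_one_def crmap_poly_eval)

lemma eval_one_A: "eval_one (A_m $ i $ j) = (if i = j then 1 else 0)"
proof -
  have "\<forall>i j. eval_one (A_m $ i $ j) = (if i = j then 1 else 0)"
    unfolding forall_4
    by (simp add: A_m_def Let_def crmapD[OF crmap_eval_one]) (simp add: eval_one_def)
  then show ?thesis by blast
qed

lemma eval_one_star_A: "eval_one (star_m (A_m $ i $ j)) = (if i = j then 1 else 0)"
proof -
  have "\<forall>i j. eval_one (star_m (A_m $ i $ j)) = (if i = j then 1 else 0)"
    unfolding forall_4
    by (simp add: A_m_def Let_def crmapD[OF crmap_eval_one] crmapD[OF crmap_star_m])
      (simp add: eval_one_def)
  then show ?thesis by blast
qed

lemma eval_one_sl_ideal: "p \<in> sl_ideal \<Longrightarrow> eval_one p = 0"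
  unfolding sl_ideal_def
proof (erule crmap_ideal_zero[OF crmap_eval_one, rotated])
  have "(\<chi> i j. if i = j then 1 else 0) = (mat 1 :: complex^4^4)"
    by (simp add: mat_def)
  then show "eval_one s = 0" if "s \<in> {det A_m - 1}" for s
    using that by (simp add: crmapD[OF crmap_eval_one] crmap_det[OF crmap_eval_one] eval_one_A)
qed

instantiation sl2h :: complex_algebra
begin

lift_definition zero_sl2h :: sl2h is 0 .
lift_definition one_sl2h :: sl2h is 1 .
lift_definition plus_sl2h :: "sl2h \<Rightarrow> sl2h \<Rightarrow> sl2h" is "(+)"
  unfolding sl_ideal_def by (rule ideal_cong(1))
lift_definition minus_sl2h :: "sl2h \<Rightarrow> sl2h \<Rightarrow> sl2h" is "(-)"
  unfolding sl_ideal_def by (rule ideal_cong(2))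
lift_definition uminus_sl2h :: "sl2h \<Rightarrow> sl2h" is uminus
  unfolding sl_ideal_def by (rule ideal_cong(3))
lift_definition times_sl2h :: "sl2h \<Rightarrow> sl2h \<Rightarrow> sl2h" is "(*)"
  unfolding sl_ideal_def by (rule ideal_cong(4))
lift_definition cscale_sl2h :: "complex \<Rightarrow> sl2h \<Rightarrow> sl2h" is cscale
  unfolding sl_ideal_def by (rule ideal_cong_cscale)

instance
proof
  fix x y z :: sl2h and c d :: complex
  note eqI = ideal_eqI[of _ _ "{det A_m - 1}", folded sl_ideal_def]
  show "x + y + z = x + (y + z)" by transfer (rule eqI, rule add.assoc)
  show "x + y = y + x" by transfer (rule eqI, rule add.commute)
  show "0 + x = x" by transfer (rule eqI, simp)
  show "- x + x = 0" by transfer (rule eqI, simp)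
  show "x - y = x + - y" by transfer (rule eqI, simp)
  show "x * y * z = x * (y * z)" by transfer (rule eqI, rule mult.assoc)
  show "x * y = y * x" by transfer (rule eqI, rule mult.commute)
  show "1 * x = x" by transfer (rule eqI, simp)
  show "(x + y) * z = x * z + y * z" by transfer (rule eqI, rule distrib_right)
  show "c *\<^sub>C (x + y) = c *\<^sub>C x + c *\<^sub>C y" by transfer (rule eqI, rule cscale_add_right)
  show "(c + d) *\<^sub>C x = c *\<^sub>C x + d *\<^sub>C x" by transfer (rule eqI, rule cscale_add_left)
  show "c *\<^sub>C d *\<^sub>C x = (c * d) *\<^sub>C x" by transfer (rule eqI, rule cscale_cscale)
  show "1 *\<^sub>C x = x" by transfer (rule eqI, rule cscale_one)
  show "(c *\<^sub>C x) * y = c *\<^sub>C (x * y)" by transfer (rule eqI, rule cscale_mult_left)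
  show "(0::sl2h) \<noteq> 1"
    by transfer (use eval_one_sl_ideal[of "0 - 1"] in \<open>auto simp: crmapD[OF crmap_eval_one]\<close>)
qed

end

lemma crmap_abs_sl2h: "crmap abs_sl2h"
  by (simp add: crmap_def one_sl2h.abs_eq plus_sl2h.abs_eq times_sl2h.abs_eq)

lemma abs_sl2h_cscale: "abs_sl2h (c *\<^sub>C p) = c *\<^sub>C abs_sl2h p"
  by (simp add: cscale_sl2h.abs_eq)

lemma abs_sl2h_eq_iff: "abs_sl2h p = abs_sl2h q \<longleftrightarrow> p - q \<in> sl_ideal"
  by (rule sl2h.abs_eq_iff)

definition A_sl :: "4 \<Rightarrow> 4 \<Rightarrow> sl2h"
  where "A_sl i j = abs_sl2h (A_m $ i $ j)"

lift_definition star_sl :: "sl2h \<Rightarrow> sl2h" is star_m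
proof -
  fix p q assume "p - q \<in> sl_ideal"
  then have "star_m (p - q) \<in> sl_ideal"
    unfolding sl_ideal_def
    by (rule crmap_ideal[OF crmap_star_m, rotated])
      (auto simp: crmapD[OF crmap_star_m] det_star_m intro: rmod.span_base)
  then show "star_m p - star_m q \<in> sl_ideal"
    by (simp add: crmapD[OF crmap_star_m])
qed

lift_definition coact_sl :: "sl2h \<Rightarrow> torus \<Rightarrow>\<^sub>0 sl2h"
  is "\<lambda>p. Poly_Mapping.map abs_sl2h (coact_m p)"
proof -
  let ?f = "\<lambda>p. Poly_Mapping.map abs_sl2h (coact_m p)"
  have f: "crmap ?f"
    by (intro crmap_comp[OF _ crmap_coact_m] crmap_map crmap_abs_sl2h)
  have "abs_sl2h (det A_m) = abs_sl2h 1"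
    unfolding abs_sl2h_eq_iff sl_ideal_def by (simp add: rmod.span_base)
  then have "?f (det A_m) = ?f 1"
    using crmapD[OF f] crmapD[OF crmap_abs_sl2h]
    by (simp add: det_coact_m map_single_zero)
  then have "?f p = 0" if "p \<in> sl_ideal" for p
    using that unfolding sl_ideal_def
    by (elim crmap_ideal_zero[OF f, rotated]) (simp add: crmapD(6)[OF f])
  then show "?f p = ?f q" if "p - q \<in> sl_ideal" for p q
    using that crmapD(6)[OF f, of p q] by simp
qed

lemma crmap_coact_sl: "crmap coact_sl"
proof -
  have f: "crmap (\<lambda>p. Poly_Mapping.map abs_sl2h (coact_m p))"
    by (intro crmap_comp[OF _ crmap_coact_m] crmap_map crmap_abs_sl2h)
  show ?thesis
    unfolding crmap_def
    by (intro conjI allI; transfer) (simp_all add: crmapD[OF f])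
qed

lemma star_sl_cscale: "star_sl (c *\<^sub>C x) = cnj c *\<^sub>C star_sl x"
  by transfer (simp add: star_m_cscale sl_ideal_def rmod.span_zero)

lemma crmap_star_sl: "crmap star_sl"
  unfolding crmap_def
  by (intro conjI allI; transfer)
    (simp_all add: crmapD[OF crmap_star_m] sl_ideal_def rmod.span_zero)

lemma coact_sl_A: "coact_sl (A_sl i j) = Poly_Mapping.single (tau i - tau j) (A_sl i j)"
  by (simp add: A_sl_def coact_sl.abs_eq coact_m_A map_single_zero crmapD[OF crmap_abs_sl2h])

lemma coact_sl_star_A:
  "coact_sl (star_sl (A_sl i j)) = Poly_Mapping.single (tau j - tau i) (star_sl (A_sl i j))"
proof -
  have "\<forall>i j. coact_m (star_m (A_m $ i $ j)) = Poly_Mapping.single (tau j - tau i) (star_m (A_m $ i $ j))"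
    unfolding forall_4
    by (simp add: A_m_def Let_def crmapD[OF crmap_coact_m] crmapD[OF crmap_star_m] single_uminus)
      (simp add: coact_m_def)
  then show ?thesis
    by (simp add: A_sl_def coact_sl.abs_eq star_sl.abs_eq map_single_zero crmapD[OF crmap_abs_sl2h])
qed

definition sp_relation :: "4 \<Rightarrow> 4 \<Rightarrow> sl2h"
  where "sp_relation i j =
    (\<Sum>\<alpha>\<in>UNIV. star_sl (A_sl \<alpha> i) * A_sl \<alpha> j) - (if i = j then 1 else 0)"

definition sp_ideal :: "sl2h set"
  where "sp_ideal = ideal_of {sp_relation i j | i j. True}"

quotient_type sp2 = sl2h / "\<lambda>p q. p - q \<in> sp_ideal"
  unfolding sp_ideal_def by (rule equivp_ideal)

lift_definition eval_one_sl :: "sl2h \<Rightarrow> complex" is eval_one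
  using eval_one_sl_ideal by (auto simp: crmapD[OF crmap_eval_one] dest: eval_one_sl_ideal)

lemma crmap_eval_one_sl: "crmap eval_one_sl"
  unfolding crmap_def
  by (intro conjI allI; transfer) (simp_all add: crmapD[OF crmap_eval_one])

lemma eval_one_sp_ideal: "p \<in> sp_ideal \<Longrightarrow> eval_one_sl p = 0"
  unfolding sp_ideal_def
proof (erule crmap_ideal_zero[OF crmap_eval_one_sl, rotated])
  have "\<forall>i j. eval_one_sl (sp_relation i j) = 0"
    unfolding forall_4
    by (simp add: sp_relation_def crmapD[OF crmap_eval_one_sl] crmap_sum[OF crmap_eval_one_sl]
        A_sl_def star_sl.abs_eq eval_one_sl.abs_eq eval_one_A eval_one_star_A sum_4)
  then show "eval_one_sl s = 0" if "s \<in> {sp_relation i j | i j. True}" for s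
    using that by auto
qed

instantiation sp2 :: complex_algebra
begin

lift_definition zero_sp2 :: sp2 is 0 .
lift_definition one_sp2 :: sp2 is 1 .
lift_definition plus_sp2 :: "sp2 \<Rightarrow> sp2 \<Rightarrow> sp2" is "(+)"
  unfolding sp_ideal_def by (rule ideal_cong(1))
lift_definition minus_sp2 :: "sp2 \<Rightarrow> sp2 \<Rightarrow> sp2" is "(-)"
  unfolding sp_ideal_def by (rule ideal_cong(2))
lift_definition uminus_sp2 :: "sp2 \<Rightarrow> sp2" is uminus
  unfolding sp_ideal_def by (rule ideal_cong(3))
lift_definition times_sp2 :: "sp2 \<Rightarrow> sp2 \<Rightarrow> sp2" is "(*)"
  unfolding sp_ideal_def by (rule ideal_cong(4))
lift_definition cscale_sp2 :: "complex \<Rightarrow> sp2 \<Rightarrow> sp2" is cscale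
  unfolding sp_ideal_def by (rule ideal_cong_cscale)

instance
proof
  fix x y z :: sp2 and c d :: complex
  note eqI = ideal_eqI[of _ _ "{sp_relation i j | i j. True}", folded sp_ideal_def]
  show "x + y + z = x + (y + z)" by transfer (rule eqI, rule add.assoc)
  show "x + y = y + x" by transfer (rule eqI, rule add.commute)
  show "0 + x = x" by transfer (rule eqI, simp)
  show "- x + x = 0" by transfer (rule eqI, simp)
  show "x - y = x + - y" by transfer (rule eqI, simp)
  show "x * y * z = x * (y * z)" by transfer (rule eqI, rule mult.assoc)
  show "x * y = y * x" by transfer (rule eqI, rule mult.commute)
  show "1 * x = x" by transfer (rule eqI, simp)
  show "(x + y) * z = x * z + y * z" by transfer (rule eqI, rule distrib_right)
  show "c *\<^sub>C (x + y) = c *\<^sub>C x + c *\<^sub>C y" by transfer (rule eqI, rule cscale_add_right)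
  show "(c + d) *\<^sub>C x = c *\<^sub>C x + d *\<^sub>C x" by transfer (rule eqI, rule cscale_add_left)
  show "c *\<^sub>C d *\<^sub>C x = (c * d) *\<^sub>C x" by transfer (rule eqI, rule cscale_cscale)
  show "1 *\<^sub>C x = x" by transfer (rule eqI, rule cscale_one)
  show "(c *\<^sub>C x) * y = c *\<^sub>C (x * y)" by transfer (rule eqI, rule cscale_mult_left)
  show "(0::sp2) \<noteq> 1"
    by transfer (use eval_one_sp_ideal[of "0 - 1"] in \<open>auto simp: crmapD[OF crmap_eval_one_sl]\<close>)
qed

end

lemma crmap_abs_sp2: "crmap abs_sp2"
  by (simp add: crmap_def one_sp2.abs_eq plus_sp2.abs_eq times_sp2.abs_eq)

lemma coact_sl_sp_relation:
  "coact_sl (sp_relation i j) = Poly_Mapping.single (tau i - tau j) (sp_relation i j)"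
proof -
  have single_sum: "Poly_Mapping.single k (\<Sum>i\<in>S. f i) = (\<Sum>i\<in>S. Poly_Mapping.single k (f i))"
    for k :: torus and f :: "4 \<Rightarrow> sl2h" and S
    by (induction S rule: infinite_finite_induct) (simp_all add: single_add)
  show ?thesis
    by (simp add: sp_relation_def crmapD[OF crmap_coact_sl] crmap_sum[OF crmap_coact_sl]
        coact_sl_A coact_sl_star_A mult_single single_sum single_diff)
qed

lift_definition coact_sp :: "sp2 \<Rightarrow> torus \<Rightarrow>\<^sub>0 sp2"
  is "\<lambda>p. Poly_Mapping.map abs_sp2 (coact_sl p)"
proof -
  let ?f = "\<lambda>p. Poly_Mapping.map abs_sp2 (coact_sl p)"
  have f: "crmap ?f"
    by (intro crmap_comp[OF _ crmap_coact_sl] crmap_map crmap_abs_sp2)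
  have "abs_sp2 (sp_relation i j) = abs_sp2 0" for i j
    unfolding sp2.abs_eq_iff sp_ideal_def by (auto intro!: rmod.span_base)
  then have "?f (sp_relation i j) = 0" for i j
    by (simp add: coact_sl_sp_relation map_single_zero crmapD[OF crmap_abs_sp2])
  then have "?f p = 0" if "p \<in> sp_ideal" for p
    using that unfolding sp_ideal_def
    by (elim crmap_ideal_zero[OF f, rotated]) auto
  then show "?f p = ?f q" if "p - q \<in> sp_ideal" for p q
    using that crmapD(6)[OF f, of p q] by simp
qed


text \<open>The records below have a whole type of class \<^class>\<open>complex_module\<close> as carrier, with the
  vector space operations of the type, unless the carrier is explicitly restricted.\<close>

record (overloaded) 'a comodule_algebra = "(complex, 'a) module" +
  coaction :: "'a \<Rightarrow> torus \<Rightarrow>\<^sub>0 'a"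

abbreviation component :: "('a::zero, 'b) comodule_algebra_scheme \<Rightarrow> 'a \<Rightarrow> torus \<Rightarrow> 'a"
  where "component R x \<equiv> Poly_Mapping.lookup (coaction R x)"

abbreviation degrees :: "('a::zero, 'b) comodule_algebra_scheme \<Rightarrow> 'a \<Rightarrow> torus set"
  where "degrees R x \<equiv> Poly_Mapping.keys (coaction R x)"

definition comm_alg :: "('a::complex_algebra \<Rightarrow> torus \<Rightarrow>\<^sub>0 'a) \<Rightarrow> 'a comodule_algebra"
  where "comm_alg \<delta> = \<lparr>carrier = UNIV, mult = (*), one = 1, zero = 0, add = (+), smult = cscale,
    coaction = \<delta>\<rparr>"

text \<open>The formula \<open>F(|a|, |b|) ab\<close> extended bilinearly from homogeneous elements, see lemma
  \<open>cotwist_mult\<close>; likewise for the braided tensor product, see lemma \<open>braided_tensor_mult\<close>.\<close>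

definition cotwist :: "real \<Rightarrow> 'a::complex_module comodule_algebra \<Rightarrow> 'a comodule_algebra"
  where "cotwist \<theta> R = R\<lparr>mult := (\<lambda>a b. \<Sum>g\<in>degrees R a. \<Sum>h\<in>degrees R b.
    twist \<theta> g h *\<^sub>C (component R a g \<otimes>\<^bsub>R\<^esub> component R b h))\<rparr>"

definition twist_inv2 :: "real \<Rightarrow> torus \<Rightarrow> torus \<Rightarrow> complex"
  where "twist_inv2 \<theta> g h = inverse ((twist \<theta> g h)\<^sup>2)"

definition braided_tensor :: "real \<Rightarrow> 'a::complex_module comodule_algebra \<Rightarrow>
    'b::complex_module comodule_algebra \<Rightarrow> ('a, 'b) tensor comodule_algebra"
  where "braided_tensor \<theta> B C = \<lparr>carrier = UNIV,
    mult = (\<lambda>x y. tensor_lift (\<lambda>a b. tensor_lift (\<lambda>c d.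
      \<Sum>g\<in>degrees B c. \<Sum>h\<in>degrees C b. twist_inv2 \<theta> g h *\<^sub>C
        ((a \<otimes>\<^bsub>B\<^esub> component B c g) \<boxtimes> (component C b h \<otimes>\<^bsub>C\<^esub> d))) y) x),
    one = \<one>\<^bsub>B\<^esub> \<boxtimes> \<one>\<^bsub>C\<^esub>, zero = 0, add = (+), smult = cscale,
    coaction = tensor_lift (\<lambda>a b. \<Sum>g\<in>degrees B a. \<Sum>h\<in>degrees C b.
      Poly_Mapping.single (g + h) (component B a g \<boxtimes> component C b h))\<rparr>"

definition algebra_hom ::
    "('a, 'c) comodule_algebra_scheme \<Rightarrow> ('b, 'd) comodule_algebra_scheme \<Rightarrow> ('a \<Rightarrow> 'b) set"
  where "algebra_hom R S =
    {f \<in> ring_hom R S. \<forall>c. \<forall>x\<in>carrier R. f (c \<odot>\<^bsub>R\<^esub> x) = c \<odot>\<^bsub>S\<^esub> f x}"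

definition algebra_iso ::
    "('a, 'c) comodule_algebra_scheme \<Rightarrow> ('b, 'd) comodule_algebra_scheme \<Rightarrow> ('a \<Rightarrow> 'b) set"
  where "algebra_iso R S = {f \<in> algebra_hom R S. bij_betw f (carrier R) (carrier S)}"

definition is_subalgebra :: "'a set \<Rightarrow> ('a, 'c) comodule_algebra_scheme \<Rightarrow> bool"
  where "is_subalgebra V R \<longleftrightarrow> V \<subseteq> carrier R \<and> \<one>\<^bsub>R\<^esub> \<in> V \<and>
    (\<forall>x\<in>V. \<forall>y\<in>V. x \<oplus>\<^bsub>R\<^esub> y \<in> V \<and> x \<otimes>\<^bsub>R\<^esub> y \<in> V) \<and> (\<forall>c. \<forall>x\<in>V. c \<odot>\<^bsub>R\<^esub> x \<in> V)"

definition generated_subalgebra :: "('a, 'c) comodule_algebra_scheme \<Rightarrow> 'a set \<Rightarrow> 'a set"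
  where "generated_subalgebra R S = \<Inter>{V. is_subalgebra V R \<and> S \<subseteq> V}"


definition B_SL :: "real \<Rightarrow> sl2h comodule_algebra"
  where "B_SL \<theta> = cotwist \<theta> (comm_alg coact_sl)"

definition B_Sp :: "real \<Rightarrow> sp2 comodule_algebra"
  where "B_Sp \<theta> = cotwist \<theta> (comm_alg coact_sp)"

text \<open>Cotwisting changes neither the underlying spaces nor the projection between them, so that
  the projection of the braided groups does not depend on the parameter.\<close>

definition \<Pi>\<^sub>\<theta> :: "sl2h \<Rightarrow> sp2"
  where "\<Pi>\<^sub>\<theta> = abs_sp2"

text \<open>The coaction of H on itself is the coproduct.\<close>

definition H_F :: "hopf comodule_algebra"
  where "H_F = comm_alg (\<lambda>p. \<Sum>g\<in>Poly_Mapping.keys p.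
    Poly_Mapping.single g (Poly_Mapping.single g (Poly_Mapping.lookup p g)))"

definition A_hat :: "real \<Rightarrow> 4 \<Rightarrow> 4 \<Rightarrow> sl2h"
  where "A_hat \<theta> i j = inverse (twist \<theta> (tau i) (tau j)) *\<^sub>C A_sl i j"

text \<open>There is at most one such map, since the entries of \<open>A_hat\<close> generate \<open>B_SL\<close>.\<close>

definition braided_coproduct :: "real \<Rightarrow> sl2h \<Rightarrow> (sl2h, sl2h) tensor"
  where "braided_coproduct \<theta> =
    (THE \<Delta>. \<Delta> \<in> algebra_hom (B_SL \<theta>) (braided_tensor \<theta> (B_SL \<theta>) (B_SL \<theta>)) \<and>
      (\<forall>i j. \<Delta> (A_hat \<theta> i j) = (\<Sum>\<alpha>\<in>UNIV. A_hat \<theta> i \<alpha> \<boxtimes> A_hat \<theta> \<alpha> j)))"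

text \<open>By lemma \<open>cobosonisation_mult\<close> below, the product of the cobosonisation is the product of the
  braided tensor product with H carrying its coproduct as coaction. Since we work over a field,
  the tensor product of a subspace K with H is the subspace spanned by the elementary tensors.\<close>

definition cobosonisation :: "real \<Rightarrow> sl2h set \<Rightarrow> (sl2h, hopf) tensor comodule_algebra"
  where "cobosonisation \<theta> K =
    (braided_tensor \<theta> (B_SL \<theta>) H_F)\<lparr>carrier := cspan {a \<boxtimes> h | a h. a \<in> K}\<rparr>"

definition \<delta>\<^sub>L :: "real \<Rightarrow> (sl2h, hopf) tensor \<Rightarrow> (sp2, (sl2h, hopf) tensor) tensor"
  where "\<delta>\<^sub>L \<theta> = tensor_lift (\<lambda>a h.
    tensor_lift (\<lambda>a1 a2. \<Pi>\<^sub>\<theta> a1 \<boxtimes> (a2 \<boxtimes> h)) (braided_coproduct \<theta> a))"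

definition coinvariants :: "real \<Rightarrow> (sl2h, hopf) tensor set"
  where "coinvariants \<theta> =
    {a \<in> carrier (cobosonisation \<theta> (carrier (B_SL \<theta>))). \<delta>\<^sub>L \<theta> a = \<one>\<^bsub>B_Sp \<theta>\<^esub> \<boxtimes> a}"

definition m_gen :: "real \<Rightarrow> 4 \<Rightarrow> 4 \<Rightarrow> sl2h"
  where "m_gen \<theta> i j =
    (\<Sum>\<alpha>\<in>UNIV. star_sl (A_hat \<theta> \<alpha> i) \<otimes>\<^bsub>B_SL \<theta>\<^esub> A_hat \<theta> \<alpha> j)"

definition B_M :: "real \<Rightarrow> sl2h set"
  where "B_M \<theta> = generated_subalgebra (B_SL \<theta>) {m_gen \<theta> i j | i j. True}"

lemma clinearI:
  "(\<And>x y. f (x + y) = f x + f y) \<Longrightarrow> (\<And>c x. f (c *\<^sub>C x) = c *\<^sub>C f x) \<Longrightarrow> clinear f"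
  by (intro module_hom.intro module_hom_axioms.intro cvs.module_axioms)

lemma cbilinearI:
  assumes "\<And>x y z. f (x + y) z = f x z + f y z" "\<And>c x z. f (c *\<^sub>C x) z = c *\<^sub>C f x z"
    "\<And>u v w. f w (u + v) = f w u + f w v" "\<And>c u w. f w (c *\<^sub>C u) = c *\<^sub>C f w u"
  shows "cbilinear f"
  unfolding cbilinear_def by (intro conjI allI clinearI assms)

lemma cbilinearD:
  assumes "cbilinear f"
  shows "f (x + y) w = f x w + f y w" "f (c *\<^sub>C x) w = c *\<^sub>C f x w"
    "f x (v + w) = f x v + f x w" "f x (c *\<^sub>C w) = c *\<^sub>C f x w"
    "f 0 w = 0" "f x 0 = 0"
proof -
  have l: "clinear (f z)" "clinear (\<lambda>x. f x w)" for z w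
    using assms by (auto simp: cbilinear_def)
  show "f (x + y) w = f x w + f y w" "f (c *\<^sub>C x) w = c *\<^sub>C f x w" "f 0 w = 0"
    using l(2)[THEN module_hom.add] l(2)[THEN module_hom.scale] l(2)[THEN module_hom.zero] by auto
  show "f x (v + w) = f x v + f x w" "f x (c *\<^sub>C w) = c *\<^sub>C f x w" "f x 0 = 0"
    using l(1)[THEN module_hom.add] l(1)[THEN module_hom.scale] l(1)[THEN module_hom.zero] by auto
qed

lemma sum_keys_superset:
  assumes "finite S" "Poly_Mapping.keys p \<subseteq> S" "\<And>g. \<phi> g 0 = 0"
  shows "(\<Sum>g\<in>Poly_Mapping.keys p. \<phi> g (Poly_Mapping.lookup p g))
    = (\<Sum>g\<in>S. \<phi> g (Poly_Mapping.lookup p g))"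
  by (rule sum.mono_neutral_left) (use assms in \<open>auto simp: in_keys_iff\<close>)

lemma clinear_sum_keys:
  fixes \<phi> :: "'k \<Rightarrow> 'a::complex_module \<Rightarrow> 'b::complex_module"
  assumes "\<And>g. clinear (\<phi> g)"
  shows "clinear (\<lambda>p. \<Sum>g\<in>Poly_Mapping.keys p. \<phi> g (Poly_Mapping.lookup p g))"
proof (rule clinearI)
  note l = assms[THEN module_hom.add] assms[THEN module_hom.scale] assms[THEN module_hom.zero]
  fix p q :: "'k \<Rightarrow>\<^sub>0 'a" and c
  let ?S = "Poly_Mapping.keys p \<union> Poly_Mapping.keys q"
  have "Poly_Mapping.keys (c *\<^sub>C p) \<subseteq> Poly_Mapping.keys p"
    by (auto simp: in_keys_iff)
  then have "(\<Sum>g\<in>Poly_Mapping.keys (c *\<^sub>C p). \<phi> g (Poly_Mapping.lookup (c *\<^sub>C p) g)) =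
    (\<Sum>g\<in>Poly_Mapping.keys p. \<phi> g (Poly_Mapping.lookup (c *\<^sub>C p) g))"
    by (intro sum_keys_superset) (simp_all add: l)
  then show "(\<Sum>g\<in>Poly_Mapping.keys (c *\<^sub>C p). \<phi> g (Poly_Mapping.lookup (c *\<^sub>C p) g)) =
    c *\<^sub>C (\<Sum>g\<in>Poly_Mapping.keys p. \<phi> g (Poly_Mapping.lookup p g))"
    by (simp add: l cvs.scale_sum_right)
  have "(\<Sum>g\<in>Poly_Mapping.keys (p + q). \<phi> g (Poly_Mapping.lookup (p + q) g)) =
    (\<Sum>g\<in>?S. \<phi> g (Poly_Mapping.lookup (p + q) g))"
    by (intro sum_keys_superset) (simp_all add: l Poly_Mapping.keys_add)
  also have "\<dots> = (\<Sum>g\<in>?S. \<phi> g (Poly_Mapping.lookup p g)) + (\<Sum>g\<in>?S. \<phi> g (Poly_Mapping.lookup q g))"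
    by (simp add: lookup_add l sum.distrib)
  also have "\<dots> = (\<Sum>g\<in>Poly_Mapping.keys p. \<phi> g (Poly_Mapping.lookup p g)) +
    (\<Sum>g\<in>Poly_Mapping.keys q. \<phi> g (Poly_Mapping.lookup q g))"
    by (simp add: l sum_keys_superset[of ?S p \<phi>] sum_keys_superset[of ?S q \<phi>])
  finally show "(\<Sum>g\<in>Poly_Mapping.keys (p + q). \<phi> g (Poly_Mapping.lookup (p + q) g)) =
    (\<Sum>g\<in>Poly_Mapping.keys p. \<phi> g (Poly_Mapping.lookup p g)) +
    (\<Sum>g\<in>Poly_Mapping.keys q. \<phi> g (Poly_Mapping.lookup q g))" .
qed

lemma sum_keys_single:
  "\<phi> g 0 = 0 \<Longrightarrow> (\<Sum>k\<in>Poly_Mapping.keys (Poly_Mapping.single g x).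
    \<phi> k (Poly_Mapping.lookup (Poly_Mapping.single g x) k)) = \<phi> g x"
  by (cases "x = 0") simp_all

lemma cbilinear_sum_keys2:
  fixes \<phi> :: "'k \<Rightarrow> 'l \<Rightarrow> 'a::complex_module \<Rightarrow> 'b::complex_module \<Rightarrow> 'c::complex_module"
  assumes \<phi>: "\<And>g h. cbilinear (\<phi> g h)" and "clinear \<delta>" "clinear \<epsilon>"
  shows "cbilinear (\<lambda>a b. \<Sum>g\<in>Poly_Mapping.keys (\<delta> a). \<Sum>h\<in>Poly_Mapping.keys (\<epsilon> b).
    \<phi> g h (Poly_Mapping.lookup (\<delta> a) g) (Poly_Mapping.lookup (\<epsilon> b) h))"
proof -
  note d = assms(2,3)[THEN module_hom.add] assms(2,3)[THEN module_hom.scale]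
  have 1: "clinear (\<lambda>p. \<Sum>g\<in>Poly_Mapping.keys p. \<Sum>h\<in>Poly_Mapping.keys q.
      \<phi> g h (Poly_Mapping.lookup p g) (Poly_Mapping.lookup q h))" for q
    by (rule clinear_sum_keys, rule clinearI)
      (simp_all add: cbilinearD[OF \<phi>] sum.distrib cvs.scale_sum_right)
  have 2: "clinear (\<lambda>q. \<Sum>g\<in>Poly_Mapping.keys p. \<Sum>h\<in>Poly_Mapping.keys q.
      \<phi> g h (Poly_Mapping.lookup p g) (Poly_Mapping.lookup q h))" for p
    apply (subst sum.swap)
    apply (rule clinear_sum_keys, rule clinearI)
     apply (simp_all add: cbilinearD[OF \<phi>] sum.distrib cvs.scale_sum_right)
    done
  note l = 1[THEN module_hom.add] 1[THEN module_hom.scale] 2[THEN module_hom.add] 2[THEN module_hom.scale]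
  show ?thesis by (rule cbilinearI) (simp_all only: d l)
qed

lemma sum_keys2_single:
  assumes "cbilinear (\<phi> g h)"
  shows "(\<Sum>k\<in>Poly_Mapping.keys (Poly_Mapping.single g x).
    \<Sum>l\<in>Poly_Mapping.keys (Poly_Mapping.single h y).
    \<phi> k l (Poly_Mapping.lookup (Poly_Mapping.single g x) k)
      (Poly_Mapping.lookup (Poly_Mapping.single h y) l)) = \<phi> g h x y"
  by (cases "x = 0"; cases "y = 0") (simp_all add: cbilinearD[OF assms])

lemma cbilinear_mult: "cbilinear ((*) :: 'a::complex_algebra \<Rightarrow> _)"
  by (rule cbilinearI) (simp_all add: distrib_left distrib_right cscale_mult_left cscale_mult_right)

lemma cbilinear_scale:
  assumes "cbilinear f"
  shows "cbilinear (\<lambda>x y. c *\<^sub>C f x y)"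
  by (rule cbilinearI)
    (simp_all add: cbilinearD[OF assms] cscale_add_right cscale_cscale mult.commute)

lemma clinear_map:
  assumes "clinear f"
  shows "clinear (Poly_Mapping.map f)"
  by (rule clinearI; rule poly_mapping_eqI)
    (simp_all add: lookup_map_zero lookup_add assms[THEN module_hom.zero]
      assms[THEN module_hom.add] assms[THEN module_hom.scale])

lemma clinear_coact_sl: "clinear coact_sl"
proof (rule clinearI)
  show "coact_sl (x + y) = coact_sl x + coact_sl y" for x y
    by (rule crmapD(2)[OF crmap_coact_sl])
  have "clinear abs_sl2h"
    by (rule clinearI) (simp_all add: abs_sl2h_cscale crmapD[OF crmap_abs_sl2h])
  note l = clinear_map[OF this, THEN module_hom.scale]
  have "coact_m (c *\<^sub>C p) = c *\<^sub>C coact_m p" for c p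
    by (simp add: coact_m_def poly_eval_cscale)
  then show "coact_sl (c *\<^sub>C x) = c *\<^sub>C coact_sl x" for c x
    by transfer (simp add: l)
qed

lemma clinear_coact_sp: "clinear coact_sp"
proof -
  have "clinear abs_sp2"
    by (rule clinearI) (simp_all add: cscale_sp2.abs_eq crmapD[OF crmap_abs_sp2])
  note l = clinear_map[OF this]
  show ?thesis
    by (rule clinearI; transfer)
      (simp_all add: clinear_coact_sl[THEN module_hom.add] clinear_coact_sl[THEN module_hom.scale]
        l[THEN module_hom.add] l[THEN module_hom.scale])
qed

lemma clinear_coaction:
  "clinear (coaction (B_SL \<theta>))" "clinear (coaction (B_Sp \<theta>))" "clinear (coaction H_F)"
proof -
  show "clinear (coaction (B_SL \<theta>))" "clinear (coaction (B_Sp \<theta>))"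
    by (simp_all add: B_SL_def B_Sp_def cotwist_def comm_alg_def clinear_coact_sl clinear_coact_sp)
  have "clinear (\<lambda>x. Poly_Mapping.single g (Poly_Mapping.single g x))" for g :: torus
    by (rule clinearI) (simp_all add: single_add cscale_single)
  from clinear_sum_keys[of "\<lambda>g x. Poly_Mapping.single g (Poly_Mapping.single g x)", OF this]
  show "clinear (coaction H_F)"
    by (simp add: H_F_def comm_alg_def)
qed

lemma cbilinear_cotwist:
  assumes "clinear (coaction R)" "cbilinear (mult R)"
  shows "cbilinear (mult (cotwist \<theta> R))"
proof -
  have "cbilinear (\<lambda>x y. twist \<theta> g h *\<^sub>C (x \<otimes>\<^bsub>R\<^esub> y))" for g h
    by (rule cbilinear_scale) (use assms(2) in simp)
  from cbilinear_sum_keys2[of "\<lambda>g h x y. twist \<theta> g h *\<^sub>C (x \<otimes>\<^bsub>R\<^esub> y)", OF this assms(1,1)]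
  show ?thesis by (simp add: cotwist_def)
qed

lemma cbilinear_mult_B:
  "cbilinear (mult (B_SL \<theta>))" "cbilinear (mult (B_Sp \<theta>))" "cbilinear (mult H_F)"
  unfolding B_SL_def B_Sp_def
  by (auto simp: H_F_def comm_alg_def cbilinear_mult clinear_coact_sl clinear_coact_sp
      intro!: cbilinear_cotwist)

definition homogeneous :: "('a::zero, 'b) comodule_algebra_scheme \<Rightarrow> torus \<Rightarrow> 'a \<Rightarrow> bool"
  where "homogeneous R g x \<longleftrightarrow> coaction R x = Poly_Mapping.single g x"

lemma cotwist_mult:
  assumes "cbilinear (mult R)" "homogeneous R g a" "homogeneous R h b"
  shows "a \<otimes>\<^bsub>cotwist \<theta> R\<^esub> b = twist \<theta> g h *\<^sub>C (a \<otimes>\<^bsub>R\<^esub> b)"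
  using assms(2,3) sum_keys2_single[of "\<lambda>g h x y. twist \<theta> g h *\<^sub>C (x \<otimes>\<^bsub>R\<^esub> y)" g h a b]
    cbilinear_scale[OF assms(1)]
  by (simp add: cotwist_def homogeneous_def)

lemma braided_tensor_mult:
  fixes B :: "'a::complex_module comodule_algebra" and C :: "'b::complex_module comodule_algebra"
  assumes B: "clinear (coaction B)" "cbilinear (mult B)"
    and C: "clinear (coaction C)" "cbilinear (mult C)"
    and hom: "homogeneous B g c" "homogeneous C h b"
  shows "(a \<boxtimes> b) \<otimes>\<^bsub>braided_tensor \<theta> B C\<^esub> (c \<boxtimes> d)
    = twist_inv2 \<theta> g h *\<^sub>C ((a \<otimes>\<^bsub>B\<^esub> c) \<boxtimes> (b \<otimes>\<^bsub>C\<^esub> d))"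
proof -
  define M :: "'a \<Rightarrow> 'b \<Rightarrow> 'a \<Rightarrow> 'b \<Rightarrow> ('a, 'b) tensor" where "M a b c d = (\<Sum>g\<in>degrees B c. \<Sum>h\<in>degrees C b. twist_inv2 \<theta> g h *\<^sub>C
        ((a \<otimes>\<^bsub>B\<^esub> component B c g) \<boxtimes> (component C b h \<otimes>\<^bsub>C\<^esub> d)))" for a b c d
  note t = cbilinearD[OF cbilinear_pure_tensor] cbilinearD[OF B(2)] cbilinearD[OF C(2)]
  have bi: "cbilinear (\<lambda>x y. twist_inv2 \<theta> g h *\<^sub>C ((a \<otimes>\<^bsub>B\<^esub> x) \<boxtimes> (y \<otimes>\<^bsub>C\<^esub> d)))" for a d g h
    by (rule cbilinear_scale, rule cbilinearI) (simp_all add: t)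
  have cb: "cbilinear (\<lambda>c b. M a b c d)" for a d
    unfolding M_def by (rule cbilinear_sum_keys2[OF bi B(1) C(1)])
  have lin: "M (a + a') b c d = M a b c d + M a' b c d" "M (z *\<^sub>C a) b c d = z *\<^sub>C M a b c d"
    "M a b c (d + d') = M a b c d + M a b c d'" "M a b c (z *\<^sub>C d) = z *\<^sub>C M a b c d"
    for a a' b c d d' z
    unfolding M_def
    by (simp_all add: t cscale_add_right cscale_cscale sum.distrib cvs.scale_sum_right mult.commute)
  have inner: "cbilinear (\<lambda>c d. M a b c d)" for a b
    by (rule cbilinearI) (simp_all add: lin cbilinearD[OF cb])
  have add_fun: "tensor_lift f y = tensor_lift f1 y + tensor_lift f2 y"
    if "cbilinear f" "cbilinear f1" "cbilinear f2" "\<And>c d. f c d = f1 c d + f2 c d"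
    for f f1 f2 :: "'a \<Rightarrow> 'b \<Rightarrow> ('a, 'b) tensor" and y
  proof -
    have "f c d = f1 c d + f2 c d" for c d by (rule that)
    then have "lin_ext (\<lambda>(a, b). f a b) p = lin_ext (\<lambda>(a, b). f1 a b) p + lin_ext (\<lambda>(a, b). f2 a b) p"
      for p by (simp add: lin_ext_def case_prod_unfold cscale_add_right sum.distrib)
    then show ?thesis by (simp add: tensor_lift_def)
  qed
  have scale_fun: "tensor_lift f y = z *\<^sub>C tensor_lift f1 y"
    if "\<And>c d. f c d = z *\<^sub>C f1 c d" for f f1 :: "'a \<Rightarrow> 'b \<Rightarrow> ('a, 'b) tensor" and y z
    using that by (simp add: tensor_lift_def lin_ext_def case_prod_unfold cvs.scale_sum_right
        cscale_cscale mult.commute)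
  have outer: "cbilinear (\<lambda>a b. tensor_lift (M a b) y)" for y
    by (rule cbilinearI; (rule add_fun[OF inner inner inner] | rule scale_fun))
      (simp_all add: lin cbilinearD[OF cb])
  have "(a \<boxtimes> b) \<otimes>\<^bsub>braided_tensor \<theta> B C\<^esub> (c \<boxtimes> d)
      = tensor_lift (\<lambda>a b. tensor_lift (M a b) (c \<boxtimes> d)) (a \<boxtimes> b)"
    by (simp add: braided_tensor_def M_def[abs_def])
  also have "\<dots> = M a b c d"
    by (subst tensor_lift_pure[OF outer]) (rule tensor_lift_pure[OF inner])
  also have "\<dots> = twist_inv2 \<theta> g h *\<^sub>C ((a \<otimes>\<^bsub>B\<^esub> c) \<boxtimes> (b \<otimes>\<^bsub>C\<^esub> d))"
    using hom sum_keys2_single[of "\<lambda>g h x y. twist_inv2 \<theta> g h *\<^sub>C ((a \<otimes>\<^bsub>B\<^esub> x) \<boxtimes> (y \<otimes>\<^bsub>C\<^esub> d))" g h c b, OF bi]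
    by (simp add: M_def homogeneous_def)
  finally show ?thesis .
qed

lemma homogeneous_H_F: "homogeneous H_F g (Poly_Mapping.single g c)"
  using sum_keys_single[of "\<lambda>g x. Poly_Mapping.single g (Poly_Mapping.single g x)" g c]
  by (simp add: homogeneous_def H_F_def comm_alg_def)

lemma B_SL_mult:
  assumes "homogeneous (B_SL \<theta>) g a" "homogeneous (B_SL \<theta>) h b"
  shows "a \<otimes>\<^bsub>B_SL \<theta>\<^esub> b = twist \<theta> g h *\<^sub>C (a * b)"
proof -
  have "a \<otimes>\<^bsub>B_SL \<theta>\<^esub> b = twist \<theta> g h *\<^sub>C (a \<otimes>\<^bsub>comm_alg coact_sl\<^esub> b)"
    unfolding B_SL_def
    by (rule cotwist_mult) (use assms in \<open>simp_all add: cbilinear_mult comm_alg_def homogeneous_def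
        B_SL_def cotwist_def\<close>)
  then show ?thesis by (simp add: comm_alg_def)
qed

lemma cobosonisation_mult:
  fixes g h p :: torus
  assumes "homogeneous (B_SL \<theta>) p b"
  defines "t \<equiv> \<lambda>g. Poly_Mapping.single g (1::complex)"
  shows "(a \<boxtimes> t g) \<otimes>\<^bsub>cobosonisation \<theta> K\<^esub> (b \<boxtimes> t h)
    = twist_inv2 \<theta> p g *\<^sub>C ((a \<otimes>\<^bsub>B_SL \<theta>\<^esub> b) \<boxtimes> t (g + h))"
proof -
  have "t g \<otimes>\<^bsub>H_F\<^esub> t h = t (g + h)"
    by (simp add: H_F_def comm_alg_def t_def mult_single)
  with braided_tensor_mult[OF clinear_coaction(1) cbilinear_mult_B(1) clinear_coaction(3)
      cbilinear_mult_B(3) assms(1) homogeneous_H_F[of g 1]]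
  show ?thesis by (simp add: cobosonisation_def t_def)
qed

end

theory Submission
  imports Defs
begin

text \<open>
  Forgetting the star, \<open>A(SL(2,H))\<close> is the coordinate algebra of \<open>SL\<^sub>4\<close> over the complex numbers,
  and \<open>A(Sp(2))\<close> is that of the subgroup \<open>Sp\<^sub>4\<close>. Up to sign, the elements
  \<open>\<Sum>\<^sub>\<alpha> A\<^sub>\<alpha>\<^sub>i\<^sup>* A\<^sub>\<alpha>\<^sub>j\<close> are the entries of the Gram matrix \<open>gram_A\<close> of the columns of A for
  the symplectic form. The theorem follows from three facts; in the end the two subalgebras are equal,
  not just isomorphic.

  The twist can be removed. The coordinate algebra is bigraded by the weights of the torus acting from
  the left and from the right. The map \<open>hat\<close>, which divides the component of weights \<open>(l, r)\<close> by
  \<open>F(l, r)\<close>, conjugates the ordinary comultiplication into the braided one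
  (\<open>braided_coproduct_eq\<close>), and it descends to \<open>Sp(2)\<close>. Hence the braided coinvariants are the
  image under \<open>hat\<close> of the functions on \<open>SL\<^sub>4\<close> that are invariant under left translation by
  \<open>Sp\<^sub>4\<close> (\<open>braided_coinvariant_iff\<close>). The entries of the Gram matrix have left weight 0, so
  \<open>hat\<close> is the identity on the algebra that they generate; and since they are homogeneous, they
  generate the same subspace for the twisted product as for the ordinary one
  (\<open>B_M_eq_gram_algebra\<close>).

  The invariants of \<open>Sp\<^sub>4\<close> on \<open>SL\<^sub>4\<close> are generated by the Gram matrix
  (\<open>coinvariant_in_gram_algebra\<close>). The quotient of \<open>SL\<^sub>4\<close> by \<open>Sp\<^sub>4\<close> is the space of alternating
  matrices of Pfaffian 1. It is covered by the three open sets on which one of the entries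
  \<open>(1, 2)\<close>, \<open>(1, 3)\<close>, \<open>(1, 4)\<close> is invertible, and on each of them the quotient map has a section
  with entries that are polynomials in the Gram matrix and the inverse of that entry. Evaluating an
  invariant function on the section shows that some power of the entry multiplies it into the algebra
  of the Gram matrix (\<open>coinvariant_on_chart\<close>). The Pfaffian being 1, the three entries generate the
  unit ideal, and the function itself belongs to the algebra.

  The factor H is inert. Its monomials form a basis, and the coaction leaves it alone, so an element of
  the cobosonisation is coinvariant if and only if its coefficients are (\<open>coinvariants_eq\<close>).
\<close>

(* Used as a rewrite rule, it would reassociate products to the left, against the normal form of
   the rules for commutative rings, and the simplifier would loop. *)
declare rmod.scale_scale [simp del]

section \<open>Linear algebra and the algebra structure on tensor products\<close>

lemma clinearD:
  assumes "clinear f"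
  shows "f (x + y) = f x + f y" "f (c *\<^sub>C x) = c *\<^sub>C f x" "f 0 = 0" "f (x - y) = f x - f y"
    "f (sum g S) = (\<Sum>i\<in>S. f (g i))"
  using assms[THEN module_hom.add] assms[THEN module_hom.scale] assms[THEN module_hom.zero]
    assms[THEN module_hom.diff] assms[THEN module_hom.sum] by auto

lemma clinear_comp: "clinear f \<Longrightarrow> clinear g \<Longrightarrow> clinear (\<lambda>x. g (f x))"
  by (rule clinearI) (simp_all add: clinearD)

lemma clinear_id: "clinear (\<lambda>x. x)"
  by (simp add: clinearI)

lemma crmap_id: "crmap (\<lambda>x. x)"
  by (simp add: crmap_def)

lemma cspan_induct [consumes 1, case_names base zero add scale]:
  assumes "x \<in> cspan S" and "\<And>s. s \<in> S \<Longrightarrow> P s" "P 0"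
    and "\<And>x y. P x \<Longrightarrow> P y \<Longrightarrow> P (x + y)" "\<And>c x. P x \<Longrightarrow> P (c *\<^sub>C x)"
  shows "P x"
  using assms(1) by (induction rule: cvs.span_induct_alt) (auto intro: assms)

lemma clinear_eq_on_cspan:
  assumes "clinear f" "clinear g" "\<And>s. s \<in> S \<Longrightarrow> f s = g s" "x \<in> cspan S"
  shows "f x = g x"
  using assms(4,1,2,3) by (induction rule: cspan_induct) (simp_all add: clinearD)

lemma clinear_left: "cbilinear f \<Longrightarrow> clinear (\<lambda>x. f x y)"
  and clinear_right: "cbilinear f \<Longrightarrow> clinear (f x)"
  by (simp_all add: cbilinear_def)

lemma cbilinear_eq_on_cspan:
  assumes f: "cbilinear f" and g: "cbilinear g"
    and eq: "\<And>s t. s \<in> S \<Longrightarrow> t \<in> T \<Longrightarrow> f s t = g s t"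
    and x: "x \<in> cspan S" and y: "y \<in> cspan T"
  shows "f x y = g x y"
proof -
  have "f s y = g s y" if "s \<in> S" for s
    by (rule clinear_eq_on_cspan[OF clinear_right[OF f] clinear_right[OF g] eq[OF that] y])
  then show ?thesis
    by (rule clinear_eq_on_cspan[OF clinear_left[OF f] clinear_left[OF g] _ x])
qed

lemma cbilinear_closed_on_cspan:
  assumes f: "cbilinear f" and V: "cvs.subspace V"
    and base: "\<And>s t. s \<in> S \<Longrightarrow> t \<in> T \<Longrightarrow> f s t \<in> V"
    and x: "x \<in> cspan S" and y: "y \<in> cspan T"
  shows "f x y \<in> V"
proof -
  note V' = cvs.subspace_0[OF V] cvs.subspace_add[OF V] cvs.subspace_scale[OF V]
  have "f s y \<in> V" if "s \<in> S" for s
    using y by (induction rule: cspan_induct) (simp_all add: cbilinearD[OF f] V' base that)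
  with x show ?thesis
    by (induction rule: cspan_induct) (simp_all add: cbilinearD[OF f] V')
qed

lemma cbilinear_lincomb:
  assumes f: "cbilinear f"
  shows "f (\<Sum>i\<in>S. a i *\<^sub>C u i) (\<Sum>j\<in>T. b j *\<^sub>C v j) =
    (\<Sum>i\<in>S. \<Sum>j\<in>T. (a i * b j) *\<^sub>C f (u i) (v j))"
proof -
  have l: "f (\<Sum>i\<in>S. a i *\<^sub>C u i) y = (\<Sum>i\<in>S. a i *\<^sub>C f (u i) y)" for y
    by (simp only: clinearD(5)[OF clinear_left[OF f]] cbilinearD[OF f])
  have r: "f x (\<Sum>j\<in>T. b j *\<^sub>C v j) = (\<Sum>j\<in>T. b j *\<^sub>C f x (v j))" for x
    by (simp only: clinearD(5)[OF clinear_right[OF f]] cbilinearD[OF f])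
  show ?thesis
    unfolding l unfolding r by (simp only: cvs.scale_sum_right cscale_cscale)
qed

text \<open>Maps out of a tensor product are honest linear maps, whereas invariance will be used only modulo
  an ideal. Functionals that vanish on the ideal bridge the gap: they turn congruences into equations,
  and by this lemma enough of them exist.\<close>

lemma separating_functional:
  fixes v :: "'a::complex_module"
  assumes I: "cvs.subspace I" and v: "v \<notin> I"
  obtains l :: "'a \<Rightarrow> complex" where "clinear l" "\<And>x. x \<in> I \<Longrightarrow> l x = 0" "l v = 1"
proof -
  interpret vp: vector_space_pair "cscale :: complex \<Rightarrow> 'a \<Rightarrow> 'a" "cscale :: complex \<Rightarrow> complex \<Rightarrow> complex"
    by unfold_locales
  obtain B where B: "B \<subseteq> I" "\<not> cvs.dependent B" "I \<subseteq> cspan B"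
    using cvs.maximal_independent_subset by blast
  have "cspan B \<subseteq> I" using B(1) I by (rule cvs.span_minimal)
  with v have "v \<notin> cspan B" by blast
  then have "\<not> cvs.dependent (insert v B)" using B(2) by (rule cvs.independent_insertI)
  from vp.linear_independent_extend[OF this, of "\<lambda>x. if x = v then 1 else (0::complex)"]
  obtain l :: "'a \<Rightarrow> complex" where l: "Vector_Spaces.linear cscale cscale l"
    "\<forall>x\<in>insert v B. l x = (if x = v then 1 else 0)" by blast
  have lin: "clinear l" using l(1) by (simp add: Vector_Spaces.linear_def)
  have "l x = 0" if "x \<in> I" for x
  proof -
    have "x \<in> cspan B" using that B(3) by blast
    then show ?thesis
    proof (rule clinear_eq_on_cspan[OF lin, of "\<lambda>_. 0", rotated 2])
      show "l s = 0" if "s \<in> B" for s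
        using that l(2) \<open>v \<notin> cspan B\<close> cvs.span_base[of v B] by auto
    qed (simp add: clinearI)
  qed
  with lin l(2) that show thesis by auto
qed

lemmas pure_simps = cbilinearD[OF cbilinear_pure_tensor]

lemma tensor_induct [case_names pure add]:
  fixes x :: "('a::complex_module, 'b::complex_module) tensor"
  assumes pure: "\<And>a b. P (a \<boxtimes> b)" and add: "\<And>x y. P x \<Longrightarrow> P y \<Longrightarrow> P (x + y)"
  shows "P x"
proof (induct x)
  fix p
  show "P (abs_tensor p)"
  proof (induction p rule: poly_mapping_single_induct)
    case zero
    have "abs_tensor 0 = (0::'a) \<boxtimes> (0::'b)"
      by (simp add: cbilinearD[OF cbilinear_pure_tensor] zero_tensor_def)
    then show ?case using pure by metis
  next
    case (single_plus k c p)
    have abs: "abs_tensor (Poly_Mapping.single k c) = (c *\<^sub>C fst k) \<boxtimes> snd k"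
      by (simp only: pure_simps)
        (simp add: pure_tensor.abs_eq cscale_tensor.abs_eq cscale_single cscale_complex_def)
    show ?case
      unfolding plus_tensor.abs_eq[symmetric] abs by (rule add[OF pure single_plus])
  qed
qed

lemma pure_tensor_cspan:
  assumes "a \<in> cspan S" "b \<in> cspan T"
  shows "a \<boxtimes> b \<in> cspan {s \<boxtimes> t | s t. s \<in> S \<and> t \<in> T}"
  by (rule cbilinear_closed_on_cspan[OF cbilinear_pure_tensor cvs.subspace_span _ assms])
    (auto intro: cvs.span_base)

lemma clinear_eq_on_pure:
  assumes "clinear f" "clinear g" "\<And>a b. f (a \<boxtimes> b) = g (a \<boxtimes> b)"
  shows "f x = g x"
  by (induction x rule: tensor_induct) (simp_all add: assms clinearD)

definition tensor_map :: "('a::complex_module \<Rightarrow> 'c::complex_module) \<Rightarrow>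
    ('b::complex_module \<Rightarrow> 'd::complex_module) \<Rightarrow> ('a, 'b) tensor \<Rightarrow> ('c, 'd) tensor"
  where "tensor_map f g = tensor_lift (\<lambda>a b. f a \<boxtimes> g b)"

lemma
  assumes f: "clinear f" and g: "clinear g"
  shows clinear_tensor_map: "clinear (tensor_map f g)"
    and tensor_map_pure: "tensor_map f g (a \<boxtimes> b) = f a \<boxtimes> g b"
proof -
  have "cbilinear (\<lambda>a b. f a \<boxtimes> g b)"
    by (rule cbilinearI) (simp_all add: clinearD[OF f] clinearD[OF g] pure_simps)
  then show "clinear (tensor_map f g)" "tensor_map f g (a \<boxtimes> b) = f a \<boxtimes> g b"
    by (simp_all add: tensor_map_def clinear_tensor_lift)
qed

text \<open>Both the plain and the braided product of a tensor product are of this form.\<close>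

lemma tensor_product_of_quadrilinear:
  fixes M :: "'a::complex_module \<Rightarrow> 'b::complex_module \<Rightarrow> 'c::complex_module \<Rightarrow>
    'd::complex_module \<Rightarrow> 'e::complex_module"
  assumes 1: "\<And>b c d. clinear (\<lambda>a. M a b c d)" and 2: "\<And>a c d. clinear (\<lambda>b. M a b c d)"
    and 3: "\<And>a b d. clinear (\<lambda>c. M a b c d)" and 4: "\<And>a b c. clinear (\<lambda>d. M a b c d)"
  defines "N \<equiv> \<lambda>x y. tensor_lift (\<lambda>a b. tensor_lift (M a b) y) x"
  shows "cbilinear N" and "N (a \<boxtimes> b) (c \<boxtimes> d) = M a b c d"
proof -
  note l = clinearD[OF 1] clinearD[OF 2] clinearD[OF 3] clinearD[OF 4]
  have inner: "cbilinear (M a b)" for a b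
    by (rule cbilinearI) (simp_all add: l)
  note li = clinearD[OF clinear_tensor_lift[OF inner]]
  have o1: "tensor_lift (M (a + a') b) y = tensor_lift (M a b) y + tensor_lift (M a' b) y" for a a' b y
  proof (induction y rule: tensor_induct)
    case (pure c d)
    show ?case unfolding tensor_lift_pure[OF inner] by (rule l)
  qed (simp only: li add_ac)
  have o2: "tensor_lift (M (k *\<^sub>C a) b) y = k *\<^sub>C tensor_lift (M a b) y" for k a b y
  proof (induction y rule: tensor_induct)
    case (pure c d)
    show ?case unfolding tensor_lift_pure[OF inner] by (rule l)
  qed (simp only: li cscale_add_right)
  have o3: "tensor_lift (M a (b + b')) y = tensor_lift (M a b) y + tensor_lift (M a b') y" for a b b' y
  proof (induction y rule: tensor_induct)
    case (pure c d)
    show ?case unfolding tensor_lift_pure[OF inner] by (rule l)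
  qed (simp only: li add_ac)
  have o4: "tensor_lift (M a (k *\<^sub>C b)) y = k *\<^sub>C tensor_lift (M a b) y" for a k b y
  proof (induction y rule: tensor_induct)
    case (pure c d)
    show ?case unfolding tensor_lift_pure[OF inner] by (rule l)
  qed (simp only: li cscale_add_right)
  have outer: "cbilinear (\<lambda>a b. tensor_lift (M a b) y)" for y
    by (intro cbilinearI o1 o2 o3 o4)
  note lo = clinearD[OF clinear_tensor_lift[OF outer]]
  show "cbilinear N"
  proof (rule cbilinearI)
    show "N x (u + v) = N x u + N x v" for x u v
      by (induction x rule: tensor_induct)
        (simp_all only: N_def tensor_lift_pure[OF outer] li lo add_ac)
    show "N x (k *\<^sub>C u) = k *\<^sub>C N x u" for x k u
      by (induction x rule: tensor_induct)
        (simp_all only: N_def tensor_lift_pure[OF outer] li lo cscale_add_right)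
  qed (simp_all add: N_def lo)
  show "N (a \<boxtimes> b) (c \<boxtimes> d) = M a b c d"
    by (simp add: N_def tensor_lift_pure[OF outer] tensor_lift_pure[OF inner])
qed

text \<open>With the plain product, matrices over a tensor product of algebras have a multiplicative
  determinant, which is what makes the comultiplication of \<open>SL\<^sub>4\<close> respect the relation
  \<open>det A = 1\<close>.\<close>

instantiation tensor :: (complex_algebra, complex_algebra) complex_algebra
begin

definition one_tensor :: "('a, 'b) tensor"
  where "one_tensor = 1 \<boxtimes> 1"

definition times_tensor :: "('a, 'b) tensor \<Rightarrow> ('a, 'b) tensor \<Rightarrow> ('a, 'b) tensor"
  where "times_tensor x y =
    tensor_lift (\<lambda>a b. tensor_lift (\<lambda>c d. (a * c) \<boxtimes> (b * d)) y) x"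

instance
proof
  have q: "clinear (\<lambda>a. (a * c) \<boxtimes> (b * d))" "clinear (\<lambda>b. (a * c) \<boxtimes> (b * d))"
    "clinear (\<lambda>c. (a * c) \<boxtimes> (b * d))" "clinear (\<lambda>d. (a * c) \<boxtimes> (b * d))"
    for a c :: 'a and b d :: 'b
    by (rule clinearI; simp add: pure_simps distrib_left distrib_right cscale_mult_left
        cscale_mult_right)+
  note T = tensor_product_of_quadrilinear[where M = "\<lambda>a b c d. (a * c) \<boxtimes> (b * d)", OF q,
      folded times_tensor_def]
  note bi = cbilinearD[OF T(1)]
  fix x y z :: "('a, 'b) tensor" and c :: complex
  show "x * y = y * x"
  proof (induction x rule: tensor_induct)
    case (pure a b)
    show ?case
    proof (induction y rule: tensor_induct)
      case (pure c d)
      show ?case by (simp only: T(2) mult.commute[of a] mult.commute[of b])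
    qed (simp only: bi)
  qed (simp only: bi)
  show "x * y * z = x * (y * z)"
  proof (induction x rule: tensor_induct)
    case (pure a b)
    show ?case
    proof (induction y rule: tensor_induct)
      case (pure c d)
      show ?case
      proof (induction z rule: tensor_induct)
        case (pure e f)
        show ?case by (simp only: T(2) mult.assoc)
      qed (simp only: bi)
    qed (simp only: bi)
  qed (simp only: bi)
  show "1 * x = x"
    unfolding one_tensor_def by (induction x rule: tensor_induct) (simp_all add: bi T(2))
  show "(x + y) * z = x * z + y * z" "(c *\<^sub>C x) * y = c *\<^sub>C (x * y)" by (rule bi)+
  show "(0 :: ('a, 'b) tensor) \<noteq> 1"
  proof
    obtain f :: "'a \<Rightarrow> complex" where f: "clinear f" "f 1 = 1"
      by (rule separating_functional[OF cvs.subspace_single_0, of "1::'a"]) auto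
    obtain g :: "'b \<Rightarrow> complex" where g: "clinear g" "g 1 = 1"
      by (rule separating_functional[OF cvs.subspace_single_0, of "1::'b"]) auto
    have fg: "cbilinear (\<lambda>a b. f a * g b)"
      by (rule cbilinearI)
        (simp_all only: clinearD[OF f(1)] clinearD[OF g(1)] distrib_left distrib_right
          cscale_mult_left cscale_mult_right)
    assume "(0 :: ('a, 'b) tensor) = 1"
    then have "tensor_lift (\<lambda>a b. f a * g b) 0 = tensor_lift (\<lambda>a b. f a * g b) (1 \<boxtimes> 1)"
      by (simp add: one_tensor_def)
    then show False
      by (simp add: tensor_lift_pure[OF fg] clinearD[OF clinear_tensor_lift[OF fg]] f g)
  qed
qed

end

lemma pure_tensor_mult: "(a \<boxtimes> b) * (c \<boxtimes> d) = (a * c) \<boxtimes> (b * d)"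
  for a c :: "'a::complex_algebra" and b d :: "'b::complex_algebra"
  unfolding times_tensor_def
  by (rule tensor_product_of_quadrilinear(2); rule clinearI;
      simp add: pure_simps distrib_left distrib_right cscale_mult_left cscale_mult_right)

lemma crmap_tensor_left: "crmap (\<lambda>a::'a::complex_algebra. a \<boxtimes> (1::'b::complex_algebra))"
  and crmap_tensor_right: "crmap (\<lambda>b::'b. (1::'a) \<boxtimes> b)"
  by (simp_all add: crmap_def pure_tensor_mult pure_simps one_tensor_def)

lemma crmap_tensor_map:
  fixes f :: "'a::complex_algebra \<Rightarrow> 'c::complex_algebra"
    and g :: "'b::complex_algebra \<Rightarrow> 'd::complex_algebra"
  assumes f: "crmap f" "clinear f" and g: "crmap g" "clinear g"
  shows "crmap (tensor_map f g)"
proof -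
  note pure = tensor_map_pure[OF f(2) g(2)]
  note lin = clinearD[OF clinear_tensor_map[OF f(2) g(2)]]
  have "tensor_map f g (x * y) = tensor_map f g x * tensor_map f g y" for x y
  proof (induction x rule: tensor_induct)
    case (pure a b)
    then show ?case
      by (induction y rule: tensor_induct)
        (simp_all add: pure_tensor_mult crmapD[OF f(1)] crmapD[OF g(1)]
          tensor_map_pure[OF f(2) g(2)] lin distrib_left)
  qed (simp add: distrib_right lin)
  then show ?thesis
    by (simp add: crmap_def one_tensor_def pure crmapD[OF f(1)] crmapD[OF g(1)] lin)
qed

section \<open>Products of matrix entries and evaluation of matrices\<close>

definition entry_prod :: "'a::comm_ring_1^'m^'n \<Rightarrow> 'n list \<Rightarrow> 'm list \<Rightarrow> 'a"
  where "entry_prod X I J = prod_list (map2 (\<lambda>i j. X $ i $ j) I J)"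

lemma entry_prod_Nil [simp]: "entry_prod X [] [] = 1"
  and entry_prod_Cons [simp]: "entry_prod X (i # I) (j # J) = X $ i $ j * entry_prod X I J"
  by (simp_all add: entry_prod_def)

lemma entry_prod_append:
  "length I = length J \<Longrightarrow> entry_prod X (I @ I') (J @ J') = entry_prod X I J * entry_prod X I' J'"
  by (simp add: entry_prod_def)

lemma crmap_entry_prod:
  assumes "crmap f" "length I = length J" "\<And>i j. f (X $ i $ j) = Y $ i $ j"
  shows "f (entry_prod X I J) = entry_prod Y I J"
  using assms(2) by (induction I J rule: list_induct2) (simp_all add: crmapD[OF assms(1)] assms(3))

lemma finite_lists_of_length [simp]: "finite {K::'a::finite list. length K = n}"
  using finite_lists_length_eq[of "UNIV::'a set" n] by simp

lemma sum_lists_Suc: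
  fixes f :: "'i::finite list \<Rightarrow> 'a::comm_monoid_add"
  shows "(\<Sum>K | length K = Suc n. f K) = (\<Sum>k\<in>UNIV. \<Sum>K | length K = n. f (k # K))"
proof -
  have "{K. length K = Suc n} = (\<lambda>(k, K). k # K) ` (UNIV \<times> {K::'i list. length K = n})"
    by (auto simp: length_Suc_conv image_iff)
  moreover have "inj_on (\<lambda>(k, K). k # K) (UNIV \<times> {K::'i list. length K = n})"
    by (auto simp: inj_on_def)
  ultimately show ?thesis
    by (simp add: sum.reindex sum.cartesian_product case_prod_unfold)
qed

lemma sum_lists_append:
  fixes f :: "'i::finite list \<Rightarrow> 'a::comm_monoid_add"
  shows "(\<Sum>L | length L = m + n. f L) = (\<Sum>K | length K = m. \<Sum>K' | length K' = n. f (K @ K'))"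
proof (induction m arbitrary: f)
  case 0
  have "{K::'i list. length K = 0} = {[]}" by auto
  then show ?case by simp
next
  case (Suc m)
  then show ?case by (simp add: sum_lists_Suc)
qed

text \<open>Expanding a product of sums introduces one list of middle indices. The same expansion computes
  the comultiplication and the translation of a function by a matrix.\<close>

lemma entry_prod_matrix_mult:
  fixes X :: "'a::comm_ring_1^'l^'n" and Y :: "'a^'m^'l"
  assumes "length I = length J"
  shows "entry_prod (X ** Y) I J =
    (\<Sum>K | length K = length I. entry_prod X I K * entry_prod Y K J)"
  using assms
proof (induction I J rule: list_induct2)
  case Nil
  have "{K::'l list. length K = length []} = {[]}" by auto
  then show ?case by simp
next
  case (Cons i I j J)
  have "(X ** Y) $ i $ j = (\<Sum>k\<in>UNIV. X $ i $ k * Y $ k $ j)"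
    by (simp add: matrix_matrix_mult_def)
  with Cons have "entry_prod (X ** Y) (i # I) (j # J) =
      (\<Sum>k\<in>UNIV. \<Sum>K | length K = length I. (X $ i $ k * Y $ k $ j) * (entry_prod X I K * entry_prod Y K J))"
    by (simp only: entry_prod_Cons sum_product)
  also have "\<dots> = (\<Sum>k\<in>UNIV. \<Sum>K | length K = length I.
      entry_prod X (i # I) (k # K) * entry_prod Y (k # K) (j # J))"
    by (intro sum.cong refl) (simp only: entry_prod_Cons mult_ac)
  finally show ?case by (simp only: sum_lists_Suc length_Cons)
qed

lemma single_sum: "Poly_Mapping.single k (sum f S) = (\<Sum>i\<in>S. Poly_Mapping.single k (f i))"
  by (induction S rule: infinite_finite_induct) (simp_all add: single_add)

text \<open>Conjugation of quaternions exchanges the indices within the pairs \<open>(1, 2)\<close> and \<open>(3, 4)\<close>: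
  the adjoint of the entry at \<open>(i, j)\<close> is, up to the sign \<open>eps i * eps j\<close>, the entry at
  \<open>(flip i, flip j)\<close>.\<close>

definition flip :: "4 \<Rightarrow> 4"
  where "flip i = (vector [2, 1, 4, 3] :: 4^4) $ i"

definition eps :: "4 \<Rightarrow> 'a::comm_ring_1"
  where "eps i = (vector [1, - 1, 1, - 1] :: 'a^4) $ i"

lemma flip_simps [simp]: "flip 1 = 2" "flip 2 = 1" "flip 3 = 4" "flip 4 = 3"
  and eps_simps [simp]: "eps 1 = 1" "eps 2 = - 1" "eps 3 = 1" "eps 4 = - 1"
  by (simp_all add: flip_def eps_def)

lemma flip_flip [simp]: "flip (flip i) = i"
proof -
  have "\<forall>i. flip (flip i) = i" unfolding forall_4 by simp
  then show ?thesis by blast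
qed

lemma tau_flip: "tau (flip i) = - tau i"
proof -
  have "\<forall>i. tau (flip i) = - tau i" unfolding forall_4 by simp
  then show ?thesis by blast
qed

lemma eps_flip: "eps (flip i) = - eps i" and eps_eps: "eps i * eps i = 1"
proof -
  have "\<forall>i. eps (flip i) = - eps i \<and> eps i * eps i = 1" unfolding forall_4 by simp
  then show "eps (flip i) = - eps i" "eps i * eps i = 1" by blast+
qed

lemma star_m_A: "star_m (A_m $ i $ j) = eps i * eps j * A_m $ flip i $ flip j"
proof -
  have "\<forall>i j. star_m (A_m $ i $ j) = eps i * eps j * A_m $ flip i $ flip j"
    unfolding forall_4 by (simp add: A_m_def Let_def crmapD[OF crmap_star_m])
  then show ?thesis by blast
qed

text \<open>The eight generators and their adjoints are, up to sign, the sixteen entries of \<open>A_m\<close>,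
  each occurring once. Forgetting the star, the algebra is thus the polynomial algebra in the entries
  of a \<open>4 \<times> 4\<close> matrix, and a matrix can be substituted for \<open>A_m\<close>.\<close>

definition eval_matrix :: "'a::complex_algebra^4^4 \<Rightarrow> m2h \<Rightarrow> 'a"
  where "eval_matrix X = poly_eval (\<lambda>(x, s). let (i, j) = place x in
    if s then eps i * eps j * X $ flip i $ flip j else X $ i $ j)"

lemma crmap_eval_matrix: "crmap (eval_matrix X)"
  by (simp add: eval_matrix_def crmap_poly_eval)

lemma clinear_eval_matrix: "clinear (eval_matrix X)"
  by (rule clinearI) (simp_all add: crmapD[OF crmap_eval_matrix], simp add: eval_matrix_def poly_eval_cscale)

lemma eval_matrix_A: "eval_matrix X (A_m $ i $ j) = X $ i $ j"
proof -
  have "\<forall>i j. eval_matrix X (A_m $ i $ j) = X $ i $ j"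
    unfolding forall_4
    by (simp add: A_m_def Let_def crmapD[OF crmap_eval_matrix]) (simp add: eval_matrix_def)
  then show ?thesis by blast
qed

lemma eval_matrix_det: "eval_matrix X (det A_m) = det X"
  by (simp add: crmap_det[OF crmap_eval_matrix] eval_matrix_A)

definition A_mat :: "sl2h^4^4"
  where "A_mat = (\<chi> i j. A_sl i j)"

lemma A_mat_nth: "A_mat $ i $ j = A_sl i j"
  by (simp add: A_mat_def)

lemma det_A_mat: "det A_mat = 1"
proof -
  have "abs_sl2h (det A_m) = abs_sl2h 1"
    unfolding abs_sl2h_eq_iff sl_ideal_def by (simp add: rmod.span_base)
  then show ?thesis
    by (simp add: crmap_det[OF crmap_abs_sl2h] A_mat_def A_sl_def crmapD[OF crmap_abs_sl2h])
qed

text \<open>The universal property of \<open>SL\<^sub>4\<close>: a matrix of determinant 1 over a commutative algebra is a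
  point with values in that algebra. For other matrices the value depends on the representative.\<close>

definition eval_sl :: "'a::complex_algebra^4^4 \<Rightarrow> sl2h \<Rightarrow> 'a"
  where "eval_sl X x = eval_matrix X (rep_sl2h x)"

lemma eval_sl_abs:
  assumes "det X = 1"
  shows "eval_sl X (abs_sl2h p) = eval_matrix X p"
proof -
  have "rep_sl2h (abs_sl2h p) - p \<in> sl_ideal"
    using Quotient3_abs_rep[OF Quotient3_sl2h, of "abs_sl2h p"] by (simp add: abs_sl2h_eq_iff)
  then have "eval_matrix X (rep_sl2h (abs_sl2h p) - p) = 0"
    unfolding sl_ideal_def
    by (rule crmap_ideal_zero[OF crmap_eval_matrix, rotated])
      (auto simp: crmapD[OF crmap_eval_matrix] eval_matrix_det assms)
  then show ?thesis by (simp add: eval_sl_def crmapD[OF crmap_eval_matrix])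
qed

lemma
  assumes "det X = 1"
  shows crmap_eval_sl: "crmap (eval_sl X)" and clinear_eval_sl: "clinear (eval_sl X)"
    and eval_sl_A: "eval_sl X (A_sl i j) = X $ i $ j"
proof -
  note abs = eval_sl_abs[OF assms]
  have surj: "\<exists>p. x = abs_sl2h p" for x
    using Quotient3_abs_rep[OF Quotient3_sl2h, of x] by metis
  show "crmap (eval_sl X)"
    unfolding crmap_def
  proof (intro conjI allI)
    fix x y
    obtain p q where "x = abs_sl2h p" "y = abs_sl2h q" using surj by metis
    then show "eval_sl X (x + y) = eval_sl X x + eval_sl X y"
      "eval_sl X (x * y) = eval_sl X x * eval_sl X y"
      by (simp_all add: abs crmapD[OF crmap_eval_matrix]
          flip: crmapD(2,3)[OF crmap_abs_sl2h])
    show "eval_sl X 1 = 1"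
      using abs[of 1] by (simp add: crmapD[OF crmap_abs_sl2h] crmapD[OF crmap_eval_matrix])
  qed
  then show "clinear (eval_sl X)"
  proof (intro clinearI)
    fix c x
    obtain p where "x = abs_sl2h p" using surj by metis
    then show "eval_sl X (c *\<^sub>C x) = c *\<^sub>C eval_sl X x"
      by (simp add: abs clinearD[OF clinear_eval_matrix] flip: abs_sl2h_cscale)
  qed (simp add: crmapD)
  show "eval_sl X (A_sl i j) = X $ i $ j"
    by (simp add: A_sl_def abs eval_matrix_A)
qed

lemma m2h_induct [case_names one add scale var]:
  assumes one: "P 1" and add: "\<And>p q. P p \<Longrightarrow> P q \<Longrightarrow> P (p + q)"
    and scale: "\<And>c p. P p \<Longrightarrow> P (c *\<^sub>C p)" and var: "\<And>v p. P p \<Longrightarrow> P (var v * p)"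
  shows "P (p :: m2h)"
proof (induction p rule: poly_mapping_single_induct)
  case zero
  show ?case using scale[OF one, of 0] by simp
next
  case (single_plus m c p)
  have "P (Poly_Mapping.single m 1)"
  proof (induction m rule: poly_mapping_single_induct)
    case zero
    then show ?case using one by simp
  next
    case (single_plus v k m)
    show ?case
    proof (induction k)
      case 0
      then show ?case using single_plus by simp
    next
      case (Suc k)
      have "Poly_Mapping.single v (Suc k) + m
          = Poly_Mapping.single v 1 + (Poly_Mapping.single v k + m)"
        by (simp flip: single_add add.assoc)
      then have "Poly_Mapping.single (Poly_Mapping.single v (Suc k) + m) 1
          = var v * Poly_Mapping.single (Poly_Mapping.single v k + m) 1"
        by (simp add: var_def mult_single)
      then show ?case using var[OF Suc] by simp
    qed
  qed
  from scale[OF this, of c] have "P (Poly_Mapping.single m c)"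
    by (simp add: cscale_single cscale_complex_def)
  then show ?case using single_plus by (rule add)
qed

lemma var_is_entry: "\<exists>i j. \<exists>c. var v = c *\<^sub>C A_m $ i $ j"
proof -
  have m: "- x = (- 1) *\<^sub>C x" for x :: m2h
    by (metis cscale_one cvs.scale_minus_left)
  obtain x s where v: "v = (x, s)" by force
  show ?thesis
  proof (cases s)
    case False
    then have "var v = 1 *\<^sub>C A_m $ fst (place x) $ snd (place x)"
      by (cases x) (simp_all add: v A_m_def Let_def cscale_one)
    then show ?thesis by blast
  next
    case True
    then have "var v = eps (fst (place x)) *\<^sub>C A_m $ flip (fst (place x)) $ flip (snd (place x))"
      by (cases x) (simp_all add: v A_m_def Let_def cscale_one flip: m)
    then show ?thesis by blast
  qed
qed

lemma m2h_cspan: "(p::m2h) \<in> cspan {entry_prod A_m I J | I J. length I = length J}"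
proof (induction p rule: m2h_induct)
  case one
  have "entry_prod A_m [] [] \<in> {entry_prod A_m I J | I J. length I = length J}" by blast
  then show ?case by (simp add: cvs.span_base)
next
  case (var v p)
  obtain i j c where v: "var v = c *\<^sub>C A_m $ i $ j" using var_is_entry by blast
  from var show ?case
  proof (induction rule: cspan_induct)
    case (base s)
    then obtain I J where s: "s = entry_prod A_m I J" "length I = length J" by blast
    then have "entry_prod A_m (i # I) (j # J) \<in> cspan {entry_prod A_m I J | I J. length I = length J}"
      by (intro cvs.span_base CollectI, intro exI[of _ "i # I"] exI[of _ "j # J"]) simp
    from cvs.span_scale[OF this, of c] show ?case by (simp add: v s cscale_mult_left)
  qed (simp_all add: cvs.span_zero cvs.span_add cvs.span_scale distrib_left cscale_mult_right)
qed (simp_all add: cvs.span_add cvs.span_scale)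

lemma clinear_abs_sl2h: "clinear abs_sl2h"
  by (rule clinearI) (simp_all add: abs_sl2h_cscale crmapD[OF crmap_abs_sl2h])

lemma abs_entry_prod:
  "length I = length J \<Longrightarrow> abs_sl2h (entry_prod A_m I J) = entry_prod A_mat I J"
  by (rule crmap_entry_prod[OF crmap_abs_sl2h]) (simp_all add: A_mat_def A_sl_def)

lemma sl2h_cspan: "(x::sl2h) \<in> cspan {entry_prod A_mat I J | I J. length I = length J}"
proof -
  obtain p where p: "x = abs_sl2h p"
    using Quotient3_abs_rep[OF Quotient3_sl2h, of x] by metis
  show ?thesis
    unfolding p using m2h_cspan[of p]
  proof (induction rule: cspan_induct)
    case (base s)
    then obtain I J where "s = entry_prod A_m I J" "length I = length J" by blast
    then show ?case by (intro cvs.span_base CollectI exI[of _ I] exI[of _ J]) (simp add: abs_entry_prod)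
  qed (simp_all add: clinearD[OF clinear_abs_sl2h] cvs.span_zero cvs.span_add cvs.span_scale)
qed

lemma clinear_eq_on_entry_prods:
  assumes "clinear f" "clinear g"
    and "\<And>I J. length I = length J \<Longrightarrow> f (entry_prod A_mat I J) = g (entry_prod A_mat I J)"
  shows "f x = g x"
  by (rule clinear_eq_on_cspan[OF assms(1,2) _ sl2h_cspan]) (use assms(3) in auto)

section \<open>Weights, the bigrading and the comultiplication\<close>

definition weight :: "4 list \<Rightarrow> torus"
  where "weight I = (\<Sum>i\<leftarrow>I. tau i)"

lemma weight_simps [simp]: "weight [] = 0" "weight (i # I) = tau i + weight I"
  "weight (I @ J) = weight I + weight J"
  by (simp_all add: weight_def)

lemma coact_entry_prod:
  assumes "length I = length J"
  shows "coact_sl (entry_prod A_mat I J) =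
    Poly_Mapping.single (weight I - weight J) (entry_prod A_mat I J)"
  using assms
proof (induction I J rule: list_induct2)
  case Nil
  show ?case by (simp add: crmapD[OF crmap_coact_sl] zero_prod_def[symmetric])
next
  case (Cons i I j J)
  then show ?case
    by (simp only: entry_prod_Cons crmapD[OF crmap_coact_sl] A_mat_nth coact_sl_A mult_single
        weight_simps add_diff_add)
qed

text \<open>The torus acts on \<open>SL\<^sub>4\<close> by left and by right multiplication, and the entry at \<open>(i, j)\<close>
  has weight \<open>tau i\<close> for the one and \<open>tau j\<close> for the other. The coaction of H only records the
  difference of the two weights; the twist of the coproduct depends on both.\<close>

definition bigrading_matrix :: "(torus \<times> torus \<Rightarrow>\<^sub>0 sl2h)^4^4"
  where "bigrading_matrix = (\<chi> i j. Poly_Mapping.single (tau i, tau j) (A_sl i j))"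

lemma prod_4: "prod f (UNIV :: 4 set) = f 1 * (f 2 * (f 3 * f 4))"
  unfolding UNIV_4 by simp

text \<open>The matrix is A with rows and columns multiplied by monomials. The four weights add up to zero,
  so these factors contribute nothing to the determinant.\<close>

lemma det_bigrading_matrix: "det bigrading_matrix = 1"
proof -
  define P Q :: "(torus \<times> torus \<Rightarrow>\<^sub>0 sl2h)^4^4"
    where "P = (\<chi> i j. if i = j then Poly_Mapping.single (tau i, 0) 1 else 0)"
      and "Q = (\<chi> i j. if i = j then Poly_Mapping.single (0, tau i) 1 else 0)"
  define B :: "(torus \<times> torus \<Rightarrow>\<^sub>0 sl2h)^4^4"
    where "B = (\<chi> i j. Poly_Mapping.single 0 (A_mat $ i $ j))"
  have diag: "det P = (\<Prod>i\<in>UNIV. P $ i $ i)" "det Q = (\<Prod>i\<in>UNIV. Q $ i $ i)"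
    by (rule det_diagonal, simp add: P_def Q_def)+
  have prod: "(\<Prod>i\<in>UNIV. P $ i $ i) = 1" "(\<Prod>i\<in>UNIV. Q $ i $ i) = 1"
  proof -
    have t: "tau 1 + (tau 2 + (tau 3 + tau 4)) = 0"
      by (simp add: zero_prod_def)
    have s: "Poly_Mapping.single (0::torus, 0::torus) (1::sl2h) = 1"
      using single_one[where 'a = "torus \<times> torus" and 'b = sl2h] by (simp only: zero_prod_def)
    show "(\<Prod>i\<in>UNIV. P $ i $ i) = 1" "(\<Prod>i\<in>UNIV. Q $ i $ i) = 1"
      by (simp_all only: prod_4 P_def Q_def vec_lambda_beta if_True refl mult_single add_Pair add_0 mult_1 t s)
  qed
  have eq: "bigrading_matrix = P ** B ** Q"
    by (simp add: P_def Q_def B_def matrix_matrix_mult_def vec_eq_iff bigrading_matrix_def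
        A_mat_def if_distrib[of "\<lambda>x. x * _"] if_distrib[of "\<lambda>x. _ * x"] mult_single
        del: tau_simps cong: if_cong)
  have B: "det B = 1"
    using crmap_det[OF crmap_single_zero, of A_mat] by (simp add: B_def det_A_mat)
  show ?thesis
    unfolding eq det_mul diag prod B by (simp only: mult_1)
qed

definition bigrading :: "sl2h \<Rightarrow> torus \<times> torus \<Rightarrow>\<^sub>0 sl2h"
  where "bigrading = eval_sl bigrading_matrix"

lemma bigrading_entry_prod:
  assumes "length I = length J"
  shows "bigrading (entry_prod A_mat I J) =
    Poly_Mapping.single (weight I, weight J) (entry_prod A_mat I J)"
proof -
  note r = crmapD[OF crmap_eval_sl[OF det_bigrading_matrix], folded bigrading_def]
  have A: "bigrading (A_sl i j) = Poly_Mapping.single (tau i, tau j) (A_sl i j)" for i j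
    by (simp only: bigrading_def eval_sl_A[OF det_bigrading_matrix])
      (simp add: bigrading_matrix_def)
  show ?thesis
    using assms
  proof (induction I J rule: list_induct2)
    case (Cons i I j J)
    then show ?case
      by (simp add: r A A_mat_nth mult_single)
  qed (simp add: r flip: zero_prod_def)
qed

text \<open>The product of the two generic points of \<open>SL\<^sub>4\<close> in the two tensor factors.\<close>

definition comult_matrix :: "(sl2h, sl2h) tensor^4^4"
  where "comult_matrix = (\<chi> i j. A_sl i j \<boxtimes> 1) ** (\<chi> i j. 1 \<boxtimes> A_sl i j)"

lemma det_comult_matrix: "det comult_matrix = 1"
proof -
  have "det (\<chi> i j. A_mat $ i $ j \<boxtimes> (1::sl2h)) = 1" "det (\<chi> i j. (1::sl2h) \<boxtimes> A_mat $ i $ j) = 1"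
    by (simp_all add: det_A_mat one_tensor_def flip: crmap_det[OF crmap_tensor_left] crmap_det[OF crmap_tensor_right])
  then show ?thesis by (simp add: comult_matrix_def det_mul A_mat_nth)
qed

definition comult :: "sl2h \<Rightarrow> (sl2h, sl2h) tensor"
  where "comult = eval_sl comult_matrix"

lemma crmap_comult: "crmap comult" and clinear_comult: "clinear comult"
  by (simp_all add: comult_def crmap_eval_sl clinear_eval_sl det_comult_matrix)

lemma comult_A: "comult (A_sl i j) = (\<Sum>\<alpha>\<in>UNIV. A_sl i \<alpha> \<boxtimes> A_sl \<alpha> j)"
  by (simp add: comult_def eval_sl_A det_comult_matrix)
    (simp add: comult_matrix_def matrix_matrix_mult_def pure_tensor_mult)

lemma comult_entry_prod:
  assumes "length I = length J"
  shows "comult (entry_prod A_mat I J) =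
    (\<Sum>K | length K = length I. entry_prod A_mat I K \<boxtimes> entry_prod A_mat K J)"
proof -
  have "comult (entry_prod A_mat I J) = entry_prod comult_matrix I J"
    by (rule crmap_entry_prod[OF crmap_comult assms])
      (simp add: A_mat_nth comult_def eval_sl_A det_comult_matrix)
  also have "\<dots> = (\<Sum>K | length K = length I.
      (entry_prod A_mat I K \<boxtimes> 1) * (1 \<boxtimes> entry_prod A_mat K J))"
    unfolding comult_matrix_def entry_prod_matrix_mult[OF assms]
    by (intro sum.cong refl arg_cong2[of _ _ _ _ "(*)"] sym[OF crmap_entry_prod]
        crmap_tensor_left crmap_tensor_right)
      (use assms in \<open>auto simp: A_mat_nth\<close>)
  finally show ?thesis by (simp add: pure_tensor_mult)
qed

section \<open>The braided coproduct as a twist of the comultiplication\<close>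

text \<open>In this form an identity between products of twists is a linear identity between exponents.\<close>

lemma twist_eq_cis:
  "twist \<theta> a b = cis (pi * \<theta> / 2 * (of_int (fst a) * of_int (snd b) - of_int (snd a) * of_int (fst b)))"
proof -
  define n where "n = fst a * snd b - snd a * fst b"
  have "\<i> * of_real pi * of_real \<theta> / 2 * of_int n = \<i> * complex_of_real (pi * \<theta> / 2 * of_int n)"
    by simp
  moreover have "real_of_int n = of_int (fst a) * of_int (snd b) - of_int (snd a) * of_int (fst b)"
    by (simp add: n_def)
  ultimately show ?thesis
    unfolding twist_def cis_conv_exp n_def[symmetric] by (simp only:)
qed

lemma twist_nonzero [simp]: "twist \<theta> a b \<noteq> 0"
  by (simp add: twist_def)

lemma twist_uminus: "twist \<theta> (- a) b = inverse (twist \<theta> a b)"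
  "twist \<theta> a (- b) = inverse (twist \<theta> a b)" "twist (- \<theta>) a b = inverse (twist \<theta> a b)"
  unfolding twist_eq_cis cis_inverse by (rule arg_cong[of _ _ cis], simp add: algebra_simps)+

lemma twist_zero [simp]: "twist \<theta> 0 a = 1" "twist \<theta> a 0 = 1"
  by (simp_all add: twist_eq_cis)

lemma cnj_twist: "cnj (twist \<theta> a b) = inverse (twist \<theta> a b)"
  unfolding twist_eq_cis cis_inverse cis_cnj ..

definition bihomogeneous :: "torus \<times> torus \<Rightarrow> sl2h \<Rightarrow> bool"
  where "bihomogeneous k x \<longleftrightarrow> bigrading x = Poly_Mapping.single k x"

lemma crmap_bigrading: "crmap bigrading" and clinear_bigrading: "clinear bigrading"
  by (simp_all add: bigrading_def crmap_eval_sl clinear_eval_sl det_bigrading_matrix)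

lemma bihomogeneous_entry_prod:
  "length I = length J \<Longrightarrow> bihomogeneous (weight I, weight J) (entry_prod A_mat I J)"
  by (simp add: bihomogeneous_def bigrading_entry_prod)

lemma bihomogeneous_A: "bihomogeneous (tau i, tau j) (A_sl i j)"
  using bihomogeneous_entry_prod[of "[i]" "[j]"] by (simp add: A_mat_nth)

lemma bihomogeneous_zero: "bihomogeneous k 0"
  and bihomogeneous_one: "bihomogeneous (0, 0) 1"
  and bihomogeneous_scale: "bihomogeneous k x \<Longrightarrow> bihomogeneous k (c *\<^sub>C x)"
  and bihomogeneous_add: "bihomogeneous k x \<Longrightarrow> bihomogeneous k y \<Longrightarrow> bihomogeneous k (x + y)"
  and bihomogeneous_diff: "bihomogeneous k x \<Longrightarrow> bihomogeneous k y \<Longrightarrow> bihomogeneous k (x - y)"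
  and bihomogeneous_mult: "bihomogeneous k x \<Longrightarrow> bihomogeneous l y \<Longrightarrow> bihomogeneous (k + l) (x * y)"
  using bihomogeneous_entry_prod[of "[]" "[]"]
  by (simp_all add: bihomogeneous_def crmapD[OF crmap_bigrading] clinearD(2)[OF clinear_bigrading]
      cscale_single single_add single_diff mult_single)

lemma B_SL_simps [simp]:
  "carrier (B_SL \<theta>) = UNIV" "\<one>\<^bsub>B_SL \<theta>\<^esub> = 1" "zero (B_SL \<theta>) = 0" "add (B_SL \<theta>) = (+)"
  "smult (B_SL \<theta>) = cscale" "coaction (B_SL \<theta>) = coact_sl"
  by (simp_all add: B_SL_def cotwist_def comm_alg_def)

text \<open>The coaction of H is conjugation by the torus, of which the bigrading separates the two
  sides.\<close>

lemma homogeneous_of_bihomogeneous: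
  assumes "bihomogeneous (l, r) x"
  shows "homogeneous (B_SL \<theta>) (l - r) x"
proof -
  define c where "c = (\<lambda>x. \<Sum>k\<in>Poly_Mapping.keys (bigrading x).
    Poly_Mapping.single (fst k - snd k) (Poly_Mapping.lookup (bigrading x) k))"
  have "clinear (\<lambda>x::sl2h. Poly_Mapping.single (fst k - snd k) x)" for k :: "torus \<times> torus"
    by (rule clinearI) (simp_all add: single_add cscale_single)
  from clinear_comp[OF clinear_bigrading clinear_sum_keys, OF this]
  have lin: "clinear c" by (simp add: c_def)
  have c: "c y = Poly_Mapping.single (fst k - snd k) y" if "bihomogeneous k y" for k y
    using that sum_keys_single[of "\<lambda>k. Poly_Mapping.single (fst k - snd k)" k y]
    by (simp add: c_def bihomogeneous_def)
  have "coact_sl x = c x"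
    by (rule clinear_eq_on_entry_prods[OF clinear_coact_sl lin])
      (simp add: coact_entry_prod c[OF bihomogeneous_entry_prod])
  then show ?thesis by (simp add: homogeneous_def c[OF assms])
qed

lemma B_SL_mult_bihomogeneous:
  assumes "bihomogeneous (l, r) x" "bihomogeneous (l', r') y"
  shows "x \<otimes>\<^bsub>B_SL \<theta>\<^esub> y = twist \<theta> (l - r) (l' - r') *\<^sub>C (x * y)"
  by (intro B_SL_mult homogeneous_of_bihomogeneous assms)

text \<open>On bihomogeneous elements this is the rescaling that produces \<open>A_hat\<close> from A. It is not
  multiplicative, but it is linear and invertible, and conjugating the ordinary comultiplication with it
  gives the braided one.\<close>

definition hat :: "real \<Rightarrow> sl2h \<Rightarrow> sl2h"
  where "hat \<theta> x = (\<Sum>k\<in>Poly_Mapping.keys (bigrading x).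
    inverse (twist \<theta> (fst k) (snd k)) *\<^sub>C Poly_Mapping.lookup (bigrading x) k)"

lemma clinear_hat: "clinear (hat \<theta>)"
proof -
  have "clinear (\<lambda>x::sl2h. inverse (twist \<theta> (fst k) (snd k)) *\<^sub>C x)" for k
    by (rule clinearI) (simp_all add: cscale_add_right cscale_cscale mult.commute)
  from clinear_comp[OF clinear_bigrading clinear_sum_keys, OF this]
  show ?thesis by (simp add: hat_def[abs_def])
qed

lemma hat_bihomogeneous:
  assumes "bihomogeneous (l, r) x"
  shows "hat \<theta> x = inverse (twist \<theta> l r) *\<^sub>C x"
  using assms sum_keys_single[of "\<lambda>k x. inverse (twist \<theta> (fst k) (snd k)) *\<^sub>C x" "(l, r)" x]
  by (simp add: hat_def bihomogeneous_def)

lemmas hat_entry_prod = hat_bihomogeneous[OF bihomogeneous_entry_prod]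

lemma A_hat_eq_hat: "A_hat \<theta> i j = hat \<theta> (A_sl i j)"
  by (simp add: A_hat_def hat_bihomogeneous[OF bihomogeneous_A])

lemma hat_hat_uminus: "hat (- \<theta>) (hat \<theta> x) = x"
  by (rule clinear_eq_on_entry_prods[OF clinear_comp[OF clinear_hat clinear_hat]])
    (simp_all add: clinearI hat_entry_prod clinearD[OF clinear_hat] cscale_cscale twist_uminus cscale_one)

lemma braided_tensor_simps [simp]:
  "carrier (braided_tensor \<theta> B C) = UNIV" "\<one>\<^bsub>braided_tensor \<theta> B C\<^esub> = \<one>\<^bsub>B\<^esub> \<boxtimes> \<one>\<^bsub>C\<^esub>"
  "zero (braided_tensor \<theta> B C) = 0" "add (braided_tensor \<theta> B C) = (+)"
  "smult (braided_tensor \<theta> B C) = cscale"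
  by (simp_all add: braided_tensor_def)

lemma cbilinear_mult_braided_tensor:
  fixes B :: "'a::complex_module comodule_algebra" and C :: "'b::complex_module comodule_algebra"
  assumes B: "clinear (coaction B)" "cbilinear (mult B)"
    and C: "clinear (coaction C)" "cbilinear (mult C)"
  shows "cbilinear (mult (braided_tensor \<theta> B C))"
proof -
  define M :: "'a \<Rightarrow> 'b \<Rightarrow> 'a \<Rightarrow> 'b \<Rightarrow> ('a, 'b) tensor"
    where "M a b c d = (\<Sum>g\<in>degrees B c. \<Sum>h\<in>degrees C b. twist_inv2 \<theta> g h *\<^sub>C
        ((a \<otimes>\<^bsub>B\<^esub> component B c g) \<boxtimes> (component C b h \<otimes>\<^bsub>C\<^esub> d)))" for a b c d
  note t = pure_simps cbilinearD[OF B(2)] cbilinearD[OF C(2)]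
  have bi: "cbilinear (\<lambda>x y. twist_inv2 \<theta> g h *\<^sub>C ((a \<otimes>\<^bsub>B\<^esub> x) \<boxtimes> (y \<otimes>\<^bsub>C\<^esub> d)))" for a d g h
    by (rule cbilinear_scale, rule cbilinearI) (simp_all add: t)
  have cb: "cbilinear (\<lambda>c b. M a b c d)" for a d
    unfolding M_def by (rule cbilinear_sum_keys2[OF bi B(1) C(1)])
  have a: "clinear (\<lambda>a. M a b c d)" for b c d
    by (rule clinearI)
      (simp_all add: M_def t cscale_add_right cscale_cscale sum.distrib cvs.scale_sum_right mult.commute)
  have d: "clinear (\<lambda>d. M a b c d)" for a b c
    by (rule clinearI)
      (simp_all add: M_def t cscale_add_right cscale_cscale sum.distrib cvs.scale_sum_right mult.commute)
  have "cbilinear (\<lambda>x y. tensor_lift (\<lambda>a b. tensor_lift (M a b) y) x)"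
    by (rule tensor_product_of_quadrilinear(1)[of M, OF a clinear_right[OF cb] clinear_left[OF cb] d])
  then show ?thesis by (simp add: braided_tensor_def M_def[abs_def])
qed

abbreviation B_SL2 :: "real \<Rightarrow> (sl2h, sl2h) tensor comodule_algebra"
  where "B_SL2 \<theta> \<equiv> braided_tensor \<theta> (B_SL \<theta>) (B_SL \<theta>)"

lemma algebra_hom_B_SL2:
  "f \<in> algebra_hom (B_SL \<theta>) (B_SL2 \<theta>) \<longleftrightarrow>
    clinear f \<and> f 1 = 1 \<boxtimes> 1 \<and> (\<forall>x y. f (x \<otimes>\<^bsub>B_SL \<theta>\<^esub> y) = f x \<otimes>\<^bsub>B_SL2 \<theta>\<^esub> f y)"
  by (auto simp: algebra_hom_def ring_hom_def clinearD intro: clinearI)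

definition twisted_comult :: "real \<Rightarrow> sl2h \<Rightarrow> (sl2h, sl2h) tensor"
  where "twisted_comult \<theta> x = tensor_map (hat \<theta>) (hat \<theta>) (comult (hat (- \<theta>) x))"

lemma clinear_twisted_comult: "clinear (twisted_comult \<theta>)"
  unfolding twisted_comult_def[abs_def]
  by (intro clinear_comp[OF clinear_comp[OF clinear_hat clinear_comult]] clinear_tensor_map clinear_hat)

lemma twisted_comult_entry_prod:
  assumes "length I = length J"
  shows "twisted_comult \<theta> (entry_prod A_mat I J) = (\<Sum>K | length K = length I.
    (twist \<theta> (weight I) (weight J) * inverse (twist \<theta> (weight I) (weight K)) *
      inverse (twist \<theta> (weight K) (weight J))) *\<^sub>C
    (entry_prod A_mat I K \<boxtimes> entry_prod A_mat K J))"
proof -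
  note h = clinearD[OF clinear_tensor_map[OF clinear_hat clinear_hat]]
    tensor_map_pure[OF clinear_hat clinear_hat]
  have "twisted_comult \<theta> (entry_prod A_mat I J) = twist \<theta> (weight I) (weight J) *\<^sub>C
    (\<Sum>K | length K = length I. hat \<theta> (entry_prod A_mat I K) \<boxtimes> hat \<theta> (entry_prod A_mat K J))"
    by (simp add: twisted_comult_def hat_entry_prod[OF assms] clinearD[OF clinear_comult] h
        comult_entry_prod[OF assms] twist_uminus)
  also have "\<dots> = twist \<theta> (weight I) (weight J) *\<^sub>C (\<Sum>K | length K = length I.
      (inverse (twist \<theta> (weight I) (weight K)) * inverse (twist \<theta> (weight K) (weight J))) *\<^sub>C
      (entry_prod A_mat I K \<boxtimes> entry_prod A_mat K J))"
    using assms
    by (intro arg_cong[of _ _ "\<lambda>x. _ *\<^sub>C x"] sum.cong refl)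
      (simp add: hat_entry_prod pure_simps cscale_cscale mult.commute)
  finally show ?thesis by (simp only: cvs.scale_sum_right cscale_cscale mult.assoc)
qed

text \<open>On products of matrix entries both sides are sums over the same lists of middle indices. The
  coefficients agree because F is an alternating bicharacter: the factor \<open>F\<^sup>-\<^sup>2\<close> that the braided
  product introduces when the inner factors are exchanged is exactly what the rescalings of the middle
  weights require.\<close>

lemma twisted_comult_mult:
  "twisted_comult \<theta> (x \<otimes>\<^bsub>B_SL \<theta>\<^esub> y) = twisted_comult \<theta> x \<otimes>\<^bsub>B_SL2 \<theta>\<^esub> twisted_comult \<theta> y"
proof (rule cbilinear_eq_on_cspan[OF _ _ _ sl2h_cspan sl2h_cspan,
      of "\<lambda>x y. twisted_comult \<theta> (x \<otimes>\<^bsub>B_SL \<theta>\<^esub> y)"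
        "\<lambda>x y. twisted_comult \<theta> x \<otimes>\<^bsub>B_SL2 \<theta>\<^esub> twisted_comult \<theta> y"])
  have b: "cbilinear (mult (B_SL2 \<theta>))"
    by (intro cbilinear_mult_braided_tensor clinear_coaction cbilinear_mult_B)
  note l = clinearD[OF clinear_twisted_comult] cbilinearD[OF b] cbilinearD[OF cbilinear_mult_B(1)]
  show "cbilinear (\<lambda>x y. twisted_comult \<theta> (x \<otimes>\<^bsub>B_SL \<theta>\<^esub> y))"
    "cbilinear (\<lambda>x y. twisted_comult \<theta> x \<otimes>\<^bsub>B_SL2 \<theta>\<^esub> twisted_comult \<theta> y)"
    by (rule cbilinearI; simp only: l)+
  fix s t
  assume "s \<in> {entry_prod A_mat I J | I J. length I = length J}"
    "t \<in> {entry_prod A_mat I J | I J. length I = length J}"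
  then obtain I J I' J' where s: "s = entry_prod A_mat I J" "length I = length J"
    and t: "t = entry_prod A_mat I' J'" "length I' = length J'" by blast
  define c where "c = (\<lambda>I J K. twist \<theta> (weight I) (weight J) * inverse (twist \<theta> (weight I) (weight K)) *
      inverse (twist \<theta> (weight K) (weight J)))"
  define E where "E = (\<lambda>I J. entry_prod A_mat I J)"
  have prod: "(E I K \<boxtimes> E K J) \<otimes>\<^bsub>B_SL2 \<theta>\<^esub> (E I' K' \<boxtimes> E K' J') =
      (twist_inv2 \<theta> (weight I' - weight K') (weight K - weight J) *
        (twist \<theta> (weight K - weight J) (weight K' - weight J') *
          twist \<theta> (weight I - weight K) (weight I' - weight K'))) *\<^sub>C
      (E (I @ I') (K @ K') \<boxtimes> E (K @ K') (J @ J'))"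
    if K: "length K = length I" "length K' = length I'" for K K'
  proof -
    have len: "length I = length K" "length K = length J" "length I' = length K'" "length K' = length J'"
      using K s(2) t(2) by simp_all
    note bi = len[THEN bihomogeneous_entry_prod, folded E_def]
    have p: "E I K * E I' K' = E (I @ I') (K @ K')" "E K J * E K' J' = E (K @ K') (J @ J')"
      using len by (simp_all add: E_def entry_prod_append)
    show ?thesis
      by (simp only: braided_tensor_mult[OF clinear_coaction(1) cbilinear_mult_B(1)
          clinear_coaction(1) cbilinear_mult_B(1) homogeneous_of_bihomogeneous[OF bi(3)]
          homogeneous_of_bihomogeneous[OF bi(2)]]
          B_SL_mult_bihomogeneous[OF bi(1) bi(3)] B_SL_mult_bihomogeneous[OF bi(2) bi(4)]
          p pure_simps cscale_cscale)
  qed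
  have coeff: "c I J K * c I' J' K' *
      (twist_inv2 \<theta> (weight I' - weight K') (weight K - weight J) *
        (twist \<theta> (weight K - weight J) (weight K' - weight J') *
          twist \<theta> (weight I - weight K) (weight I' - weight K')))
    = twist \<theta> (weight I - weight J) (weight I' - weight J') * c (I @ I') (J @ J') (K @ K')" for K K'
    unfolding c_def twist_inv2_def power2_eq_square twist_eq_cis cis_mult cis_inverse
    by (rule arg_cong[of _ _ cis]) (simp add: algebra_simps)
  have "twisted_comult \<theta> s \<otimes>\<^bsub>B_SL2 \<theta>\<^esub> twisted_comult \<theta> t =
    (\<Sum>K | length K = length I. \<Sum>K' | length K' = length I'.
      (c I J K * c I' J' K') *\<^sub>C ((E I K \<boxtimes> E K J) \<otimes>\<^bsub>B_SL2 \<theta>\<^esub> (E I' K' \<boxtimes> E K' J')))"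
    unfolding s(1) t(1) twisted_comult_entry_prod[OF s(2)] twisted_comult_entry_prod[OF t(2)]
      c_def E_def by (rule cbilinear_lincomb[OF b])
  also have "\<dots> = (\<Sum>K | length K = length I. \<Sum>K' | length K' = length I'.
      (twist \<theta> (weight I - weight J) (weight I' - weight J') * c (I @ I') (J @ J') (K @ K')) *\<^sub>C
      (E (I @ I') (K @ K') \<boxtimes> E (K @ K') (J @ J')))"
    by (intro sum.cong refl) (simp only: mem_Collect_eq prod cscale_cscale coeff)
  also have "\<dots> = (\<Sum>L | length L = length I + length I'.
      (twist \<theta> (weight I - weight J) (weight I' - weight J') * c (I @ I') (J @ J') L) *\<^sub>C
      (E (I @ I') L \<boxtimes> E L (J @ J')))"
    by (rule sum_lists_append[symmetric])
  also have "\<dots> = twist \<theta> (weight I - weight J) (weight I' - weight J') *\<^sub>C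
      twisted_comult \<theta> (E (I @ I') (J @ J'))"
    using s(2) t(2) by (simp add: E_def c_def twisted_comult_entry_prod cvs.scale_sum_right cscale_cscale)
  also have "\<dots> = twisted_comult \<theta> (s \<otimes>\<^bsub>B_SL \<theta>\<^esub> t)"
    by (simp add: s t B_SL_mult_bihomogeneous[OF bihomogeneous_entry_prod[OF s(2)] bihomogeneous_entry_prod[OF t(2)]]
        clinearD[OF clinear_twisted_comult] E_def entry_prod_append[OF s(2)])
  finally show "twisted_comult \<theta> (s \<otimes>\<^bsub>B_SL \<theta>\<^esub> t) =
    twisted_comult \<theta> s \<otimes>\<^bsub>B_SL2 \<theta>\<^esub> twisted_comult \<theta> t" ..
qed

lemma twisted_comult_A_hat:
  "twisted_comult \<theta> (A_hat \<theta> i j) = (\<Sum>\<alpha>\<in>UNIV. A_hat \<theta> i \<alpha> \<boxtimes> A_hat \<theta> \<alpha> j)"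
  using clinear_tensor_map[OF clinear_hat clinear_hat]
  by (simp add: twisted_comult_def A_hat_eq_hat hat_hat_uminus comult_A clinearD
      tensor_map_pure[OF clinear_hat clinear_hat])

text \<open>The elements \<open>A_hat\<close> generate the twisted algebra, since the twisted product of bihomogeneous
  elements is a nonzero multiple of their ordinary product.\<close>

lemma braided_coproduct_unique:
  assumes "\<And>\<Delta>. \<Delta> \<in> {f, g} \<Longrightarrow> \<Delta> \<in> algebra_hom (B_SL \<theta>) (B_SL2 \<theta>)"
    and "\<And>i j. f (A_hat \<theta> i j) = g (A_hat \<theta> i j)"
  shows "f = g"
proof
  fix x
  have f: "clinear f" "f 1 = 1 \<boxtimes> 1" "\<And>x y. f (x \<otimes>\<^bsub>B_SL \<theta>\<^esub> y) = f x \<otimes>\<^bsub>B_SL2 \<theta>\<^esub> f y"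
    and g: "clinear g" "g 1 = 1 \<boxtimes> 1" "\<And>x y. g (x \<otimes>\<^bsub>B_SL \<theta>\<^esub> y) = g x \<otimes>\<^bsub>B_SL2 \<theta>\<^esub> g y"
    using assms(1) by (auto simp: algebra_hom_B_SL2)
  have "f (entry_prod A_mat I J) = g (entry_prod A_mat I J)" if "length I = length J" for I J
    using that
  proof (induction I J rule: list_induct2)
    case (Cons i I j J)
    have bi: "bihomogeneous (tau i, tau j) (A_hat \<theta> i j)"
      unfolding A_hat_def by (rule bihomogeneous_scale[OF bihomogeneous_A])
    define c where "c = twist \<theta> (tau i - tau j) (weight I - weight J) * inverse (twist \<theta> (tau i) (tau j))"
    have "c \<noteq> 0" by (simp add: c_def)
    have c: "A_hat \<theta> i j \<otimes>\<^bsub>B_SL \<theta>\<^esub> entry_prod A_mat I J = c *\<^sub>C entry_prod A_mat (i # I) (j # J)"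
      unfolding B_SL_mult_bihomogeneous[OF bi bihomogeneous_entry_prod[OF Cons(1)]]
      by (simp add: c_def A_hat_def A_mat_nth cscale_mult_left cscale_cscale)
    have "c *\<^sub>C f (entry_prod A_mat (i # I) (j # J)) = c *\<^sub>C g (entry_prod A_mat (i # I) (j # J))"
      using f(3)[of "A_hat \<theta> i j" "entry_prod A_mat I J"] g(3)[of "A_hat \<theta> i j" "entry_prod A_mat I J"]
      by (simp add: c clinearD[OF f(1)] clinearD[OF g(1)] Cons assms(2) del: entry_prod_Cons)
    with \<open>c \<noteq> 0\<close> show ?case by (metis cvs.scale_left_imp_eq)
  qed (simp add: f g)
  then show "f x = g x" by (rule clinear_eq_on_entry_prods[OF f(1) g(1)])
qed

lemma braided_coproduct_eq: "braided_coproduct \<theta> = twisted_comult \<theta>"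
  unfolding braided_coproduct_def
proof (rule the_equality)
  have "twisted_comult \<theta> 1 = 1 \<boxtimes> 1"
  proof -
    have "{K::4 list. length K = 0} = {[]}" by auto
    with twisted_comult_entry_prod[of "[]" "[]" \<theta>] show ?thesis by (simp add: cscale_one)
  qed
  then have hom: "twisted_comult \<theta> \<in> algebra_hom (B_SL \<theta>) (B_SL2 \<theta>)"
    by (simp add: algebra_hom_B_SL2 clinear_twisted_comult twisted_comult_mult)
  then show "twisted_comult \<theta> \<in> algebra_hom (B_SL \<theta>) (B_SL2 \<theta>) \<and>
    (\<forall>i j. twisted_comult \<theta> (A_hat \<theta> i j) = (\<Sum>\<alpha>\<in>UNIV. A_hat \<theta> i \<alpha> \<boxtimes> A_hat \<theta> \<alpha> j))"
    by (simp add: twisted_comult_A_hat)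
  fix \<Delta>
  assume "\<Delta> \<in> algebra_hom (B_SL \<theta>) (B_SL2 \<theta>) \<and>
    (\<forall>i j. \<Delta> (A_hat \<theta> i j) = (\<Sum>\<alpha>\<in>UNIV. A_hat \<theta> i \<alpha> \<boxtimes> A_hat \<theta> \<alpha> j))"
  with hom show "\<Delta> = twisted_comult \<theta>"
    by (intro braided_coproduct_unique[of _ _ \<theta>]) (auto simp: twisted_comult_A_hat)
qed

section \<open>The algebra generated by the Gram matrix\<close>

definition symplectic :: "'a::comm_ring_1^4^4"
  where "symplectic = (\<chi> i j. if j = flip i then eps i else 0)"

text \<open>The Gram matrix of the columns of X for the symplectic form.\<close>

definition gram :: "'a::comm_ring_1^4^4 \<Rightarrow> 'a^4^4"
  where "gram X = transpose X ** symplectic ** X"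

lemma gram_nth:
  "gram X $ i $ j = X $ 1 $ i * X $ 2 $ j - X $ 2 $ i * X $ 1 $ j + X $ 3 $ i * X $ 4 $ j - X $ 4 $ i * X $ 3 $ j"
  by (simp add: gram_def symplectic_def transpose_def matrix_matrix_mult_def sum_4)

lemma gram_mult: "gram (X ** Y) = transpose Y ** gram X ** Y"
  by (simp add: gram_def matrix_transpose_mul matrix_mul_assoc)

lemma crmap_gram: "crmap f \<Longrightarrow> f (gram X $ i $ j) = gram (\<chi> i j. f (X $ i $ j)) $ i $ j"
  by (simp add: gram_nth crmapD)

definition gram_A :: "sl2h^4^4"
  where "gram_A = gram A_mat"

lemma star_sl_A: "star_sl (A_sl i j) = eps i * eps j * A_sl (flip i) (flip j)"
proof -
  have "abs_sl2h (eps k) = eps k" for k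
    using exhaust_4[of k] by (auto simp: crmapD[OF crmap_abs_sl2h])
  then show ?thesis
    by (simp add: A_sl_def star_sl.abs_eq star_m_A crmapD[OF crmap_abs_sl2h])
qed

text \<open>Taking the adjoints of the entries of A amounts to conjugating A by the matrix of the symplectic
  form, so Hermitian products of columns become symplectic ones.\<close>

lemma star_A_A_eq_gram_A: "(\<Sum>\<alpha>\<in>UNIV. star_sl (A_sl \<alpha> i) * A_sl \<alpha> j) = - eps i * gram_A $ flip i $ j"
  by (simp add: star_sl_A sum_4 gram_A_def gram_nth A_mat_nth algebra_simps)

lemma clinear_abs_sp2: "clinear abs_sp2"
  by (rule clinearI) (simp_all add: cscale_sp2.abs_eq crmapD[OF crmap_abs_sp2])

lemma abs_rep_sp2: "abs_sp2 (rep_sp2 z) = z"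
  using Quotient3_abs_rep[OF Quotient3_sp2] .

lemma abs_sp2_eq_iff: "abs_sp2 x = abs_sp2 y \<longleftrightarrow> x - y \<in> sp_ideal"
  by (rule sp2.abs_eq_iff)

text \<open>The relations defining \<open>Sp(2)\<close> say that the columns of A form a symplectic basis.\<close>

lemma abs_sp2_gram_A: "abs_sp2 (gram_A $ i $ j) = symplectic $ i $ j"
proof -
  have "abs_sp2 (sp_relation (flip i) j) = abs_sp2 0"
    unfolding abs_sp2_eq_iff sp_ideal_def by (auto intro!: rmod.span_base)
  then have "abs_sp2 (eps i * gram_A $ i $ j) = (if flip i = j then 1 else 0)"
    unfolding sp_relation_def star_A_A_eq_gram_A
    by (simp add: eps_flip crmapD[OF crmap_abs_sp2] split: if_splits)
  moreover have "abs_sp2 (eps i) = eps i"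
    using exhaust_4[of i] by (auto simp: crmapD[OF crmap_abs_sp2])
  ultimately have "eps i * abs_sp2 (gram_A $ i $ j) = (if flip i = j then 1 else 0)"
    by (simp add: crmapD[OF crmap_abs_sp2])
  then have "eps i * (eps i * abs_sp2 (gram_A $ i $ j)) = symplectic $ i $ j"
    by (auto simp: symplectic_def)
  then show ?thesis
    by (simp only: mult.assoc[symmetric] eps_eps mult_1)
qed

text \<open>The symplectic form only pairs indices of opposite weight, so the left weights cancel. This is
  why the rescaling \<open>hat\<close> will not affect the Gram matrix.\<close>

lemma bihomogeneous_gram_A: "bihomogeneous (0, tau i + tau j) (gram_A $ i $ j)"
proof -
  have "bihomogeneous (0, tau i + tau j) (A_sl k i * A_sl (flip k) j)" for k
    using bihomogeneous_mult[OF bihomogeneous_A bihomogeneous_A, of k i "flip k" j] by (simp add: tau_flip)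
  from this[of 1] this[of 2] this[of 3] this[of 4] show ?thesis
    by (simp add: gram_A_def gram_nth A_mat_nth bihomogeneous_add bihomogeneous_diff)
qed

lemma bihomogeneous_entry_prod_gram_A:
  assumes "length I = length J"
  shows "bihomogeneous (0, weight I + weight J) (entry_prod gram_A I J)"
  using assms
proof (induction I J rule: list_induct2)
  case (Cons i I j J)
  show ?case
    using bihomogeneous_mult[OF bihomogeneous_gram_A Cons.IH, of i j] by (simp add: add_ac)
qed (simp add: bihomogeneous_one)

text \<open>The span of the ordinary products is used, so that the definition does not mention
  \<open>\<theta>\<close>; by the lemma \<open>B_M_eq_gram_algebra\<close> below the twisted products span the same space.\<close>

definition gram_algebra :: "sl2h set"
  where "gram_algebra = cspan {entry_prod gram_A I J | I J. length I = length J}"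

lemma subspace_gram_algebra: "cvs.subspace gram_algebra"
  unfolding gram_algebra_def by (rule cvs.subspace_span)

lemma entry_prod_gram_A_in: "length I = length J \<Longrightarrow> entry_prod gram_A I J \<in> gram_algebra"
  unfolding gram_algebra_def by (rule cvs.span_base) blast

lemma one_in_gram_algebra: "1 \<in> gram_algebra" and gram_A_in_gram_algebra: "gram_A $ i $ j \<in> gram_algebra"
  using entry_prod_gram_A_in[of "[]" "[]"] entry_prod_gram_A_in[of "[i]" "[j]"] by simp_all

lemma gram_algebra_mult: "x \<in> gram_algebra \<Longrightarrow> y \<in> gram_algebra \<Longrightarrow> x * y \<in> gram_algebra"
proof -
  assume "x \<in> gram_algebra" "y \<in> gram_algebra"
  then show ?thesis
    using cbilinear_closed_on_cspan[OF cbilinear_mult subspace_gram_algebra, of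
        "{entry_prod gram_A I J | I J. length I = length J}" "{entry_prod gram_A I J | I J. length I = length J}" x y]
    by (force simp: gram_algebra_def[symmetric] entry_prod_append[symmetric] intro: entry_prod_gram_A_in)
qed

lemmas gram_algebra_closed = cvs.subspace_0[OF subspace_gram_algebra]
  cvs.subspace_add[OF subspace_gram_algebra] cvs.subspace_scale[OF subspace_gram_algebra]
  cvs.subspace_diff[OF subspace_gram_algebra] cvs.subspace_neg[OF subspace_gram_algebra]
  one_in_gram_algebra gram_A_in_gram_algebra gram_algebra_mult

lemma hat_gram_algebra: "x \<in> gram_algebra \<Longrightarrow> hat \<theta> x = x"
  unfolding gram_algebra_def
  by (erule clinear_eq_on_cspan[OF clinear_hat, rotated 2])
    (auto simp: hat_bihomogeneous[OF bihomogeneous_entry_prod_gram_A] cscale_one clinearI)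

text \<open>The twist factors of the summands all agree: the middle weight \<open>tau \<alpha>\<close> cancels between the
  two factors \<open>A_hat\<close> and their twisted product.\<close>

lemma m_gen_eq: "m_gen \<theta> i j = (- inverse (twist \<theta> (tau i) (tau j)) * eps i) *\<^sub>C gram_A $ flip i $ j"
proof -
  have "star_sl (A_hat \<theta> \<alpha> i) \<otimes>\<^bsub>B_SL \<theta>\<^esub> A_hat \<theta> \<alpha> j =
    inverse (twist \<theta> (tau i) (tau j)) *\<^sub>C (star_sl (A_sl \<alpha> i) * A_sl \<alpha> j)" for \<alpha>
  proof -
    have e: "eps \<alpha> * eps i * x = (eps \<alpha> * eps i) *\<^sub>C x" for x :: sl2h
      using exhaust_4[of \<alpha>] exhaust_4[of i] by (auto simp: cscale_one)
    have star: "star_sl (A_hat \<theta> \<alpha> i) = twist \<theta> (tau \<alpha>) (tau i) *\<^sub>C star_sl (A_sl \<alpha> i)"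
      by (simp add: A_hat_def star_sl_cscale cnj_twist)
    have bi: "bihomogeneous (- tau \<alpha>, - tau i) (star_sl (A_sl \<alpha> i))"
      unfolding star_sl_A e tau_flip[symmetric] by (intro bihomogeneous_scale bihomogeneous_A)
    have c: "inverse (twist \<theta> (tau \<alpha>) (tau j)) * (twist \<theta> (tau \<alpha>) (tau i) *
        twist \<theta> (- tau \<alpha> - - tau i) (tau \<alpha> - tau j)) = inverse (twist \<theta> (tau i) (tau j))"
      unfolding twist_eq_cis cis_mult cis_inverse by (rule arg_cong[of _ _ cis]) (simp add: algebra_simps)
    show ?thesis
      by (simp only: star A_hat_def[of \<theta> \<alpha> j] cbilinearD[OF cbilinear_mult_B(1)]
          B_SL_mult_bihomogeneous[OF bi bihomogeneous_A] cscale_cscale c)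
  qed
  then have "m_gen \<theta> i j = inverse (twist \<theta> (tau i) (tau j)) *\<^sub>C (- eps i * gram_A $ flip i $ j)"
    by (simp only: m_gen_def star_A_A_eq_gram_A[symmetric] cvs.scale_sum_right)
  moreover have "- eps i * x = (- eps i) *\<^sub>C x" for x :: sl2h
    using exhaust_4[of i] by (auto simp: cscale_one)
  ultimately show ?thesis by (simp add: cscale_cscale)
qed

lemma is_subalgebra_gram_algebra: "is_subalgebra gram_algebra (B_SL \<theta>)"
proof -
  have "x \<otimes>\<^bsub>B_SL \<theta>\<^esub> y \<in> gram_algebra" if "x \<in> gram_algebra" "y \<in> gram_algebra" for x y
  proof (rule cbilinear_closed_on_cspan[OF cbilinear_mult_B(1) subspace_gram_algebra _ that[unfolded gram_algebra_def]])
    fix s t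
    assume "s \<in> {entry_prod gram_A I J | I J. length I = length J}"
      "t \<in> {entry_prod gram_A I J | I J. length I = length J}"
    then obtain I J I' J' where s: "s = entry_prod gram_A I J" "length I = length J"
      and t: "t = entry_prod gram_A I' J'" "length I' = length J'" by blast
    show "s \<otimes>\<^bsub>B_SL \<theta>\<^esub> t \<in> gram_algebra"
      unfolding s(1) t(1) B_SL_mult_bihomogeneous[OF bihomogeneous_entry_prod_gram_A[OF s(2)] bihomogeneous_entry_prod_gram_A[OF t(2)]]
      by (intro gram_algebra_closed entry_prod_gram_A_in s t)
  qed
  then show ?thesis by (simp add: is_subalgebra_def gram_algebra_closed)
qed

text \<open>The entries of the Gram matrix are homogeneous, so each twisted product of them is a nonzero
  multiple of the ordinary one, and the two products generate the same subspace.\<close>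

lemma B_M_eq_gram_algebra: "B_M \<theta> = gram_algebra"
proof
  have "m_gen \<theta> i j \<in> gram_algebra" for i j
    by (simp only: m_gen_eq gram_algebra_closed)
  then show "B_M \<theta> \<subseteq> gram_algebra"
    unfolding B_M_def generated_subalgebra_def using is_subalgebra_gram_algebra[of \<theta>] by blast
next
  have "gram_algebra \<subseteq> V" if sub: "is_subalgebra V (B_SL \<theta>)" and gen: "{m_gen \<theta> i j | i j. True} \<subseteq> V" for V
  proof -
    have V: "1 \<in> V" "\<And>x y. x \<in> V \<Longrightarrow> y \<in> V \<Longrightarrow> x + y \<in> V" "\<And>c x. x \<in> V \<Longrightarrow> c *\<^sub>C x \<in> V"
      "\<And>x y. x \<in> V \<Longrightarrow> y \<in> V \<Longrightarrow> x \<otimes>\<^bsub>B_SL \<theta>\<^esub> y \<in> V"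
      using sub by (auto simp: is_subalgebra_def)
    have gram_A: "gram_A $ i $ j \<in> V" for i j
    proof -
      define c where "c = - inverse (twist \<theta> (tau (flip i)) (tau j)) * eps (flip i)"
      have "c \<noteq> 0" using exhaust_4[of i] by (auto simp: c_def)
      then have "gram_A $ i $ j = inverse c *\<^sub>C m_gen \<theta> (flip i) j"
        by (simp only: m_gen_eq flip_flip c_def[symmetric] cscale_cscale left_inverse cscale_one not_False_eq_True)
      moreover have "m_gen \<theta> (flip i) j \<in> V" using gen by blast
      ultimately show ?thesis using V(3) by metis
    qed
    have "entry_prod gram_A I J \<in> V" if "length I = length J" for I J
      using that
    proof (induction I J rule: list_induct2)
      case (Cons i I j J)
      have "gram_A $ i $ j \<otimes>\<^bsub>B_SL \<theta>\<^esub> entry_prod gram_A I J \<in> V" by (rule V(4)[OF gram_A Cons.IH])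
      then have "twist \<theta> (0 - (tau i + tau j)) (0 - (weight I + weight J)) *\<^sub>C
          entry_prod gram_A (i # I) (j # J) \<in> V"
        by (simp only: B_SL_mult_bihomogeneous[OF bihomogeneous_gram_A bihomogeneous_entry_prod_gram_A[OF Cons.hyps]]
            entry_prod_Cons)
      from V(3)[OF this, of "inverse (twist \<theta> (0 - (tau i + tau j)) (0 - (weight I + weight J)))"]
      show ?case by (simp only: cscale_cscale left_inverse[OF twist_nonzero] cscale_one)
    qed (simp add: V)
    moreover have "cvs.subspace V"
      using V(3)[OF V(1), of 0] by (auto intro!: cvs.subspaceI V)
    ultimately show ?thesis
      unfolding gram_algebra_def by (intro cvs.span_minimal) auto
  qed
  then show "gram_algebra \<subseteq> B_M \<theta>"
    unfolding B_M_def generated_subalgebra_def by (intro Inter_greatest) auto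
qed

section \<open>Untwisting the coinvariance condition\<close>

lemma sl2h_mult_cspan:
  assumes "cvs.subspace V" "\<And>I J. length I = length J \<Longrightarrow> entry_prod A_mat I J * x \<in> V"
  shows "y * x \<in> V"
  using sl2h_cspan[of y]
  by (induction rule: cspan_induct)
    (use assms(2) in \<open>auto simp: distrib_right cscale_mult_left cvs.subspace_0[OF assms(1)]
      cvs.subspace_add[OF assms(1)] cvs.subspace_scale[OF assms(1)]\<close>)

lemma sp_ideal_cscale: "x \<in> sp_ideal \<Longrightarrow> c *\<^sub>C x \<in> sp_ideal"
  using rmod.span_scale[of x "{sp_relation i j | i j. True}" "c *\<^sub>C 1"]
  by (simp add: sp_ideal_def cscale_mult_left)

lemma bihomogeneous_sp_relation: "bihomogeneous (0, tau j - tau i) (sp_relation i j)"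
proof -
  have e: "- eps i * x = (- eps i) *\<^sub>C x" for x :: sl2h
    using exhaust_4[of i] by (auto simp: cscale_one)
  have "bihomogeneous (0, tau j - tau i) (- eps i * gram_A $ flip i $ j)"
    unfolding e using bihomogeneous_scale[OF bihomogeneous_gram_A[of "flip i" j]]
    by (simp only: tau_flip uminus_add_conv_diff)
  moreover have "bihomogeneous (0, tau j - tau i) (if i = j then 1 else 0)"
    using bihomogeneous_one bihomogeneous_zero by (auto simp: zero_prod_def)
  ultimately show ?thesis
    unfolding sp_relation_def star_A_A_eq_gram_A by (rule bihomogeneous_diff)
qed

text \<open>The relations of \<open>Sp(2)\<close> are bihomogeneous, and the ideal is spanned by their multiples with
  bihomogeneous elements.\<close>

lemma hat_sp_ideal:
  assumes "x \<in> sp_ideal"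
  shows "hat \<theta> x \<in> sp_ideal"
  using assms unfolding sp_ideal_def
proof (induction rule: rmod.span_induct_alt)
  case base
  show ?case by (simp add: clinearD[OF clinear_hat] rmod.span_zero)
next
  case (step c x y)
  then obtain i j where x: "x = sp_relation i j" by blast
  have "c * x \<in> {z. hat \<theta> z \<in> sp_ideal}"
  proof (rule sl2h_mult_cspan)
    show "cvs.subspace {z. hat \<theta> z \<in> sp_ideal}"
      by (rule cvs.subspaceI)
        (auto simp: clinearD[OF clinear_hat] sp_ideal_cscale, auto simp: sp_ideal_def rmod.span_zero rmod.span_add)
    fix I J :: "4 list"
    assume "length I = length J"
    note bi = bihomogeneous_mult[OF bihomogeneous_entry_prod[OF this] bihomogeneous_sp_relation[of j i]]
    have "entry_prod A_mat I J * x \<in> sp_ideal"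
      unfolding x sp_ideal_def by (intro rmod.span_scale rmod.span_base) blast
    then show "entry_prod A_mat I J * x \<in> {z. hat \<theta> z \<in> sp_ideal}"
      by (simp only: mem_Collect_eq x hat_bihomogeneous[OF bi[unfolded add_Pair]] sp_ideal_cscale)
  qed
  with step show ?case
    by (simp add: clinearD[OF clinear_hat] sp_ideal_def rmod.span_add)
qed

text \<open>The map induced by \<open>hat\<close> on the quotient.\<close>

definition hat_sp :: "real \<Rightarrow> sp2 \<Rightarrow> sp2"
  where "hat_sp \<theta> z = abs_sp2 (hat \<theta> (rep_sp2 z))"

lemma hat_sp_abs: "hat_sp \<theta> (abs_sp2 x) = abs_sp2 (hat \<theta> x)"
proof -
  have "rep_sp2 (abs_sp2 x) - x \<in> sp_ideal"
    by (simp add: abs_rep_sp2 flip: abs_sp2_eq_iff)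
  from hat_sp_ideal[OF this] show ?thesis
    by (simp add: hat_sp_def abs_sp2_eq_iff clinearD[OF clinear_hat])
qed

lemma clinear_hat_sp: "clinear (hat_sp \<theta>)"
proof (rule clinearI)
  show "hat_sp \<theta> (x + y) = hat_sp \<theta> x + hat_sp \<theta> y" for x y
    using hat_sp_abs[of \<theta> "rep_sp2 x + rep_sp2 y"]
    by (simp add: clinearD[OF clinear_abs_sp2] clinearD[OF clinear_hat] abs_rep_sp2 hat_sp_def)
  show "hat_sp \<theta> (c *\<^sub>C x) = c *\<^sub>C hat_sp \<theta> x" for c x
    using hat_sp_abs[of \<theta> "c *\<^sub>C rep_sp2 x"]
    by (simp add: clinearD[OF clinear_abs_sp2] clinearD[OF clinear_hat] abs_rep_sp2 hat_sp_def)
qed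

lemma hat_sp_one: "hat_sp \<theta> 1 = 1"
  using hat_sp_abs[of \<theta> 1] by (simp add: hat_gram_algebra one_in_gram_algebra crmapD[OF crmap_abs_sp2])

text \<open>The coaction dual to the left translation of \<open>SL\<^sub>4\<close> by its subgroup \<open>Sp\<^sub>4\<close>.\<close>

definition left_coact :: "sl2h \<Rightarrow> (sp2, sl2h) tensor"
  where "left_coact x = tensor_map abs_sp2 (\<lambda>x. x) (comult x)"

lemma crmap_left_coact: "crmap left_coact"
  unfolding left_coact_def[abs_def]
  by (rule crmap_comp[OF crmap_tensor_map[OF crmap_abs_sp2 clinear_abs_sp2 crmap_id clinear_id] crmap_comult])

lemma clinear_left_coact: "clinear left_coact"
  unfolding left_coact_def[abs_def]
  by (rule clinear_comp[OF clinear_comult clinear_tensor_map[OF clinear_abs_sp2 clinear_id]])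

text \<open>In matrix form the coaction is \<open>A \<mapsto> X ** A\<close> with X the generic point of \<open>Sp\<^sub>4\<close>, and
  \<open>gram (X ** A)\<close> only depends on \<open>gram X\<close>, which is the standard symplectic matrix.\<close>

lemma left_coact_gram_A: "left_coact (gram_A $ i $ j) = 1 \<boxtimes> gram_A $ i $ j"
proof -
  define X :: "(sp2, sl2h) tensor^4^4" where "X = (\<chi> i j. abs_sp2 (A_mat $ i $ j) \<boxtimes> 1)"
  define Y :: "(sp2, sl2h) tensor^4^4" where "Y = (\<chi> i j. 1 \<boxtimes> A_mat $ i $ j)"
  note t = clinearD[OF clinear_tensor_map[OF clinear_abs_sp2 clinear_id]]
    tensor_map_pure[OF clinear_abs_sp2 clinear_id]
  have "(\<chi> i j. left_coact (A_mat $ i $ j)) = X ** Y"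
    by (simp add: vec_eq_iff left_coact_def A_mat_nth comult_A t X_def Y_def
        matrix_matrix_mult_def pure_tensor_mult)
  then have "left_coact (gram_A $ i $ j) = (transpose Y ** gram X ** Y) $ i $ j"
    by (simp add: gram_A_def crmap_gram[OF crmap_left_coact] gram_mult)
  moreover have "gram X $ i $ j = symplectic $ i $ j" for i j
  proof -
    have c: "crmap (\<lambda>x. abs_sp2 x \<boxtimes> (1::sl2h))"
      by (rule crmap_comp[OF crmap_tensor_left crmap_abs_sp2])
    have "gram X $ i $ j = symplectic $ i $ j \<boxtimes> 1"
      using crmap_gram[OF c, of A_mat i j] by (simp add: X_def abs_sp2_gram_A flip: gram_A_def)
    also have "\<dots> = symplectic $ i $ j"
      using exhaust_4[of i] by (auto simp: symplectic_def crmapD[OF crmap_tensor_left])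
    finally show ?thesis .
  qed
  then have "gram X = symplectic" by (simp add: vec_eq_iff)
  moreover have "gram Y $ i $ j = 1 \<boxtimes> gram_A $ i $ j"
    by (simp add: Y_def gram_A_def crmap_gram[OF crmap_tensor_right])
  ultimately show ?thesis by (simp add: gram_def)
qed

lemma left_coact_gram_algebra:
  assumes "x \<in> gram_algebra"
  shows "left_coact x = 1 \<boxtimes> x"
  using assms unfolding gram_algebra_def
proof (rule clinear_eq_on_cspan[OF clinear_left_coact clinear_right[OF cbilinear_pure_tensor], rotated])
  fix s
  assume "s \<in> {entry_prod gram_A I J | I J. length I = length J}"
  then obtain I J where s: "s = entry_prod gram_A I J" "length I = length J" by blast
  have "left_coact (entry_prod gram_A I J) = entry_prod (\<chi> i j. 1 \<boxtimes> gram_A $ i $ j) I J"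
    by (rule crmap_entry_prod[OF crmap_left_coact s(2)]) (simp add: left_coact_gram_A)
  also have "\<dots> = 1 \<boxtimes> entry_prod gram_A I J"
    by (rule crmap_entry_prod[OF crmap_tensor_right s(2), symmetric]) simp
  finally show "left_coact s = 1 \<boxtimes> s" by (simp add: s)
qed

text \<open>The projection to \<open>Sp(2)\<close> intertwines \<open>hat\<close> with \<open>hat_sp\<close>. The braided coaction is
  therefore the ordinary one conjugated by invertible rescalings, all of which fix 1.\<close>

lemma braided_coinvariant_iff:
  "tensor_map abs_sp2 (\<lambda>x. x) (twisted_comult \<theta> x) = 1 \<boxtimes> x \<longleftrightarrow>
    left_coact (hat (- \<theta>) x) = 1 \<boxtimes> hat (- \<theta>) x" (is "?twisted \<longleftrightarrow> ?plain")
proof -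
  let ?H = "\<lambda>\<theta>. tensor_map (hat_sp \<theta>) (hat \<theta>)"
  note id = clinear_tensor_map[OF clinear_abs_sp2 clinear_id]
  note hh = clinear_tensor_map[OF clinear_hat clinear_hat]
  note H = clinear_tensor_map[OF clinear_hat_sp clinear_hat]
  note pure = tensor_map_pure[OF clinear_abs_sp2 clinear_id] tensor_map_pure[OF clinear_hat clinear_hat]
    tensor_map_pure[OF clinear_hat_sp clinear_hat]
  have "tensor_map abs_sp2 (\<lambda>x. x) (tensor_map (hat \<theta>) (hat \<theta>) y) = ?H \<theta> (tensor_map abs_sp2 (\<lambda>x. x) y)" for y
    by (rule clinear_eq_on_pure[OF clinear_comp[OF hh id] clinear_comp[OF id H]])
      (simp add: pure hat_sp_abs)
  then have eq: "tensor_map abs_sp2 (\<lambda>x. x) (twisted_comult \<theta> x) = ?H \<theta> (left_coact (hat (- \<theta>) x))"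
    by (simp add: twisted_comult_def left_coact_def)
  have inv_sp: "hat_sp (- \<theta>) (hat_sp \<theta> z) = z" for \<theta> z
    using hat_sp_abs[of "- \<theta>" "hat \<theta> (rep_sp2 z)"]
    by (simp add: hat_sp_def[of \<theta>] hat_hat_uminus abs_rep_sp2)
  have inv: "?H (- \<theta>) (?H \<theta> z) = z" for z
    by (rule clinear_eq_on_pure[OF clinear_comp[OF H H] clinear_id])
      (simp add: pure hat_hat_uminus inv_sp)
  show ?thesis
  proof
    assume ?twisted
    then have "?H (- \<theta>) (?H \<theta> (left_coact (hat (- \<theta>) x))) = ?H (- \<theta>) (1 \<boxtimes> x)"
      by (simp add: eq)
    then show ?plain by (simp add: inv pure hat_sp_one)
  next
    assume ?plain
    then show ?twisted
      using hat_hat_uminus[of "- \<theta>" x] by (simp add: eq pure hat_sp_one)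
  qed
qed

section \<open>Pfaffians and local sections\<close>

lemma det_4:
  "det (A::'a::comm_ring_1^4^4) =
    A$1$1*A$2$2*A$3$3*A$4$4 +
    A$1$1*A$2$3*A$3$4*A$4$2 +
    A$1$1*A$2$4*A$3$2*A$4$3 +
    A$1$2*A$2$1*A$3$4*A$4$3 +
    A$1$2*A$2$3*A$3$1*A$4$4 +
    A$1$2*A$2$4*A$3$3*A$4$1 +
    A$1$3*A$2$1*A$3$2*A$4$4 +
    A$1$3*A$2$2*A$3$4*A$4$1 +
    A$1$3*A$2$4*A$3$1*A$4$2 +
    A$1$4*A$2$1*A$3$3*A$4$2 +
    A$1$4*A$2$2*A$3$1*A$4$3 +
    A$1$4*A$2$3*A$3$2*A$4$1 -
    A$1$1*A$2$2*A$3$4*A$4$3 -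
    A$1$1*A$2$3*A$3$2*A$4$4 -
    A$1$1*A$2$4*A$3$3*A$4$2 -
    A$1$2*A$2$1*A$3$3*A$4$4 -
    A$1$2*A$2$3*A$3$4*A$4$1 -
    A$1$2*A$2$4*A$3$1*A$4$3 -
    A$1$3*A$2$1*A$3$4*A$4$2 -
    A$1$3*A$2$2*A$3$1*A$4$4 -
    A$1$3*A$2$4*A$3$2*A$4$1 -
    A$1$4*A$2$1*A$3$2*A$4$3 -
    A$1$4*A$2$2*A$3$3*A$4$1 -
    A$1$4*A$2$3*A$3$1*A$4$2"
proof -
  have f1: "finite {2::4, 3, 4}" "1 \<notin> {2::4, 3, 4}"
    and f2: "finite {3::4, 4}" "2 \<notin> {3::4, 4}"
    and f3: "finite {4::4}" "3 \<notin> {4::4}"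
    by auto
  show ?thesis
    unfolding det_def UNIV_4
    unfolding sum_over_permutations_insert[OF f1]
    unfolding sum_over_permutations_insert[OF f2]
    unfolding sum_over_permutations_insert[OF f3]
    unfolding permutes_sing
    by (simp add: sign_swap_id permutation_swap_id permutation_compose sign_compose sign_id swap_id_eq)
qed

definition pfaffian :: "'a::comm_ring_1^4^4 \<Rightarrow> 'a"
  where "pfaffian X = X $ 1 $ 2 * X $ 3 $ 4 - X $ 1 $ 3 * X $ 2 $ 4 + X $ 1 $ 4 * X $ 2 $ 3"

lemma pfaffian_gram: "pfaffian (gram X) = det X"
  unfolding det_4 pfaffian_def gram_nth by (simp add: algebra_simps)

text \<open>The analogue of the adjugate for an alternating matrix: its product with X is the Pfaffian
  times the identity.\<close>

definition pfaffian_adjoint :: "'a::comm_ring_1^4^4 \<Rightarrow> 'a^4^4"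
  where "pfaffian_adjoint X = vector [vector [0, - X $ 3 $ 4, X $ 2 $ 4, - X $ 2 $ 3],
    vector [X $ 3 $ 4, 0, - X $ 1 $ 4, X $ 1 $ 3],
    vector [- X $ 2 $ 4, X $ 1 $ 4, 0, - X $ 1 $ 2],
    vector [X $ 2 $ 3, - X $ 1 $ 3, X $ 1 $ 2, 0]]"

lemma gram_alternating: "gram X $ i $ i = 0" "gram X $ i $ j = - gram X $ j $ i"
  by (simp_all add: gram_nth algebra_simps)

lemma pfaffian_adjoint_mult_gram:
  assumes "det X = 1"
  shows "pfaffian_adjoint (gram X) ** gram X = mat 1"
proof -
  define G where "G = gram X"
  have z: "G $ i $ i = 0" for i by (simp add: G_def gram_alternating)
  have a: "G $ 2 $ 1 = - G $ 1 $ 2" "G $ 3 $ 1 = - G $ 1 $ 3" "G $ 4 $ 1 = - G $ 1 $ 4"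
    "G $ 3 $ 2 = - G $ 2 $ 3" "G $ 4 $ 2 = - G $ 2 $ 4" "G $ 4 $ 3 = - G $ 3 $ 4"
    unfolding G_def by (rule gram_alternating)+
  have p: "G $ 1 $ 2 * G $ 3 $ 4 - G $ 1 $ 3 * G $ 2 $ 4 + G $ 1 $ 4 * G $ 2 $ 3 = 1"
    using pfaffian_gram[of X] by (simp add: assms pfaffian_def G_def)
  have "pfaffian_adjoint G ** G = mat 1"
    unfolding vec_eq_iff forall_4 matrix_matrix_mult_def sum_4 mat_def
    by (simp add: pfaffian_adjoint_def z a) (use p in \<open>simp add: algebra_simps\<close>)
  then show ?thesis by (simp add: G_def)
qed

text \<open>Together with the preceding lemma this gives a two-sided inverse of X.\<close>

lemma mult_pfaffian_adjoint:
  assumes "det X = 1"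
  shows "X ** (pfaffian_adjoint (gram X) ** transpose X ** symplectic) = mat 1"
proof -
  have "X ** pfaffian_adjoint (gram X) ** transpose X ** symplectic = (\<chi> i j. if i = j then det X else 0)"
    unfolding vec_eq_iff forall_4 matrix_matrix_mult_def sum_4 det_4
    by (simp add: pfaffian_adjoint_def symplectic_def transpose_def gram_nth) (simp add: algebra_simps)
  also have "\<dots> = mat 1" unfolding assms mat_def ..
  finally show ?thesis by (simp only: matrix_mul_assoc)
qed

text \<open>Let \<open>m = X $ p $ q\<close>. After division by m, the columns p and q are \<open>e\<^sub>1\<close> and \<open>m e\<^sub>2\<close>, the
  column r is \<open>e\<^sub>3\<close> corrected by a combination of \<open>e\<^sub>1\<close> and \<open>e\<^sub>2\<close>, and the column s is a
  multiple of \<open>e\<^sub>4\<close> corrected likewise. Symplectic Gram-Schmidt determines the coefficients so that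
  the resulting vectors have Gram matrix X. Multiplying by m keeps the entries polynomial, at the cost
  of a factor \<open>m\<^sup>2\<close> in the Gram matrix.\<close>

definition section_matrix :: "'a::comm_ring_1^4^4 \<Rightarrow> 4 \<Rightarrow> 4 \<Rightarrow> 4 \<Rightarrow> 4 \<Rightarrow> 'a^4^4"
  where "section_matrix X p q r s = (\<chi> i j. (
    if j = p then vector [X $ p $ q, 0, 0, 0]
    else if j = q then vector [0, (X $ p $ q)\<^sup>2, 0, 0]
    else if j = r then vector [- X $ q $ r, X $ p $ q * X $ p $ r, X $ p $ q, 0]
    else vector [- X $ q $ s, X $ p $ q * X $ p $ s, 0,
      X $ p $ q * X $ r $ s - X $ p $ r * X $ q $ s + X $ p $ s * X $ q $ r]) $ i)"

text \<open>One chart for each of the three terms of the Pfaffian.\<close>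

definition charts :: "(4 \<times> 4 \<times> 4 \<times> 4) set"
  where "charts = {(1, 2, 3, 4), (1, 3, 2, 4), (1, 4, 2, 3)}"

lemma gram_section_matrix:
  assumes "(p, q, r, s) \<in> charts"
  shows "gram (section_matrix (gram X) p q r s) $ i $ j = (gram X $ p $ q)\<^sup>2 * gram X $ i $ j"
proof -
  define G where "G = gram X"
  have z: "G $ i $ i = 0" for i by (simp add: G_def gram_alternating)
  have a: "G $ 2 $ 1 = - G $ 1 $ 2" "G $ 3 $ 1 = - G $ 1 $ 3" "G $ 4 $ 1 = - G $ 1 $ 4"
    "G $ 3 $ 2 = - G $ 2 $ 3" "G $ 4 $ 2 = - G $ 2 $ 4" "G $ 4 $ 3 = - G $ 3 $ 4"
    unfolding G_def by (rule gram_alternating)+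
  have "\<forall>i j. gram (section_matrix G p q r s) $ i $ j = (G $ p $ q)\<^sup>2 * G $ i $ j"
    using assms unfolding forall_4 gram_nth charts_def
    by (elim insertE emptyE; clarify; simp add: section_matrix_def z a power2_eq_square)
      (simp_all add: algebra_simps)
  then show ?thesis by (simp add: G_def)
qed

text \<open>Multiplying by \<open>a x + b y + c z = 1\<close> raises the total degree of the monomials in a, b, c in
  front of f, and once the degree is \<open>3 n\<close> one of the three exponents is at least n.\<close>

lemma partition_of_unity_closed:
  fixes V :: "'a::comm_ring_1 set"
  assumes add: "\<And>x y. x \<in> V \<Longrightarrow> y \<in> V \<Longrightarrow> x + y \<in> V"
    and mult: "\<And>x y. x \<in> V \<Longrightarrow> y \<in> V \<Longrightarrow> x * y \<in> V"
    and V: "a \<in> V" "b \<in> V" "c \<in> V" "x \<in> V" "y \<in> V" "z \<in> V" "1 \<in> V"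
    and unity: "a * x + b * y + c * z = 1"
    and f: "a ^ n * f \<in> V" "b ^ n * f \<in> V" "c ^ n * f \<in> V"
  shows "f \<in> V"
proof -
  have pow: "u ^ k \<in> V" if "u \<in> V" for u k
    by (induction k) (simp_all add: V mult that)
  have "(\<forall>i j k. K \<le> i + j + k \<longrightarrow> a ^ i * b ^ j * c ^ k * f \<in> V) \<Longrightarrow> f \<in> V" for K
  proof (induction K)
    case 0
    then have "a ^ 0 * b ^ 0 * c ^ 0 * f \<in> V" by blast
    then show ?case by simp
  next
    case (Suc K)
    have "a ^ i * b ^ j * c ^ k * f \<in> V" if "K \<le> i + j + k" for i j k
    proof -
      have "a ^ i * b ^ j * c ^ k * f = (a * x + b * y + c * z) * (a ^ i * b ^ j * c ^ k * f)"
        by (simp add: unity)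
      also have "\<dots> = x * (a ^ Suc i * b ^ j * c ^ k * f) + y * (a ^ i * b ^ Suc j * c ^ k * f) +
          z * (a ^ i * b ^ j * c ^ Suc k * f)"
        by (simp add: algebra_simps)
      also have "\<dots> \<in> V"
        by (intro add mult[OF V(4)] mult[OF V(5)] mult[OF V(6)])
          (rule Suc.prems[rule_format], use that in simp)+
      finally show ?thesis .
    qed
    then show ?case using Suc.IH by blast
  qed
  moreover have "a ^ i * b ^ j * c ^ k * f \<in> V" if "3 * n \<le> i + j + k" for i j k
  proof -
    have "n \<le> i \<or> n \<le> j \<or> n \<le> k" using that by arith
    then consider "n \<le> i" | "n \<le> j" | "n \<le> k" by blast
    then show ?thesis
    proof cases
      case 1
      then have "a ^ i * b ^ j * c ^ k * f = a ^ (i - n) * b ^ j * c ^ k * (a ^ n * f)"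
        using power_add[of a "i - n" n] by (simp add: mult_ac)
      then show ?thesis by (simp add: mult pow V f)
    next
      case 2
      then have "a ^ i * b ^ j * c ^ k * f = a ^ i * b ^ (j - n) * c ^ k * (b ^ n * f)"
        using power_add[of b "j - n" n] by (simp add: mult_ac)
      then show ?thesis by (simp add: mult pow V f)
    next
      case 3
      then have "a ^ i * b ^ j * c ^ k * f = a ^ i * b ^ j * c ^ (k - n) * (c ^ n * f)"
        using power_add[of c "k - n" n] by (simp add: mult_ac)
      then show ?thesis by (simp add: mult pow V f)
    qed
  qed
  ultimately show ?thesis by blast
qed

section \<open>Invariants of the symplectic group\<close>

text \<open>A map modulo an ideal is described by a map out of the polynomial algebra, on which algebra maps
  can be prescribed freely. It descends to \<open>Sp(2)\<close> as soon as it respects the relations.\<close>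

lemma relations_into_ideal:
  assumes crmap: "crmap \<phi>"
    and det: "\<phi> (det A_m - 1) \<in> ideal_of G"
    and rel: "\<And>i j. \<phi> (- eps i * gram A_m $ flip i $ j - (if i = j then 1 else 0)) \<in> ideal_of G"
    and p: "abs_sp2 (abs_sl2h p) = 0"
  shows "\<phi> p \<in> ideal_of G"
proof -
  note r = crmapD[OF crmap]
  have sl: "\<phi> q \<in> ideal_of G" if "abs_sl2h q = 0" for q
  proof -
    have "abs_sl2h q = abs_sl2h 0"
      using that by (simp only: crmapD[OF crmap_abs_sl2h])
    then have "q - 0 \<in> ideal_of {det A_m - 1}"
      by (simp only: abs_sl2h_eq_iff sl_ideal_def)
    then have "\<phi> (q - 0) \<in> ideal_of G"
      by (rule crmap_ideal[OF crmap, rotated]) (simp only: singleton_iff det)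
    then show ?thesis by (simp only: diff_zero)
  qed
  have "\<forall>q. abs_sl2h q = x \<longrightarrow> \<phi> q \<in> ideal_of G" if "x \<in> ideal_of {sp_relation i j | i j. True}" for x
    using that
  proof (induction rule: rmod.span_induct_alt)
    case base
    then show ?case using sl by blast
  next
    case (step c x y)
    then obtain i j where x: "x = sp_relation i j" by blast
    define c' where "c' = rep_sl2h c"
    define x' where "x' = - eps i * gram A_m $ flip i $ j - (if i = j then 1 else 0)"
    have c': "abs_sl2h c' = c"
      unfolding c'_def using Quotient3_abs_rep[OF Quotient3_sl2h] .
    have "abs_sl2h (eps i) = eps i"
      using exhaust_4[of i] by (auto simp: crmapD[OF crmap_abs_sl2h])
    then have x': "abs_sl2h x' = x"
      unfolding x x'_def sp_relation_def star_A_A_eq_gram_A gram_A_def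
      by (simp add: crmapD[OF crmap_abs_sl2h] crmap_gram[OF crmap_abs_sl2h] A_mat_def A_sl_def)
    show ?case
    proof (intro allI impI)
      fix q
      assume "abs_sl2h q = c * x + y"
      then have "abs_sl2h (q - c' * x') = y"
        by (simp add: crmapD[OF crmap_abs_sl2h] c' x')
      then have "\<phi> (q - c' * x') \<in> ideal_of G" using step by blast
      moreover have "\<phi> c' * \<phi> x' \<in> ideal_of G"
        unfolding x'_def by (rule rmod.span_scale[OF rel])
      ultimately have "\<phi> (q - c' * x') + \<phi> c' * \<phi> x' \<in> ideal_of G"
        by (rule rmod.span_add)
      then show "\<phi> q \<in> ideal_of G" by (simp add: r)
    qed
  qed
  moreover have "abs_sl2h p \<in> ideal_of {sp_relation i j | i j. True}"
    using p abs_sp2_eq_iff[of "abs_sl2h p" 0] by (simp add: crmapD[OF crmap_abs_sp2] sp_ideal_def)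
  ultimately show ?thesis by blast
qed

lemma subspace_ideal_of: "cvs.subspace (ideal_of (G :: 'a::complex_algebra set))"
proof (rule cvs.subspaceI)
  fix c and x :: 'a
  assume "x \<in> ideal_of G"
  from rmod.span_scale[OF this, of "c *\<^sub>C 1"] show "c *\<^sub>C x \<in> ideal_of G"
    by (simp add: cscale_mult_left)
qed (simp_all add: rmod.span_zero rmod.span_add)

text \<open>Read geometrically: if f is invariant under \<open>Sp\<^sub>4\<close> and k is a point of \<open>Sp\<^sub>4\<close>, then
  \<open>f (k A) = f A\<close>. Here k is symplectic only modulo the ideal generated by G, as will be needed for
  a point k that has denominators.\<close>

lemma coinvariant_translation:
  fixes k :: "'r::complex_algebra^4^4" and \<iota> :: "sl2h \<Rightarrow> 'r" and G :: "'r set"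
  assumes inv: "left_coact (abs_sl2h p) = 1 \<boxtimes> abs_sl2h p"
    and \<iota>: "crmap \<iota>" "clinear \<iota>"
    and det: "det k - 1 \<in> ideal_of G"
    and symplectic: "\<And>i j. gram k $ i $ j - symplectic $ i $ j \<in> ideal_of G"
  shows "eval_matrix (k ** (\<chi> i j. \<iota> (A_mat $ i $ j))) p - \<iota> (abs_sl2h p) \<in> ideal_of G"
proof (rule ccontr)
  define \<phi> where "\<phi> = eval_matrix k"
  have \<phi>: "crmap \<phi>" "clinear \<phi>"
    by (simp_all add: \<phi>_def crmap_eval_matrix clinear_eval_matrix)
  have kills: "\<phi> q \<in> ideal_of G" if "abs_sp2 (abs_sl2h q) = 0" for q
  proof (rule relations_into_ideal[OF \<phi>(1) _ _ that])
    show "\<phi> (det A_m - 1) \<in> ideal_of G"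
      using det by (simp add: crmapD[OF \<phi>(1)] \<phi>_def eval_matrix_det crmapD[OF crmap_eval_matrix])
    fix i j :: 4
    have "\<phi> (eps i) = eps i"
      using exhaust_4[of i] by (auto simp: crmapD[OF \<phi>(1)])
    moreover have "\<phi> (gram A_m $ flip i $ j) = gram k $ flip i $ j"
      by (simp add: crmap_gram[OF \<phi>(1)]) (simp add: \<phi>_def eval_matrix_A)
    moreover have "- eps i * symplectic $ flip i $ j = (if i = j then 1 else 0 :: 'r)"
      by (simp add: symplectic_def eps_flip eps_eps)
    ultimately have "\<phi> (- eps i * gram A_m $ flip i $ j - (if i = j then 1 else 0))
        = - eps i * (gram k $ flip i $ j - symplectic $ flip i $ j)"
      by (simp add: crmapD[OF \<phi>(1)] right_diff_distrib)
    then show "\<phi> (- eps i * gram A_m $ flip i $ j - (if i = j then 1 else 0)) \<in> ideal_of G"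
      by (simp only: rmod.span_scale[OF symplectic])
  qed
  assume "eval_matrix (k ** (\<chi> i j. \<iota> (A_mat $ i $ j))) p - \<iota> (abs_sl2h p) \<notin> ideal_of G"
  from separating_functional[OF subspace_ideal_of this]
  obtain l :: "'r \<Rightarrow> complex" where l: "clinear l" "\<And>x. x \<in> ideal_of G \<Longrightarrow> l x = 0"
    and sep: "l (eval_matrix (k ** (\<chi> i j. \<iota> (A_mat $ i $ j))) p - \<iota> (abs_sl2h p)) = 1"
    by blast
  have l_cong: "l (x * z) = l (y * z)" if "x - y \<in> ideal_of G" for x y z
  proof -
    have "(x - y) * z \<in> ideal_of G"
      using rmod.span_scale[OF that, of z] by (simp add: mult.commute)
    from l(2)[OF this] show ?thesis by (simp add: left_diff_distrib clinearD[OF l(1)])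
  qed
  \<comment> \<open>evaluation at k on \<open>Sp(2)\<close>, through a choice of representatives; linear only modulo the ideal\<close>
  define \<rho> where "\<rho> z = \<phi> (rep_sl2h (rep_sp2 z))" for z
  have abs_rep: "abs_sl2h (rep_sl2h x) = x" for x
    using Quotient3_abs_rep[OF Quotient3_sl2h] .
  have \<rho>: "\<rho> z - \<phi> q \<in> ideal_of G" if "z = abs_sp2 (abs_sl2h q)" for z q
  proof -
    have "abs_sp2 (abs_sl2h (rep_sl2h (rep_sp2 z) - q)) = 0"
      by (simp add: crmapD[OF crmap_abs_sl2h] crmapD[OF crmap_abs_sp2] abs_rep abs_rep_sp2 that)
    from kills[OF this] show ?thesis by (simp add: \<rho>_def crmapD[OF \<phi>(1)])
  qed
  define b where "b z y = l (\<rho> z * \<iota> y)" for z y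
  have b: "b (abs_sp2 (abs_sl2h q)) y = l (\<phi> q * \<iota> y)" for q y
    unfolding b_def by (rule l_cong[OF \<rho>[OF refl]])
  have bi: "cbilinear b"
  proof (rule cbilinearI)
    fix x y :: sp2 and z c
    obtain q r where q: "x = abs_sp2 (abs_sl2h q)" and r: "y = abs_sp2 (abs_sl2h r)"
      by (metis abs_rep abs_rep_sp2)
    show "b (x + y) z = b x z + b y z" "b (c *\<^sub>C x) z = c *\<^sub>C b x z"
      unfolding q r
      by (simp_all add: b clinearD[OF \<phi>(2)] clinearD[OF l(1)] distrib_right cscale_mult_left
          flip: clinearD(1,2)[OF clinear_abs_sp2] clinearD(1,2)[OF clinear_abs_sl2h])
  qed (simp_all add: b_def clinearD[OF \<iota>(2)] clinearD[OF l(1)] distrib_left cscale_mult_right)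
  define M where "M = k ** (\<chi> i j. \<iota> (A_mat $ i $ j))"
  \<comment> \<open>contracting the coaction with b substitutes \<open>k A\<close> for A\<close>
  have eq: "tensor_lift b (left_coact (abs_sl2h q)) = l (eval_matrix M q)" for q
  proof (rule clinear_eq_on_cspan[OF _ _ _ m2h_cspan])
    show "clinear (\<lambda>q. tensor_lift b (left_coact (abs_sl2h q)))" "clinear (\<lambda>q. l (eval_matrix M q))"
      by (intro clinear_comp[OF clinear_comp[OF clinear_abs_sl2h clinear_left_coact] clinear_tensor_lift[OF bi]]
          clinear_comp[OF clinear_eval_matrix l(1)])+
    fix s
    assume "s \<in> {entry_prod A_m I J | I J. length I = length J}"
    then obtain I J where s: "s = entry_prod A_m I J" and len: "length I = length J" by blast
    have "left_coact (abs_sl2h s) =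
      (\<Sum>K | length K = length I. abs_sp2 (entry_prod A_mat I K) \<boxtimes> entry_prod A_mat K J)"
      by (simp add: s abs_entry_prod[OF len] left_coact_def comult_entry_prod[OF len]
          clinearD[OF clinear_tensor_map[OF clinear_abs_sp2 clinear_id]]
          tensor_map_pure[OF clinear_abs_sp2 clinear_id])
    then have "tensor_lift b (left_coact (abs_sl2h s)) =
      (\<Sum>K | length K = length I. b (abs_sp2 (abs_sl2h (entry_prod A_m I K))) (entry_prod A_mat K J))"
      by (simp add: clinearD[OF clinear_tensor_lift[OF bi]] tensor_lift_pure[OF bi] abs_entry_prod)
    also have "\<dots> = l (\<Sum>K | length K = length I. \<phi> (entry_prod A_m I K) * \<iota> (entry_prod A_mat K J))"
      by (simp add: b clinearD[OF l(1)])
    also have "(\<Sum>K | length K = length I. \<phi> (entry_prod A_m I K) * \<iota> (entry_prod A_mat K J)) =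
        (\<Sum>K | length K = length I. entry_prod k I K * entry_prod (\<chi> i j. \<iota> (A_mat $ i $ j)) K J)"
      by (intro sum.cong refl arg_cong2[of _ _ _ _ "(*)"] crmap_entry_prod[OF \<phi>(1)] crmap_entry_prod[OF \<iota>(1)])
        (use len in \<open>auto simp: \<phi>_def eval_matrix_A\<close>)
    also have "\<dots> = entry_prod M I J"
      unfolding M_def by (rule entry_prod_matrix_mult[OF len, symmetric])
    also have "\<dots> = eval_matrix M s"
      unfolding s by (rule crmap_entry_prod[OF crmap_eval_matrix len, symmetric]) (rule eval_matrix_A)
    finally show "tensor_lift b (left_coact (abs_sl2h s)) = l (eval_matrix M s)" .
  qed
  have "l (eval_matrix M p) = b 1 (abs_sl2h p)"
    by (simp add: inv tensor_lift_pure[OF bi] flip: eq)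
  also have "\<dots> = l (\<iota> (abs_sl2h p))"
    using b[of 1 "abs_sl2h p"]
    by (simp add: crmapD[OF crmap_abs_sl2h] crmapD[OF crmap_abs_sp2] crmapD[OF \<phi>(1)])
  finally show False
    using sep by (simp add: clinearD[OF l(1)] flip: M_def)
qed

text \<open>Modulo \<open>m T - 1\<close> the variable T stands for \<open>1 / m\<close>. This is the result of that
  substitution multiplied by \<open>m ^ n\<close>. The exponent \<open>n - k\<close> is truncated, so it has this meaning only
  for n at least the degree.\<close>

definition dehomogenise :: "'a::complex_algebra \<Rightarrow> nat \<Rightarrow> (nat \<Rightarrow>\<^sub>0 'a) \<Rightarrow> 'a"
  where "dehomogenise m n u = (\<Sum>k\<in>Poly_Mapping.keys u. m ^ (n - k) * Poly_Mapping.lookup u k)"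

lemma clinear_dehomogenise: "clinear (dehomogenise m n)"
  unfolding dehomogenise_def[abs_def]
  by (rule clinear_sum_keys, rule clinearI) (simp_all add: distrib_left cscale_mult_right)

lemma dehomogenise_single: "dehomogenise m n (Poly_Mapping.single k a) = m ^ (n - k) * a"
  unfolding dehomogenise_def by (rule sum_keys_single) simp

lemma dehomogenise_ideal:
  assumes "u \<in> ideal_of {Poly_Mapping.single 1 m - 1}"
  shows "\<exists>N. \<forall>n\<ge>N. dehomogenise m n u = 0"
proof -
  note d = clinearD[OF clinear_dehomogenise]
  obtain q where u: "u = q * (Poly_Mapping.single 1 m - 1)"
    using assms by (auto simp: rmod.span_singleton)
  show ?thesis
    unfolding u
  proof (induction q rule: poly_mapping_single_induct)
    case zero
    show ?case by (simp add: d)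
  next
    case (single_plus k c p)
    then obtain N where N: "\<forall>n\<ge>N. dehomogenise m n (p * (Poly_Mapping.single 1 m - 1)) = 0" by blast
    have "dehomogenise m n (Poly_Mapping.single k c * (Poly_Mapping.single 1 m - 1)) = 0" if "Suc k \<le> n" for n
    proof -
      have "Poly_Mapping.single k c * (Poly_Mapping.single 1 m - 1)
          = Poly_Mapping.single (Suc k) (c * m) - Poly_Mapping.single k c"
        by (simp add: right_diff_distrib mult_single)
      moreover have "n - k = Suc (n - Suc k)" using that by simp
      ultimately show ?thesis
        by (simp add: d dehomogenise_single mult_ac)
    qed
    with N have "\<forall>n\<ge>max N (Suc k). dehomogenise m n ((Poly_Mapping.single k c + p) * (Poly_Mapping.single 1 m - 1)) = 0"
      by (simp add: distrib_right d)
    then show ?case by blast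
  qed
qed

lemma single_power_ideal:
  fixes m :: "'a::complex_algebra"
  shows "Poly_Mapping.single k (m ^ k) - 1 \<in> ideal_of {Poly_Mapping.single (1::nat) m - 1}"
proof (induction k)
  case 0
  show ?case by (simp add: rmod.span_zero)
next
  case (Suc k)
  have "Poly_Mapping.single (Suc k) (m ^ Suc k) - 1 =
    Poly_Mapping.single 1 m * (Poly_Mapping.single k (m ^ k) - 1) + (Poly_Mapping.single 1 m - 1)"
    by (simp add: right_diff_distrib mult_single)
  then show ?case
    by (simp only: rmod.span_add[OF rmod.span_scale[OF Suc] rmod.span_base[OF singletonI]])
qed

lemma entry_prod_single:
  assumes "length I = length J" "\<And>i j. X $ i $ j = Poly_Mapping.single 1 (Y $ i $ j)"
  shows "entry_prod X I J = Poly_Mapping.single (length I) (entry_prod Y I J)"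
  using assms(1) by (induction I J rule: list_induct2) (simp_all add: assms(2) mult_single)

lemma gram_algebra_power: "x \<in> gram_algebra \<Longrightarrow> x ^ n \<in> gram_algebra"
  by (induction n) (simp_all add: gram_algebra_closed)

lemma section_matrix_gram_A_in: "section_matrix gram_A p q r s $ i $ j \<in> gram_algebra"
  using exhaust_4[of i]
  by (auto simp: section_matrix_def gram_algebra_closed gram_algebra_power)

text \<open>Where \<open>m = gram_A $ p $ q\<close> does not vanish, the matrix \<open>S / m\<close> built from the Gram matrix by
  \<open>section_matrix\<close> has the same Gram matrix as A, so it differs from A by the symplectic matrix
  \<open>(S / m) A\<^sup>-\<^sup>1\<close>. An invariant f thus takes the same value at A and at \<open>S / m\<close>, which is a
  polynomial in the Gram entries and \<open>1 / m\<close>. A polynomial variable T in place of \<open>1 / m\<close> keeps track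
  of the powers of m to be cleared.\<close>

lemma coinvariant_on_chart:
  assumes inv: "left_coact f = 1 \<boxtimes> f" and chart: "(p, q, r, s) \<in> charts"
  shows "\<exists>N. \<forall>n\<ge>N. (gram_A $ p $ q) ^ n * f \<in> gram_algebra"
proof -
  define m where "m = gram_A $ p $ q"
  define G where "G = {Poly_Mapping.single (1::nat) m - 1}"
  \<comment> \<open>the inverse of A\<close>
  define N where "N = pfaffian_adjoint gram_A ** transpose A_mat ** symplectic"
  have NA: "N ** A_mat = mat 1"
    using pfaffian_adjoint_mult_gram[OF det_A_mat]
    by (simp add: N_def gram_A_def gram_def matrix_mul_assoc)
  have AN: "A_mat ** N = mat 1"
    using mult_pfaffian_adjoint[OF det_A_mat] by (simp add: N_def gram_A_def)
  \<comment> \<open>k is m times the symplectic matrix \<open>(S / m) A\<^sup>-\<^sup>1\<close>; with T for \<open>1 / m\<close>, kT is that matrix\<close>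
  define S where "S = section_matrix gram_A p q r s"
  define k where "k = S ** N"
  define kT where "kT = (\<chi> i j. Poly_Mapping.single (1::nat) (k $ i $ j))"
  have gramS: "gram S $ i $ j = m\<^sup>2 * gram_A $ i $ j" for i j
    using gram_section_matrix[OF chart, of A_mat i j] by (simp add: S_def gram_A_def m_def)
  have "gram k $ i $ j = m\<^sup>2 * symplectic $ i $ j" for i j
  proof -
    have "gram S = (\<chi> i j. m\<^sup>2 * gram_A $ i $ j)" by (simp add: vec_eq_iff gramS)
    then have "gram k = transpose N ** (\<chi> i j. m\<^sup>2 * gram_A $ i $ j) ** N"
      by (simp add: k_def gram_mult)
    then have "gram k $ i $ j = m\<^sup>2 * (transpose N ** gram_A ** N) $ i $ j"
      by (simp add: matrix_matrix_mult_def sum_distrib_left sum_distrib_right mult_ac)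
    also have "transpose N ** gram_A ** N = gram (A_mat ** N)" by (simp add: gram_mult gram_A_def)
    also have "\<dots> = symplectic" by (simp add: AN gram_def transpose_mat)
    finally show ?thesis .
  qed
  then have gram_kT: "gram kT $ i $ j = Poly_Mapping.single 2 (m\<^sup>2 * symplectic $ i $ j)" for i j
    by (simp add: gram_nth kT_def mult_single numeral_2_eq_2 flip: single_add single_diff)
  have "gram kT $ i $ j - symplectic $ i $ j = symplectic $ i $ j * (Poly_Mapping.single 2 (m\<^sup>2) - 1)" for i j
  proof -
    have "Poly_Mapping.single (0::nat) (eps i :: sl2h) = eps i"
      using exhaust_4[of i] by (auto simp: single_uminus)
    then have "(symplectic $ i $ j :: nat \<Rightarrow>\<^sub>0 sl2h) = Poly_Mapping.single 0 (symplectic $ i $ j)"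
      by (simp add: symplectic_def)
    then show ?thesis
      by (simp add: gram_kT right_diff_distrib mult_single mult.commute numeral_2_eq_2)
  qed
  then have symplectic: "gram kT $ i $ j - symplectic $ i $ j \<in> ideal_of G" for i j
    unfolding G_def by (simp only: rmod.span_scale[OF single_power_ideal])
  have "det kT = Poly_Mapping.single 4 (m ^ 4)"
    by (simp add: gram_kT symplectic_def mult_single pfaffian_def eval_nat_numeral mult.assoc flip: pfaffian_gram)
  then have det: "det kT - 1 \<in> ideal_of G"
    unfolding G_def by (simp only: single_power_ideal)
  \<comment> \<open>translating A by kT gives \<open>T S\<close>, which depends on A only through its Gram matrix\<close>
  obtain P where P: "f = abs_sl2h P"
    using Quotient3_abs_rep[OF Quotient3_sl2h, of f] by metis
  have lin: "clinear (Poly_Mapping.single (0::nat) :: sl2h \<Rightarrow> _)"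
    by (rule clinearI) (simp_all add: single_add cscale_single)
  define ST where "ST = kT ** (\<chi> i j. Poly_Mapping.single (0::nat) (A_mat $ i $ j))"
  have "ST $ i $ j = Poly_Mapping.single 1 ((k ** A_mat) $ i $ j)" for i j
    by (simp add: ST_def kT_def matrix_matrix_mult_def mult_single single_sum)
  moreover have "k ** A_mat = S"
    by (simp add: k_def NA flip: matrix_mul_assoc)
  ultimately have ST: "ST $ i $ j = Poly_Mapping.single 1 (S $ i $ j)" for i j by simp
  have "eval_matrix ST P - Poly_Mapping.single 0 f \<in> ideal_of G"
    using coinvariant_translation[OF inv[unfolded P] crmap_single_zero lin det symplectic] by (simp add: ST_def P)
  then obtain n0 where n0: "\<forall>n\<ge>n0. dehomogenise m n (eval_matrix ST P - Poly_Mapping.single 0 f) = 0"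
    using dehomogenise_ideal unfolding G_def by blast
  have "dehomogenise m n (eval_matrix ST P) \<in> gram_algebra" for n
    using m2h_cspan[of P]
  proof (induction rule: cspan_induct)
    case (base u)
    then obtain I J where u: "u = entry_prod A_m I J" "length I = length J" by blast
    have "eval_matrix ST u = entry_prod ST I J"
      unfolding u(1) by (rule crmap_entry_prod[OF crmap_eval_matrix u(2)]) (rule eval_matrix_A)
    also have "\<dots> = Poly_Mapping.single (length I) (entry_prod S I J)"
      by (rule entry_prod_single[OF u(2) ST])
    finally have "dehomogenise m n (eval_matrix ST u) = m ^ (n - length I) * entry_prod S I J"
      by (simp add: dehomogenise_single)
    moreover have "entry_prod S I J \<in> gram_algebra"
      using u(2) by (induction I J rule: list_induct2)
        (simp_all add: gram_algebra_closed section_matrix_gram_A_in S_def)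
    ultimately show ?case
      by (simp add: gram_algebra_closed gram_algebra_power m_def)
  qed (simp_all add: clinearD[OF clinear_eval_matrix] clinearD[OF clinear_dehomogenise] gram_algebra_closed)
  moreover have "dehomogenise m n (eval_matrix ST P) = m ^ n * f" if "n \<ge> n0" for n
    using n0 that by (simp add: clinearD[OF clinear_dehomogenise] dehomogenise_single)
  ultimately show ?thesis unfolding m_def by metis
qed

text \<open>The Pfaffian of \<open>gram_A\<close> is \<open>det A = 1\<close>, so the three entries by which the charts are
  localised generate the unit ideal, and the local expressions for f glue.\<close>

lemma coinvariant_in_gram_algebra:
  assumes "left_coact f = 1 \<boxtimes> f"
  shows "f \<in> gram_algebra"
proof -
  have "pfaffian gram_A = 1" by (simp add: gram_A_def pfaffian_gram det_A_mat)
  then have unity: "gram_A $ 1 $ 2 * gram_A $ 3 $ 4 + gram_A $ 1 $ 3 * (- gram_A $ 2 $ 4) + gram_A $ 1 $ 4 * gram_A $ 2 $ 3 = 1"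
    by (simp add: pfaffian_def)
  have c: "(1, 2, 3, 4) \<in> charts" "(1, 3, 2, 4) \<in> charts" "(1, 4, 2, 3) \<in> charts"
    by (simp_all add: charts_def)
  obtain n1 n2 n3 where n: "\<forall>n\<ge>n1. (gram_A $ 1 $ 2) ^ n * f \<in> gram_algebra"
    "\<forall>n\<ge>n2. (gram_A $ 1 $ 3) ^ n * f \<in> gram_algebra" "\<forall>n\<ge>n3. (gram_A $ 1 $ 4) ^ n * f \<in> gram_algebra"
    using c[THEN coinvariant_on_chart[OF assms]] by blast
  show ?thesis
    by (rule partition_of_unity_closed[OF _ _ _ _ _ _ _ _ _ unity, of _ "max n1 (max n2 n3)"])
      (use n in \<open>auto intro: gram_algebra_closed\<close>)
qed

section \<open>Coefficients in the torus algebra\<close>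

lemma hopf_cspan: "(h::hopf) \<in> cspan {Poly_Mapping.single g 1 | g. True}"
proof (induction h rule: poly_mapping_single_induct)
  case (single_plus g c h)
  have "Poly_Mapping.single g (1::complex) \<in> cspan {Poly_Mapping.single g 1 | g. True}"
    by (rule cvs.span_base) blast
  from cvs.span_scale[OF this, of c] have "Poly_Mapping.single g c \<in> cspan {Poly_Mapping.single g 1 | g. True}"
    by (simp add: cscale_single cscale_complex_def)
  then show ?case using single_plus by (rule cvs.span_add)
qed (simp add: cvs.span_zero)

text \<open>An element of the tensor product with the torus algebra is a family of elements of the first
  factor indexed by monomials.\<close>

definition hopf_components :: "(sl2h, hopf) tensor \<Rightarrow> torus \<Rightarrow>\<^sub>0 sl2h"
  where "hopf_components = tensor_lift (\<lambda>a h.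
    \<Sum>g\<in>Poly_Mapping.keys h. Poly_Mapping.single g (Poly_Mapping.lookup h g *\<^sub>C a))"

lemma
  shows clinear_hopf_components: "clinear hopf_components"
    and lookup_hopf_components: "Poly_Mapping.lookup (hopf_components (a \<boxtimes> h)) g = Poly_Mapping.lookup h g *\<^sub>C a"
proof -
  have lin: "clinear (\<lambda>h. \<Sum>g\<in>Poly_Mapping.keys h. Poly_Mapping.single g (Poly_Mapping.lookup h g *\<^sub>C a))"
    for a :: sl2h
    by (rule clinear_sum_keys, rule clinearI)
      (simp_all add: cscale_add_left single_add cscale_single cscale_cscale cscale_complex_def)
  have bi: "cbilinear (\<lambda>(a::sl2h) h. \<Sum>g\<in>Poly_Mapping.keys h. Poly_Mapping.single g (Poly_Mapping.lookup h g *\<^sub>C a))"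
    by (rule cbilinearI; (simp only: clinearD[OF lin])?)
      (simp_all add: cscale_add_right single_add sum.distrib cvs.scale_sum_right cscale_single
        cscale_cscale mult.commute)
  show "clinear hopf_components"
    unfolding hopf_components_def by (rule clinear_tensor_lift[OF bi])
  have "hopf_components (a \<boxtimes> h) = (\<Sum>g\<in>Poly_Mapping.keys h. Poly_Mapping.single g (Poly_Mapping.lookup h g *\<^sub>C a))"
    unfolding hopf_components_def by (rule tensor_lift_pure[OF bi])
  then show "Poly_Mapping.lookup (hopf_components (a \<boxtimes> h)) g = Poly_Mapping.lookup h g *\<^sub>C a"
    by (simp add: lookup_sum lookup_single when_def in_keys_iff)
qed

lemma sum_hopf_components:
  "x = (\<Sum>g\<in>Poly_Mapping.keys (hopf_components x).
    Poly_Mapping.lookup (hopf_components x) g \<boxtimes> Poly_Mapping.single g 1)"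
proof -
  define f :: "(torus \<Rightarrow>\<^sub>0 sl2h) \<Rightarrow> (sl2h, hopf) tensor"
    where "f p = (\<Sum>g\<in>Poly_Mapping.keys p. Poly_Mapping.lookup p g \<boxtimes> Poly_Mapping.single g 1)" for p
  have f: "clinear f"
    unfolding f_def[abs_def] by (rule clinear_sum_keys[OF clinear_left[OF cbilinear_pure_tensor]])
  note fc = clinear_comp[OF clinear_hopf_components f]
  have "x = f (hopf_components x)"
  proof (rule clinear_eq_on_pure[OF clinear_id fc])
    fix a :: sl2h and h :: hopf
    show "a \<boxtimes> h = f (hopf_components (a \<boxtimes> h))"
    proof (rule clinear_eq_on_cspan[OF clinear_right[OF cbilinear_pure_tensor]
          clinear_comp[OF clinear_right[OF cbilinear_pure_tensor] fc] _ hopf_cspan])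
      fix s :: hopf
      assume "s \<in> {Poly_Mapping.single g 1 | g. True}"
      then obtain g where s: "s = Poly_Mapping.single g 1" by blast
      have "hopf_components (a \<boxtimes> s) = Poly_Mapping.single g a"
        by (rule poly_mapping_eqI)
          (simp add: lookup_hopf_components s lookup_single when_def cscale_one)
      then show "a \<boxtimes> s = f (hopf_components (a \<boxtimes> s))"
        using sum_keys_single[of "\<lambda>g x. x \<boxtimes> Poly_Mapping.single g (1::complex)" g a]
        by (simp add: f_def s pure_simps)
    qed
  qed
  then show ?thesis by (simp add: f_def)
qed

definition twisted_left_coact :: "real \<Rightarrow> sl2h \<Rightarrow> (sp2, sl2h) tensor"
  where "twisted_left_coact \<theta> x = tensor_map abs_sp2 (\<lambda>x. x) (twisted_comult \<theta> x)"

lemma clinear_twisted_left_coact: "clinear (twisted_left_coact \<theta>)"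
  unfolding twisted_left_coact_def[abs_def]
  by (rule clinear_comp[OF clinear_twisted_comult clinear_tensor_map[OF clinear_abs_sp2 clinear_id]])

lemma twisted_coinvariant_iff: "twisted_left_coact \<theta> x = 1 \<boxtimes> x \<longleftrightarrow> x \<in> gram_algebra"
proof
  assume "twisted_left_coact \<theta> x = 1 \<boxtimes> x"
  then have "hat (- \<theta>) x \<in> gram_algebra"
    unfolding twisted_left_coact_def braided_coinvariant_iff by (rule coinvariant_in_gram_algebra)
  then have "hat \<theta> (hat (- \<theta>) x) \<in> gram_algebra" by (simp only: hat_gram_algebra)
  then show "x \<in> gram_algebra" using hat_hat_uminus[of "- \<theta>" x] by simp
next
  assume "x \<in> gram_algebra"
  then show "twisted_left_coact \<theta> x = 1 \<boxtimes> x"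
    unfolding twisted_left_coact_def braided_coinvariant_iff
    by (simp add: hat_gram_algebra left_coact_gram_algebra)
qed

text \<open>The coaction acts on the first tensor factor and carries the factor in H along.\<close>

lemma
  shows clinear_\<delta>\<^sub>L: "clinear (\<delta>\<^sub>L \<theta>)"
    and \<delta>\<^sub>L_pure: "\<delta>\<^sub>L \<theta> (a \<boxtimes> h) = tensor_map (\<lambda>b. b) (\<lambda>c. c \<boxtimes> h) (twisted_left_coact \<theta> a)"
proof -
  note tl = clinear_left[OF cbilinear_pure_tensor]
  have cl: "clinear (tensor_map (\<lambda>b::sp2. b) (\<lambda>c::sl2h. c \<boxtimes> h))" for h :: hopf
    by (rule clinear_tensor_map[OF clinear_id tl])
  have map_pure: "tensor_map (\<lambda>b::sp2. b) (\<lambda>c::sl2h. c \<boxtimes> h) (b \<boxtimes> c) = b \<boxtimes> (c \<boxtimes> h)" for h :: hopf and b c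
    by (rule tensor_map_pure[OF clinear_id tl])
  define f where "f a h = tensor_map (\<lambda>b. b) (\<lambda>c. c \<boxtimes> h) (twisted_left_coact \<theta> a)" for a and h :: hopf
  have inner: "tensor_lift (\<lambda>a1 a2. \<Pi>\<^sub>\<theta> a1 \<boxtimes> (a2 \<boxtimes> h)) (braided_coproduct \<theta> a) = f a h" for a and h :: hopf
  proof -
    have bi: "cbilinear (\<lambda>a1 (a2::sl2h). \<Pi>\<^sub>\<theta> a1 \<boxtimes> (a2 \<boxtimes> h))"
      by (rule cbilinearI) (simp_all add: \<Pi>\<^sub>\<theta>_def clinearD[OF clinear_abs_sp2] pure_simps)
    have "tensor_lift (\<lambda>a1 a2. \<Pi>\<^sub>\<theta> a1 \<boxtimes> (a2 \<boxtimes> h)) y =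
        tensor_map (\<lambda>b. b) (\<lambda>c. c \<boxtimes> h) (tensor_map abs_sp2 (\<lambda>x. x) y)"
      for y :: "(sl2h, sl2h) tensor"
      by (rule clinear_eq_on_pure[OF clinear_tensor_lift[OF bi]
            clinear_comp[OF clinear_tensor_map[OF clinear_abs_sp2 clinear_id] cl]])
        (simp only: tensor_lift_pure[OF bi] tensor_map_pure[OF clinear_abs_sp2 clinear_id] map_pure,
          simp only: \<Pi>\<^sub>\<theta>_def)
    then show ?thesis by (simp only: f_def twisted_left_coact_def braided_coproduct_eq)
  qed
  have right: "clinear (\<lambda>h::hopf. tensor_map (\<lambda>b::sp2. b) (\<lambda>c::sl2h. c \<boxtimes> h) y)" for y
  proof (rule clinearI)
    show "tensor_map (\<lambda>b::sp2. b) (\<lambda>c::sl2h. c \<boxtimes> (h + h')) y =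
      tensor_map (\<lambda>b. b) (\<lambda>c. c \<boxtimes> h) y + tensor_map (\<lambda>b. b) (\<lambda>c. c \<boxtimes> h') y" for h h' :: hopf
    proof (induction y rule: tensor_induct)
      case (pure b c)
      show ?case unfolding map_pure by (simp only: pure_simps)
    qed (simp only: clinearD[OF cl] add_ac)
    show "tensor_map (\<lambda>b::sp2. b) (\<lambda>c::sl2h. c \<boxtimes> (k *\<^sub>C h)) y =
      k *\<^sub>C tensor_map (\<lambda>b. b) (\<lambda>c. c \<boxtimes> h) y" for k and h :: hopf
    proof (induction y rule: tensor_induct)
      case (pure b c)
      show ?case unfolding map_pure by (simp only: pure_simps)
    qed (simp only: clinearD[OF cl] cscale_add_right)
  qed
  have bi: "cbilinear f"
    by (rule cbilinearI)
      (simp_all only: f_def clinearD[OF cl] clinearD[OF clinear_twisted_left_coact] clinearD[OF right])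
  have "\<delta>\<^sub>L \<theta> = tensor_lift f"
    by (simp only: \<delta>\<^sub>L_def[abs_def] inner)
  then show "clinear (\<delta>\<^sub>L \<theta>)" "\<delta>\<^sub>L \<theta> (a \<boxtimes> h) = tensor_map (\<lambda>b. b) (\<lambda>c. c \<boxtimes> h) (twisted_left_coact \<theta> a)"
    by (simp_all only: clinear_tensor_lift[OF bi] tensor_lift_pure[OF bi] f_def)
qed

lemma hopf_component_\<delta>\<^sub>L:
  "tensor_map (\<lambda>b. b) (\<lambda>y. Poly_Mapping.lookup (hopf_components y) g) (\<delta>\<^sub>L \<theta> x) =
    twisted_left_coact \<theta> (Poly_Mapping.lookup (hopf_components x) g)"
proof -
  have lk: "clinear (\<lambda>y. Poly_Mapping.lookup (hopf_components y) g)"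
    by (rule clinearI) (simp_all add: clinearD[OF clinear_hopf_components] lookup_add)
  note E = clinear_tensor_map[OF clinear_id lk, where 'b = sp2]
  show ?thesis
  proof (rule clinear_eq_on_pure[OF clinear_comp[OF clinear_\<delta>\<^sub>L E] clinear_comp[OF lk clinear_twisted_left_coact]])
    fix a :: sl2h and h :: hopf
    note tl = clinear_tensor_map[OF clinear_id clinear_left[OF cbilinear_pure_tensor], of h, where 'b = sp2]
    have "tensor_map (\<lambda>b. b) (\<lambda>y. Poly_Mapping.lookup (hopf_components y) g)
        (tensor_map (\<lambda>b. b) (\<lambda>c. c \<boxtimes> h) y) = Poly_Mapping.lookup h g *\<^sub>C y" for y :: "(sp2, sl2h) tensor"
      by (rule clinear_eq_on_pure[OF clinear_comp[OF tl E]])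
        (simp_all add: clinearI cscale_add_right cscale_cscale mult.commute
          tensor_map_pure[OF clinear_id clinear_left[OF cbilinear_pure_tensor]]
          tensor_map_pure[OF clinear_id lk] lookup_hopf_components pure_simps)
    then show "tensor_map (\<lambda>b. b) (\<lambda>y. Poly_Mapping.lookup (hopf_components y) g) (\<delta>\<^sub>L \<theta> (a \<boxtimes> h)) =
      twisted_left_coact \<theta> (Poly_Mapping.lookup (hopf_components (a \<boxtimes> h)) g)"
      by (simp only: \<delta>\<^sub>L_pure lookup_hopf_components clinearD[OF clinear_twisted_left_coact])
  qed
qed

lemma carrier_cobosonisation: "carrier (cobosonisation \<theta> K) = cspan {a \<boxtimes> h | a h. a \<in> K}"
  by (simp add: cobosonisation_def)

text \<open>Taking the coefficient of a monomial commutes with the coaction, so coinvariance can be tested on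
  the coefficients.\<close>

lemma coinvariants_eq: "coinvariants \<theta> = cspan {a \<boxtimes> h | a h. a \<in> gram_algebra}"
proof (intro equalityI subsetI)
  fix x
  assume "x \<in> coinvariants \<theta>"
  then have "\<delta>\<^sub>L \<theta> x = 1 \<boxtimes> x"
    by (simp add: coinvariants_def B_Sp_def cotwist_def comm_alg_def)
  have "Poly_Mapping.lookup (hopf_components x) g \<in> gram_algebra" for g
  proof -
    have lk: "clinear (\<lambda>y. Poly_Mapping.lookup (hopf_components y) g)"
      by (rule clinearI) (simp_all add: clinearD[OF clinear_hopf_components] lookup_add)
    show ?thesis
      using hopf_component_\<delta>\<^sub>L[of g \<theta> x]
      by (simp only: \<open>\<delta>\<^sub>L \<theta> x = _\<close> tensor_map_pure[OF clinear_id lk] flip: twisted_coinvariant_iff[of \<theta>])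
  qed
  then show "x \<in> cspan {a \<boxtimes> h | a h. a \<in> gram_algebra}"
    by (subst sum_hopf_components) (blast intro: cvs.span_sum cvs.span_base)
next
  fix x :: "(sl2h, hopf) tensor"
  assume x: "x \<in> cspan {a \<boxtimes> h | a h. a \<in> gram_algebra}"
  have "\<delta>\<^sub>L \<theta> x = 1 \<boxtimes> x"
  proof (rule clinear_eq_on_cspan[OF clinear_\<delta>\<^sub>L clinear_right[OF cbilinear_pure_tensor] _ x])
    fix s :: "(sl2h, hopf) tensor"
    assume "s \<in> {a \<boxtimes> h | a h. a \<in> gram_algebra}"
    then obtain a h where s: "s = a \<boxtimes> h" and "a \<in> gram_algebra" by blast
    then have "twisted_left_coact \<theta> a = 1 \<boxtimes> a" by (simp only: twisted_coinvariant_iff)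
    then show "\<delta>\<^sub>L \<theta> s = 1 \<boxtimes> s"
      by (simp only: s \<delta>\<^sub>L_pure tensor_map_pure[OF clinear_id clinear_left[OF cbilinear_pure_tensor]])
  qed
  moreover have "x \<in> cspan {a \<boxtimes> h | a h. a \<in> UNIV}"
    using x by (rule set_mp[OF cvs.span_mono, rotated]) blast
  ultimately show "x \<in> coinvariants \<theta>"
    by (simp add: coinvariants_def carrier_cobosonisation B_Sp_def cotwist_def comm_alg_def)
qed

lemma H_F_simps: "\<one>\<^bsub>H_F\<^esub> = 1" "x \<otimes>\<^bsub>H_F\<^esub> y = x * y"
  by (simp_all add: H_F_def comm_alg_def)

lemma gram_cobosonisation_mult:
  assumes x: "x \<in> cspan {a \<boxtimes> h | a h. a \<in> gram_algebra}" and y: "y \<in> cspan {a \<boxtimes> h | a h. a \<in> gram_algebra}"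
  shows "x \<otimes>\<^bsub>braided_tensor \<theta> (B_SL \<theta>) H_F\<^esub> y \<in> cspan {a \<boxtimes> h | a h. a \<in> gram_algebra}"
proof -
  let ?S = "{s \<boxtimes> t | s t. s \<in> {entry_prod gram_A I J | I J. length I = length J} \<and>
    t \<in> {Poly_Mapping.single (g::torus) (1::complex) | g. True}}"
  have sub: "cspan {a \<boxtimes> h | a (h::hopf). a \<in> gram_algebra} \<subseteq> cspan ?S"
    by (rule cvs.span_minimal[OF _ cvs.subspace_span])
      (auto intro: pure_tensor_cspan hopf_cspan simp only: gram_algebra_def)
  have bi: "cbilinear (mult (braided_tensor \<theta> (B_SL \<theta>) H_F))"
    by (intro cbilinear_mult_braided_tensor clinear_coaction cbilinear_mult_B)
  show ?thesis
  proof (rule cbilinear_closed_on_cspan[OF bi cvs.subspace_span _ set_mp[OF sub x] set_mp[OF sub y]])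
    fix s t
    assume "s \<in> ?S" "t \<in> ?S"
    then obtain I J g I' J' h where s: "s = entry_prod gram_A I J \<boxtimes> Poly_Mapping.single g 1" "length I = length J"
      and t: "t = entry_prod gram_A I' J' \<boxtimes> Poly_Mapping.single h 1" "length I' = length J'" by blast
    have "entry_prod gram_A I J \<otimes>\<^bsub>B_SL \<theta>\<^esub> entry_prod gram_A I' J' \<in> gram_algebra"
      using is_subalgebra_gram_algebra[of \<theta>] s(2) t(2) by (simp add: is_subalgebra_def entry_prod_gram_A_in)
    then have "(entry_prod gram_A I J \<otimes>\<^bsub>B_SL \<theta>\<^esub> entry_prod gram_A I' J') \<boxtimes>
        (Poly_Mapping.single g 1 \<otimes>\<^bsub>H_F\<^esub> Poly_Mapping.single h 1) \<in> cspan {a \<boxtimes> h | a h. a \<in> gram_algebra}"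
      by (intro cvs.span_base) blast
    then show "s \<otimes>\<^bsub>braided_tensor \<theta> (B_SL \<theta>) H_F\<^esub> t \<in> cspan {a \<boxtimes> h | a h. a \<in> gram_algebra}"
      unfolding s(1) t(1) braided_tensor_mult[OF clinear_coaction(1) cbilinear_mult_B(1) clinear_coaction(3)
          cbilinear_mult_B(3) homogeneous_of_bihomogeneous[OF bihomogeneous_entry_prod_gram_A[OF t(2)]] homogeneous_H_F]
      by (rule cvs.span_scale)
  qed
qed

theorem proposition7p3:
  fixes \<theta> :: real
  shows "is_subalgebra (coinvariants \<theta>) (cobosonisation \<theta> (carrier (B_SL \<theta>))) \<and>
    is_subalgebra (carrier (cobosonisation \<theta> (B_M \<theta>))) (cobosonisation \<theta> (carrier (B_SL \<theta>))) \<and>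
    (\<exists>\<phi>. \<phi> \<in> algebra_iso
      ((cobosonisation \<theta> (carrier (B_SL \<theta>)))\<lparr>carrier := coinvariants \<theta>\<rparr>)
      (cobosonisation \<theta> (B_M \<theta>)))"
proof -
  define K :: "(sl2h, hopf) tensor set" where "K = cspan {a \<boxtimes> h | a h. a \<in> gram_algebra}"
  have coinv: "coinvariants \<theta> = K" and M: "carrier (cobosonisation \<theta> (B_M \<theta>)) = K"
    by (simp_all add: K_def coinvariants_eq carrier_cobosonisation B_M_eq_gram_algebra)
  have "K \<subseteq> cspan {a \<boxtimes> h | a h. a \<in> UNIV}"
    unfolding K_def by (rule cvs.span_mono) blast
  moreover have "1 \<boxtimes> 1 \<in> K"
    unfolding K_def using one_in_gram_algebra by (intro cvs.span_base) blast
  ultimately have "is_subalgebra K (cobosonisation \<theta> (carrier (B_SL \<theta>)))"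
    using gram_cobosonisation_mult[of _ _ \<theta>]
    by (simp add: is_subalgebra_def cobosonisation_def H_F_simps K_def cvs.span_add cvs.span_scale)
  moreover have "(\<lambda>x. x) \<in> algebra_iso
      ((cobosonisation \<theta> (carrier (B_SL \<theta>)))\<lparr>carrier := coinvariants \<theta>\<rparr>) (cobosonisation \<theta> (B_M \<theta>))"
    using coinv M by (simp add: algebra_iso_def algebra_hom_def ring_hom_def cobosonisation_def bij_betw_def)
  ultimately show ?thesis unfolding coinv M by blast
qed

end
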